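(* Let $G$ be a real, connected, compact, semisimple Lie group with identity $e$, let $\mathcal{X}$ be a linear vector field on $G$ with linear flow $\varphi_t$, let $X$ be the right invariant vector field associated to $\mathcal{X}$, and let $\mathcal{D}=\operatorname{ad}(X)$ be the derivation associated to $\mathcal{X}$. The following statements are equivalent: (i) for every $g\in G$, the invariant flow $t\mapsto \exp(tX)g$ is periodic; (ii) $e$ is a periodic point of the invariant flow $\exp(tX)$; (iii) every $g\in G$ is a periodic point of the linear flow $\varphi_t$; (iv) for every $g\in G$, $\operatorname{Ad}(g)$ is a periodic point of the flow $e^{t\mathcal{D}}$, i.e. the curve $t\mapsto e^{t\mathcal{D}}\operatorname{Ad}(g)$ is periodic.
   Context: A vector field $\mathcal{X}$ on a Lie group $G$ is called linear if its flow $(\varphi_t)_{t\in\mathbb{R}}$ is a family of automorphisms of the Lie group $G$; $\varphi_t$ is then called the linear flow. Since $G$ is semisimple, there is a right invariant vector field $X$ (identified with an element of the Lie algebra $\mathfrak{g}$) such that $\mathcal{X}=X+I_*X$, where $I_*$ is the differential of the inversion $\mathfrak{i}(g)=g^{-1}$ and $I_*X$ is the associated left invariant vector field; equivalently $\varphi_t(g)=\exp(tX)\,g\,\exp(-tX)$ for all $g\in G$, $t\in\mathbb{R}$. The derivation associated to $\mathcal{X}$ is $\mathcal{D}(Y)=-[\mathcal{X},Y]$, $Y\in\mathfrak{g}$, i.e. $\mathcal{D}=\operatorname{ad}(X)$, and $(d\varphi_t)_e=e^{t\mathcal{D}}$. The invariant flow of $X$ is $g\mapsto\exp(tX)g$.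 A curve $c:\mathbb{R}\to M$ is periodic if there is $s>0$ with $c(t+s)=c(t)$ for all $t$ (constant curves are allowed); a point is a periodic point of a flow if its orbit curve is periodic. *)

theory Defs
  imports "HOL-Analysis.Analysis" "HOL-Library.Function_Algebras"
begin

section \<open>Functions as real vectors\<close>

text \<open>Vector fields are represented below by functions with values in a vector space. The
  pointwise addition comes from HOL-Library; the pointwise scalar multiplication is added here,
  so that the library notions \<^const>\<open>subspace\<close> and \<^const>\<open>span\<close> apply to spaces of
  vector fields.\<close>

instantiation "fun" :: (type, real_vector) real_vector
begin

definition scaleR_fun_def: "r *\<^sub>R f = (\<lambda>x. r *\<^sub>R f x)"

instance
  by standard (auto simp: scaleR_fun_def plus_fun_def fun_eq_iff scaleR_add_right scaleR_add_left)

end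

section \<open>Smooth manifolds\<close>

text \<open>\<open>C\<^sup>k\<close> functions on an open subset of a finite-dimensional space: all iterated
  directional derivatives up to order \<open>k\<close> exist and are continuous.\<close>

fun Ck_on :: "nat \<Rightarrow> 'a::real_normed_vector set \<Rightarrow> ('a \<Rightarrow> 'b::real_normed_vector) \<Rightarrow> bool" where
  "Ck_on 0 S f \<longleftrightarrow> continuous_on S f"
| "Ck_on (Suc k) S f \<longleftrightarrow>
     (\<forall>x\<in>S. f differentiable (at x)) \<and> (\<forall>v. Ck_on k S (\<lambda>x. frechet_derivative f (at x) v))"

definition smooth_on :: "'a::real_normed_vector set \<Rightarrow> ('a \<Rightarrow> 'b::real_normed_vector) \<Rightarrow> bool" where
  "smooth_on S f \<longleftrightarrow> (\<forall>k. Ck_on k S f)"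

text \<open>A chart is a pair of its domain and its coordinate map; the values of the coordinate map
  outside the domain are irrelevant.\<close>

type_synonym ('a, 'e) chart = "'a set \<times> ('a \<Rightarrow> 'e)"

definition chart_inv :: "('a, 'e) chart \<Rightarrow> 'e \<Rightarrow> 'a" where
  "chart_inv c = inv_into (fst c) (snd c)"

definition charts_at :: "('a, 'e) chart set \<Rightarrow> 'a \<Rightarrow> ('a, 'e) chart set" where
  "charts_at A p = {c \<in> A. p \<in> fst c}"

text \<open>The sort of the model space below says that it is a normed space in which bounded sequences
  have convergent subsequences, that is, a normed space of finite dimension. In contrast to
  \<^class>\<open>euclidean_space\<close>, this includes dimension 0.\<close>

definition smooth_atlas ::
  "('a::topological_space, 'e::{banach,heine_borel}) chart set \<Rightarrow> bool" where
  "smooth_atlas A \<longleftrightarrow>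
     (\<Union>c\<in>A. fst c) = UNIV \<and>
     (\<forall>c\<in>A. open (fst c) \<and> open (snd c ` fst c) \<and>
        homeomorphism (fst c) (snd c ` fst c) (snd c) (chart_inv c)) \<and>
     (\<forall>c\<in>A. \<forall>d\<in>A. smooth_on (snd c ` (fst c \<inter> fst d)) (snd d \<circ> chart_inv c))"

definition smooth_map ::
  "('a::topological_space, 'e::real_normed_vector) chart set \<Rightarrow>
   ('b::topological_space, 'f::real_normed_vector) chart set \<Rightarrow> ('a \<Rightarrow> 'b) \<Rightarrow> bool" where
  "smooth_map A B F \<longleftrightarrow>
     continuous_on UNIV F \<and>
     (\<forall>c\<in>A. \<forall>d\<in>B. smooth_on (snd c ` (fst c \<inter> F -` fst d)) (snd d \<circ> F \<circ> chart_inv c))"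

definition product_atlas ::
  "('a, 'e) chart set \<Rightarrow> ('b, 'f) chart set \<Rightarrow> ('a \<times> 'b, 'e \<times> 'f) chart set" where
  "product_atlas A B = {(fst c \<times> fst d, map_prod (snd c) (snd d)) |c d. c \<in> A \<and> d \<in> B}"

section \<open>Tangent vectors and vector fields\<close>

text \<open>A tangent vector at \<open>p\<close> is the family of its coordinate vectors in all charts around \<open>p\<close>,
  which are related by the derivatives of the transition maps. Components for charts not
  containing \<open>p\<close> are set to 0, so that equality of tangent vectors is equality of families.\<close>

type_synonym ('a, 'e) tangent = "('a, 'e) chart \<Rightarrow> 'e"

type_synonym ('a, 'e) vfield = "'a \<Rightarrow> ('a, 'e) tangent"

definition tangent_space ::
  "('a, 'e::real_normed_vector) chart set \<Rightarrow> 'a \<Rightarrow> ('a, 'e) tangent set" where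
  "tangent_space A p =
     {v. (\<forall>c. c \<notin> charts_at A p \<longrightarrow> v c = 0) \<and>
         (\<forall>c\<in>charts_at A p. \<forall>d\<in>charts_at A p.
            v d = frechet_derivative (snd d \<circ> chart_inv c) (at (snd c p)) (v c))}"

text \<open>The differential of \<open>F\<close> at \<open>p\<close>. By the chain rule it does not depend on the chosen chart.\<close>

definition differential ::
  "('a, 'e::real_normed_vector) chart set \<Rightarrow> ('b, 'f::real_normed_vector) chart set \<Rightarrow>
   ('a \<Rightarrow> 'b) \<Rightarrow> 'a \<Rightarrow> ('a, 'e) tangent \<Rightarrow> ('b, 'f) tangent" where
  "differential A B F p v =
     (\<lambda>d. if d \<in> charts_at B (F p)
          then let c = (SOME c. c \<in> charts_at A p)
               in frechet_derivative (snd d \<circ> F \<circ> chart_inv c) (at (snd c p)) (v c)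
          else 0)"

definition vector_field ::
  "('a, 'e::real_normed_vector) chart set \<Rightarrow> ('a, 'e) vfield \<Rightarrow> bool" where
  "vector_field A V \<longleftrightarrow>
     (\<forall>p. V p \<in> tangent_space A p) \<and>
     (\<forall>c\<in>A. smooth_on (snd c ` fst c) (\<lambda>x. V (chart_inv c x) c))"

text \<open>The bracket of vector fields with the sign convention \<open>[V, W] f = V (W f) - W (V f)\<close>,
  written in coordinates as \<open>Dw(v) - Dv(w)\<close>.\<close>

definition lie_bracket ::
  "('a, 'e::real_normed_vector) chart set \<Rightarrow> ('a, 'e) vfield \<Rightarrow> ('a, 'e) vfield \<Rightarrow> ('a, 'e) vfield" where
  "lie_bracket A V W =
     (\<lambda>p c. if c \<in> charts_at A p
            then let v = (\<lambda>x. V (chart_inv c x) c); w = (\<lambda>x. W (chart_inv c x) c); x = snd c p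
                 in frechet_derivative w (at x) (v x) - frechet_derivative v (at x) (w x)
            else 0)"

text \<open>The push-forward of a vector field by a diffeomorphism.\<close>

definition pushforward ::
  "('a, 'e::real_normed_vector) chart set \<Rightarrow> ('a \<Rightarrow> 'a) \<Rightarrow> ('a, 'e) vfield \<Rightarrow> ('a, 'e) vfield" where
  "pushforward A F V = (\<lambda>q. differential A A F (inv F q) (V (inv F q)))"

definition integral_curve ::
  "('a::topological_space, 'e::real_normed_vector) chart set \<Rightarrow> ('a, 'e) vfield \<Rightarrow>
   (real \<Rightarrow> 'a) \<Rightarrow> bool" where
  "integral_curve A V \<gamma> \<longleftrightarrow>
     continuous_on UNIV \<gamma> \<and>
     (\<forall>t. \<forall>c\<in>charts_at A (\<gamma> t). ((\<lambda>s. snd c (\<gamma> s)) has_vector_derivative V (\<gamma> t) c) (at t))"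

definition is_flow ::
  "('a::topological_space, 'e::real_normed_vector) chart set \<Rightarrow> ('a, 'e) vfield \<Rightarrow>
   (real \<Rightarrow> 'a \<Rightarrow> 'a) \<Rightarrow> bool" where
  "is_flow A V \<phi> \<longleftrightarrow> (\<forall>g. \<phi> 0 g = g \<and> integral_curve A V (\<lambda>t. \<phi> t g))"

section \<open>Lie groups\<close>

locale lie_group = group mul one inver
  for mul :: "'a::{t2_space,second_countable_topology} \<Rightarrow> 'a \<Rightarrow> 'a"
    and one :: 'a and inver :: "'a \<Rightarrow> 'a" +
  fixes A :: "('a, 'e::{banach,heine_borel}) chart set"
  assumes smooth_atlas: "smooth_atlas A"
    and smooth_mult: "smooth_map (product_atlas A A) A (\<lambda>(x, y). mul x y)"
    and smooth_inver: "smooth_map A A inver"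

definition lie_automorphism ::
  "('a::topological_space, 'e::real_normed_vector) chart set \<Rightarrow> ('a \<Rightarrow> 'a \<Rightarrow> 'a) \<Rightarrow>
   ('a \<Rightarrow> 'a) \<Rightarrow> bool" where
  "lie_automorphism A mul F \<longleftrightarrow>
     bij F \<and> smooth_map A A F \<and> smooth_map A A (inv F) \<and>
     (\<forall>x y. F (mul x y) = mul (F x) (F y))"

definition linear_vector_field ::
  "('a::topological_space, 'e::real_normed_vector) chart set \<Rightarrow> ('a \<Rightarrow> 'a \<Rightarrow> 'a) \<Rightarrow>
   ('a, 'e) vfield \<Rightarrow> bool" where
  "linear_vector_field A mul V \<longleftrightarrow>
     vector_field A V \<and> (\<exists>\<phi>. is_flow A V \<phi> \<and> (\<forall>t. lie_automorphism A mul (\<phi> t)))"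

text \<open>The Lie algebra is realised by the right invariant vector fields.\<close>

definition lie_algebra ::
  "('a, 'e::real_normed_vector) chart set \<Rightarrow> ('a \<Rightarrow> 'a \<Rightarrow> 'a) \<Rightarrow> ('a, 'e) vfield set" where
  "lie_algebra A mul =
     {X. vector_field A X \<and>
         (\<forall>g h. differential A A (\<lambda>x. mul x h) g (X g) = X (mul g h))}"

definition lie_ideal ::
  "('a, 'e::real_normed_vector) chart set \<Rightarrow> ('a, 'e) vfield set \<Rightarrow> ('a, 'e) vfield set \<Rightarrow> bool" where
  "lie_ideal A L I \<longleftrightarrow> I \<subseteq> L \<and> subspace I \<and> (\<forall>X\<in>L. \<forall>Y\<in>I. lie_bracket A X Y \<in> I)"

definition derived_algebra ::
  "('a, 'e::real_normed_vector) chart set \<Rightarrow> ('a, 'e) vfield set \<Rightarrow> ('a, 'e) vfield set" where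
  "derived_algebra A L = span {lie_bracket A X Y |X Y. X \<in> L \<and> Y \<in> L}"

definition lie_solvable ::
  "('a, 'e::real_normed_vector) chart set \<Rightarrow> ('a, 'e) vfield set \<Rightarrow> bool" where
  "lie_solvable A L \<longleftrightarrow> (\<exists>n. (derived_algebra A ^^ n) L = {0})"

text \<open>Semisimple: the Lie algebra has no nonzero solvable ideals. This is insensitive to the sign
  of the bracket.\<close>

definition lie_semisimple ::
  "('a, 'e::real_normed_vector) chart set \<Rightarrow> ('a \<Rightarrow> 'a \<Rightarrow> 'a) \<Rightarrow> bool" where
  "lie_semisimple A mul \<longleftrightarrow>
     (\<forall>I. lie_ideal A (lie_algebra A mul) I \<and> lie_solvable A I \<longrightarrow> I = {0})"

definition lie_exp ::
  "('a::topological_space, 'e::real_normed_vector) chart set \<Rightarrow> 'a \<Rightarrow> ('a, 'e) vfield \<Rightarrow> 'a" where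
  "lie_exp A one X = (THE g. \<exists>\<gamma>. integral_curve A X \<gamma> \<and> \<gamma> 0 = one \<and> \<gamma> 1 = g)"

definition invariant_flow ::
  "('a::topological_space, 'e::real_normed_vector) chart set \<Rightarrow> ('a \<Rightarrow> 'a \<Rightarrow> 'a) \<Rightarrow> 'a \<Rightarrow>
   ('a, 'e) vfield \<Rightarrow> real \<Rightarrow> 'a \<Rightarrow> 'a" where
  "invariant_flow A mul one X t g = mul (lie_exp A one (t *\<^sub>R X)) g"

text \<open>\<open>Ad g\<close> is the action on the Lie algebra of the differential of conjugation by \<open>g\<close>; it is made
  extensional outside the Lie algebra, so that equality is equality of maps on the Lie algebra.\<close>

definition Ad ::
  "('a, 'e::real_normed_vector) chart set \<Rightarrow> ('a \<Rightarrow> 'a \<Rightarrow> 'a) \<Rightarrow> ('a \<Rightarrow> 'a) \<Rightarrow> 'a \<Rightarrow>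
   ('a, 'e) vfield \<Rightarrow> ('a, 'e) vfield" where
  "Ad A mul inver g =
     restrict (pushforward A (\<lambda>x. mul (mul g x) (inver g))) (lie_algebra A mul)"

text \<open>The derivation \<open>Y \<mapsto> - [\<X>, Y]\<close> associated to a linear vector field. The bracket of right
  invariant vector fields is the opposite of the one transported from the left invariant fields
  through the tangent space at the identity; for the latter, this derivation is \<open>ad X\<close>.\<close>

definition derivation_of ::
  "('a, 'e::real_normed_vector) chart set \<Rightarrow> ('a, 'e) vfield \<Rightarrow> ('a, 'e) vfield \<Rightarrow> ('a, 'e) vfield" where
  "derivation_of A V Y = - lie_bracket A V Y"

text \<open>The exponential series of a linear operator; on vector fields the limit is pointwise
  (the topology of function types is the product topology).\<close>

definition operator_exp ::
  "('v \<Rightarrow> 'v) \<Rightarrow> 'v::{real_vector,topological_space} \<Rightarrow> 'v" where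
  "operator_exp T v = (\<Sum>k. (T ^^ k) v /\<^sub>R fact k)"

text \<open>The flow \<open>(t, F) \<mapsto> e\<^sup>t\<^sup>D \<circ> F\<close> on the maps from \<open>L\<close> to \<open>L\<close>.\<close>

definition derivation_flow ::
  "'v set \<Rightarrow> ('v \<Rightarrow> 'v) \<Rightarrow> real \<Rightarrow> ('v \<Rightarrow> 'v) \<Rightarrow> 'v::{real_vector,topological_space} \<Rightarrow> 'v" where
  "derivation_flow L D t F = compose L (operator_exp (\<lambda>Y. t *\<^sub>R D Y)) F"

definition periodic_curve :: "(real \<Rightarrow> 'b) \<Rightarrow> bool" where
  "periodic_curve c \<longleftrightarrow> (\<exists>s>0. \<forall>t. c (t + s) = c t)"

definition periodic_point :: "(real \<Rightarrow> 'b \<Rightarrow> 'b) \<Rightarrow> 'b \<Rightarrow> bool" where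
  "periodic_point \<Phi> p \<longleftrightarrow> periodic_curve (\<lambda>t. \<Phi> t p)"

end

theory Submission
  imports Defs
begin

text \<open>Write \<open>\<Gamma> t = exp (t X)\<close>, so that \<open>\<phi>\<^sub>t(g) = \<Gamma>(t) g \<Gamma>(t)\<^sup>-\<^sup>1\<close> and \<open>e\<^sup>t\<^sup>D = Ad (\<Gamma> t)\<close>. All
  four statements are equivalent to \<open>\<Gamma> s = e\<close> for some \<open>s > 0\<close>; that this implies them is
  immediate. Conversely, (iv) gives \<open>Ad (\<Gamma> s) = 1\<close> for some \<open>s > 0\<close>. The kernel of \<open>Ad\<close> is
  discrete, because a limit direction of elements of the kernel tending to \<open>e\<close> would span an
  abelian ideal; so in the compact group \<open>G\<close> some \<open>\<Gamma> (n s)\<close> with \<open>n > 0\<close> is \<open>e\<close>. In (iii) the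
  period depends on \<open>g\<close>, but the periods of the elements near \<open>e\<close> turn out to be commensurable.
  By Baire's theorem one \<open>\<Gamma> s\<close> then commutes with an open set, hence with the connected group
  \<open>G\<close>, and again \<open>Ad (\<Gamma> s) = 1\<close>.\<close> 

section \<open>Calculus in finite-dimensional spaces\<close>

text \<open>Membership of \<open>z\<close> in the kernel of \<open>Ad\<close> is used in the form
  \<open>rfield w z = lfield w z\<close> for all \<open>w\<close>, that is, as the vanishing at
  \<open>z\<close> of the field \<open>lfield w - rfield w\<close>. This field is zero at the unit,
  and its derivative there is a bracket up to sign. One computation in a chart thus serves twice:
  for the derivative of \<open>Ad\<close> along \<Gamma>, hence for the exponential series, and for
  the discreteness of the kernel. In (iii), Baire's theorem does not apply at once, because the
  centralizers of all \<open>\<Gamma> s\<close> with \<open>s > 0\<close> form an uncountable cover.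
  Commensurability reduces it to the multiples of a single period. It rests on the fact that a
  closed subgroup of the reals with two incommensurable elements is the whole line.\<close>

text \<open>A finite \<open>1/2\<close>-net of the unit sphere replaces a basis, which the sort of the model space
  does not provide: it turns pointwise convergence of linear maps into convergence in norm.\<close> 

lemma finite_net_unit_sphere:
  obtains N :: "'e::{real_normed_vector,heine_borel} set"
  where "finite N" "\<And>A b x. \<lbrakk>bounded_linear (A :: 'e \<Rightarrow> 'f::real_normed_vector); b \<ge> 0; \<And>n. n \<in> N
    \<Longrightarrow> norm (A n) \<le> b\<rbrakk>
      \<Longrightarrow> norm (A x) \<le> 2 * b * norm x"
proof -
  have "compact (sphere (0::'e) 1)"
    unfolding compact_eq_bounded_closed
  proof
    show "bounded (sphere (0::'e) 1)" by (rule boundedI[where B=1]) simp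
    show "closed (sphere (0::'e) 1)"
      using closed_Collect_eq[of norm "\<lambda>_. 1"] by (simp add: sphere_def continuous_on_norm_id)
  qed
  then obtain N :: "'e set" where N: "finite N" "sphere 0 1 \<subseteq> (\<Union>x\<in>N. ball x (1/2))"
    by (metis compact_imp_seq_compact half_gt_zero_iff seq_compact_imp_totally_bounded
      zero_less_one)
  show ?thesis
  proof
    show "finite N" by fact
    fix A :: "'e \<Rightarrow> 'f" and b x
    assume A: "bounded_linear A" and b: "b \<ge> 0" "\<And>n. n \<in> N \<Longrightarrow> norm (A n) \<le> b"
    interpret A: bounded_linear A by fact
    \<comment> \<open>Replacing \<open>v\<close> by a net point at distance below \<open>1/2\<close>
      costs half of \<open>onorm A\<close>, which is then absorbed on the left.\<close>
    have unit: "norm (A v) \<le> b + onorm A / 2" if v: "norm v = 1" for v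
    proof -
      from v N obtain n where n: "n \<in> N" "dist n v < 1/2" by (auto simp: subset_iff)
      have "norm (A v) \<le> norm (A n) + norm (A (v - n))"
        by (metis A.diff norm_triangle_sub)
      also have "norm (A (v - n)) \<le> onorm A * norm (v - n)" by (rule onorm[OF A])
      also have "\<dots> \<le> onorm A * (1/2)"
        using n(2) onorm_pos_le[OF A] by (intro mult_left_mono)
          (auto simp: dist_norm norm_minus_commute)
      finally show ?thesis using b(2)[OF n(1)] by simp
    qed
    have "onorm A \<le> b + onorm A / 2"
    proof (rule onorm_bound)
      show "0 \<le> b + onorm A / 2" using b(1) onorm_pos_le[OF A] by simp
      fix y :: 'e
      show "norm (A y) \<le> (b + onorm A / 2) * norm y"
      proof (cases "y = 0")
        case False
        have "norm (A (y /\<^sub>R norm y)) \<le> b + onorm A / 2"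
          using False by (intro unit) simp
        then show ?thesis using False by (simp add: A.scaleR field_simps)
      qed (simp add: A.zero)
    qed
    then have "onorm A \<le> 2 * b" by simp
    then show "norm (A x) \<le> 2 * b * norm x"
      using onorm[OF A, of x] by (meson mult_right_mono norm_ge_zero order_trans)
  qed
qed

text \<open>On the finite net pointwise convergence is uniform; the bound \<open>e/2\<close> there
  becomes \<open>e\<close> on all vectors, since the net lemma doubles it.\<close>

lemma eventually_uniform_pointwise_linear:
  fixes A :: "'y \<Rightarrow> 'e::{real_normed_vector,heine_borel} \<Rightarrow> 'f::real_normed_vector"
  assumes lim: "\<And>v. ((\<lambda>y. A y v) \<longlongrightarrow> B v) F"
    and A: "eventually (\<lambda>y. bounded_linear (A y)) F" and B: "bounded_linear B" and "e > 0"
  shows "eventually (\<lambda>y. \<forall>v. norm (A y v - B v) \<le> e * norm v) F"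
proof -
  from finite_net_unit_sphere[where 'e='e and 'f='f] obtain N :: "'e set" where N: "finite N"
    "\<And>A b x. \<lbrakk>bounded_linear (A :: 'e \<Rightarrow> 'f); b \<ge> 0; \<And>n. n \<in> N \<Longrightarrow> norm (A n) \<le> b\<rbrakk>
      \<Longrightarrow> norm (A x) \<le> 2 * b * norm x"
    by metis
  have "eventually (\<lambda>y. \<forall>n\<in>N. norm (A y n - B n) \<le> e/2) F"
  proof (intro eventually_ball_finite[OF N(1)] ballI)
    fix n show "eventually (\<lambda>y. norm (A y n - B n) \<le> e/2) F"
      using tendstoD[OF lim[of n], of "e/2"] \<open>e > 0\<close>
      by (auto simp: dist_norm elim!: eventually_mono)
  qed
  with A show ?thesis
  proof eventually_elim
    case (elim y)
    then show ?case
      using N(2)[of "\<lambda>v. A y v - B v" "e/2"] \<open>e > 0\<close> bounded_linear_sub[OF _ B] by auto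
  qed
qed

text \<open>A product rule for operators that are differentiable vector by vector. The mixed term
  \<open>?E\<close> is negligible: \<open>A y\<close> tends to \<open>A x\<close> uniformly on unit
  vectors, and \<open>V y - V x\<close> is at most linear in \<open>y - x\<close>.\<close>

lemma has_derivative_linear_apply:
  fixes A :: "'y::real_normed_vector \<Rightarrow> 'e::{real_normed_vector,heine_borel} \<Rightarrow>
    'f::real_normed_vector"
  assumes A': "\<And>v. ((\<lambda>y. A y v) has_derivative A' v) (at x)"
    and lin: "eventually (\<lambda>y. bounded_linear (A y)) (at x)" "bounded_linear (A x)"
    and V: "(V has_derivative V') (at x)"
  shows "((\<lambda>y. A y (V y)) has_derivative (\<lambda>h. A' (V x) h + A x (V' h))) (at x)"
proof -
  interpret A: bounded_linear "A x" by fact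
  obtain K where K: "\<And>h. norm (V' h) \<le> norm h * K" "K \<ge> 0"
    using bounded_linear.nonneg_bounded[OF has_derivative_bounded_linear[OF V]] by blast
  have lim: "((\<lambda>y. A y v) \<longlongrightarrow> A x v) (at x)" for v
    using has_derivative_continuous[OF A'[of v]] by (simp add: continuous_within)
  have lip: "eventually (\<lambda>y. norm (V y - V x) \<le> (K + 1) * norm (y - x)) (at x)"
  proof -
    have "eventually (\<lambda>y. norm (V y - V x - V' (y - x)) / norm (y - x) < 1) (at x)"
      using V unfolding has_derivative_iff_norm by (auto dest!: tendstoD[where e=1])
    moreover have "eventually (\<lambda>y. y \<noteq> x) (at x)" by (simp add: eventually_at_filter)
    ultimately show ?thesis
    proof eventually_elim
      case (elim y)
      then have "norm (V y - V x - V' (y - x)) \<le> norm (y - x)" by (simp add: field_simps)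
      moreover have "norm (V' (y - x)) \<le> norm (y - x) * K" by (rule K)
      ultimately show ?case
        using norm_triangle_sub[of "V y - V x" "V' (y - x)"] by (simp add: algebra_simps)
    qed
  qed
  let ?E = "\<lambda>y. A y (V y - V x) - A x (V y - V x)"
  have E: "(?E has_derivative (\<lambda>h. 0)) (at x)"
    unfolding has_derivative_iff_norm
  proof (intro conjI tendstoI)
    fix e :: real assume e: "e > 0"
    \<comment> \<open>\<open>V\<close> has the Lipschitz bound \<open>K + 1\<close> at
      \<open>x\<close>, so \<open>e / (K + 2)\<close> leaves a strict inequality.\<close>
    have "eventually (\<lambda>y. \<forall>v. norm (A y v - A x v) \<le> (e / (K + 2)) * norm v) (at x)"
      by (rule eventually_uniform_pointwise_linear[OF lim lin]) (use e K(2) in simp)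
    moreover have "eventually (\<lambda>y. y \<noteq> x) (at x)" by (simp add: eventually_at_filter)
    ultimately show "eventually (\<lambda>y. dist (norm ((?E y - ?E x) - 0) / norm (y - x)) 0 < e) (at x)"
      using lip
    proof eventually_elim
      case (elim y)
      have "norm (?E y) \<le> (e / (K + 2)) * norm (V y - V x)" using elim(1) by blast
      also have "\<dots> \<le> (e / (K + 2)) * ((K + 1) * norm (y - x))"
        by (intro mult_left_mono elim) (use e K(2) in simp)
      also have "\<dots> < e * norm (y - x)" using e K(2) elim(2) by (simp add: field_simps)
      finally show ?case using elim(2) by (simp add: field_simps A.zero)
    qed
  qed auto
  have 1: "((\<lambda>y. A x (V y - V x)) has_derivative (\<lambda>h. A x (V' h))) (at x)"
    using V by (auto intro!: derivative_eq_intros A.has_derivative)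
  have "((\<lambda>y. A y (V x) + A x (V y - V x) + ?E y) has_derivative (\<lambda>h. A' (V x) h + A x (V' h)
    + 0)) (at x)"
    by (intro has_derivative_add A' 1 E)
  moreover have "eventually (\<lambda>y. A y (V x) + A x (V y - V x) + ?E y = A y (V y)) (at x)"
    using lin(1)
  proof eventually_elim
    case (elim y)
    then interpret Ay: bounded_linear "A y" .
    show ?case by (simp add: Ay.diff)
  qed
  ultimately show ?thesis
    by (rule_tac has_derivative_transform_eventually[where f="\<lambda>y. A y (V x) + A x (V y - V x)
      + ?E y"])
       (auto simp: A.zero A.diff lin)
qed

section \<open>Symmetry of second derivatives and brackets of related fields\<close>

text \<open>The mean value inequality is applied to \<open>f (x + s v + t w) - f (x + s v)\<close>
  as a function of \<open>s\<close>. Its derivative involves \<open>f'\<close> in direction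
  \<open>v\<close> alone, which is approximated by its linearization at \<open>x\<close>.\<close>

lemma second_difference_bound:
  fixes f :: "'a::real_normed_vector \<Rightarrow> 'b::real_normed_vector"
  assumes f: "\<And>y. y \<in> ball x r \<Longrightarrow> (f has_derivative f' y) (at y)" and r: "r > 0"
    and D: "((\<lambda>y. f' y v) has_derivative D) (at x)" and "e > 0"
  shows "eventually (\<lambda>t. norm (f (x + t *\<^sub>R v + t *\<^sub>R w) - f (x + t *\<^sub>R v) - f (x + t *\<^sub>R w)
    + f x - t\<^sup>2 *\<^sub>R D w)
           \<le> e * t\<^sup>2) (at_right 0)"
proof -
  interpret D: bounded_linear D using D by (rule has_derivative_bounded_linear)
  \<comment> \<open>All points that occur are within \<open>t * M\<close> of \<open>x\<close>. Two
    errors of size at most \<open>e' * (t * M)\<close> add up to \<open>e * t\<close>.\<close>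
  define M where "M = norm v + norm w + 1"
  have M: "M > 0" "norm v \<le> M" "norm v + norm w \<le> M" by
    (auto simp: M_def add_pos_nonneg add_nonneg_pos)
  define e' where "e' = e / (2 * M)"
  have e': "e' > 0" using \<open>e > 0\<close> M by (simp add: e'_def)
  from D e' obtain d where d: "d > 0"
    and dd: "\<And>y. norm (y - x) < d \<Longrightarrow> norm (f' y v - f' x v - D (y - x)) \<le> e' * norm (y - x)"
    unfolding has_derivative_at_alt by metis
  define R where "R = min d r / M"
  have R: "R > 0" using d r M by (simp add: R_def)
  have main: "norm (f (x + t *\<^sub>R v + t *\<^sub>R w) - f (x + t *\<^sub>R v) - f (x + t *\<^sub>R w)
    + f x - t\<^sup>2 *\<^sub>R D w) \<le> e * t\<^sup>2"
    if t: "0 < t" "t < R" for t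
  proof -
    let ?h = "\<lambda>s. f (x + s *\<^sub>R v + t *\<^sub>R w) - f (x + s *\<^sub>R v)"
    let ?h' = "\<lambda>s. f' (x + s *\<^sub>R v + t *\<^sub>R w) v - f' (x + s *\<^sub>R v) v"
    have tM: "t * M < min d r" using t M by (simp add: R_def field_simps)
    have near: "norm (s *\<^sub>R v + t *\<^sub>R w) \<le> t * M" "norm (s *\<^sub>R v) \<le> t * M" if s: "s \<in> {0..t}" for s
    proof -
      have "norm (s *\<^sub>R v) \<le> t * norm v" using s by (auto intro: mult_right_mono)
      moreover have "norm (t *\<^sub>R w) = t * norm w" using t by simp
      moreover have "t * norm v + t * norm w \<le> t * M" "t * norm v \<le> t * M"
        using t M by (auto simp flip: distrib_left)
      ultimately show "norm (s *\<^sub>R v + t *\<^sub>R w) \<le> t * M" "norm (s *\<^sub>R v) \<le> t * M"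
        using norm_triangle_ineq[of "s *\<^sub>R v" "t *\<^sub>R w"] by linarith+
    qed
    have in_ball: "x + s *\<^sub>R v + t *\<^sub>R w \<in> ball x r" "x + s *\<^sub>R v \<in> ball x r" if "s \<in> {0..t}" for s
    proof -
      have "dist x (x + z) = norm z" for z by (simp add: dist_norm)
      then show "x + s *\<^sub>R v + t *\<^sub>R w \<in> ball x r" "x + s *\<^sub>R v \<in> ball x r"
        using near[OF that] tM by (simp_all add: add.assoc)
    qed
    have der: "(?h has_vector_derivative ?h' s) (at s within {0..t})" if s: "s \<in> {0..t}" for s
    proof -
      have "(f has_derivative f' (x + s *\<^sub>R v + t *\<^sub>R w)) (at (x + s *\<^sub>R v + t *\<^sub>R w))"
        "(f has_derivative f' (x + s *\<^sub>R v)) (at (x + s *\<^sub>R v))" using f in_ball[OF s] by auto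
      note fd = this
      note l = fd[THEN has_derivative_bounded_linear, THEN bounded_linear.linear]
      have "((\<lambda>s. f (x + s *\<^sub>R v + t *\<^sub>R w)) has_derivative (\<lambda>h. f' (x + s *\<^sub>R v + t *\<^sub>R w)
        (h *\<^sub>R v))) (at s within {0..t})"
        by (rule has_derivative_compose[where f'="\<lambda>h. h *\<^sub>R v"
          and f="\<lambda>s. x + s *\<^sub>R v + t *\<^sub>R w", OF _ fd(1)]) (auto intro!: derivative_eq_intros)
      moreover have "((\<lambda>s. f (x + s *\<^sub>R v)) has_derivative (\<lambda>h. f' (x + s *\<^sub>R v) (h *\<^sub>R v)))
        (at s within {0..t})"
        by (rule has_derivative_compose[where f'="\<lambda>h. h *\<^sub>R v" and f="\<lambda>s. x + s *\<^sub>R v",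
          OF _ fd(2)]) (auto intro!: derivative_eq_intros)
      ultimately have "(?h has_derivative (\<lambda>h. f' (x + s *\<^sub>R v + t *\<^sub>R w) (h *\<^sub>R v) - f'
        (x + s *\<^sub>R v) (h *\<^sub>R v))) (at s within {0..t})"
        by (rule has_derivative_diff)
      then show ?thesis unfolding has_vector_derivative_def
        by (simp add: linear_cmul[OF l(1)] linear_cmul[OF l(2)] scaleR_diff_right)
    qed
    have bnd: "norm (?h' s - t *\<^sub>R D w) \<le> e * t" if s: "s \<in> {0..t}" for s
    proof -
      let ?a = "s *\<^sub>R v + t *\<^sub>R w" and ?b = "s *\<^sub>R v"
      have "norm (f' (x + ?a) v - f' x v - D ?a) \<le> e' * norm ?a"
        using dd[of "x + ?a"] near[OF s] tM by simp
      also have "\<dots> \<le> e' * (t * M)" using near[OF s] e' by (intro mult_left_mono) auto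
      finally have 1: "norm (f' (x + ?a) v - f' x v - D ?a) \<le> e' * (t * M)" .
      have "norm (f' (x + ?b) v - f' x v - D ?b) \<le> e' * norm ?b"
        using dd[of "x + ?b"] near[OF s] tM by simp
      also have "\<dots> \<le> e' * (t * M)" using near[OF s] e' by (intro mult_left_mono) auto
      finally have 2: "norm (f' (x + ?b) v - f' x v - D ?b) \<le> e' * (t * M)" .
      have eq: "?h' s - t *\<^sub>R D w = (f' (x + ?a) v - f' x v - D ?a) - (f' (x + ?b)
        v - f' x v - D ?b)"
        by (simp add: D.add D.scaleR algebra_simps)
      have "norm (?h' s - t *\<^sub>R D w) \<le> e' * (t * M) + e' * (t * M)"
        unfolding eq using 1 2 norm_triangle_ineq4 by (meson add_mono order_trans)
      also have "\<dots> = e * t" using M by (simp add: e'_def field_simps)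
      finally show ?thesis .
    qed
    have "norm ((?h t - t *\<^sub>R (t *\<^sub>R D w)) - (?h 0 - 0 *\<^sub>R (t *\<^sub>R D w))) \<le> (e * t) * norm (t - 0)"
    proof (rule differentiable_bound[where S="{0..t}" and f'="\<lambda>s h. h *\<^sub>R (?h' s - t *\<^sub>R D w)"])
      fix s assume s: "s \<in> {0..t}"
      have "((\<lambda>s. ?h s - s *\<^sub>R (t *\<^sub>R D w)) has_vector_derivative (?h' s - t *\<^sub>R D w))
        (at s within {0..t})"
        by (rule has_vector_derivative_diff[OF der[OF s]]) (auto simp:
          has_vector_derivative_def intro!: derivative_eq_intros)
      then show "((\<lambda>s. ?h s - s *\<^sub>R (t *\<^sub>R D w)) has_derivative (\<lambda>h. h *\<^sub>R (?h' s - t *\<^sub>R D w)))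
        (at s within {0..t})"
        by (simp add: has_vector_derivative_def)
      show "onorm (\<lambda>h. h *\<^sub>R (?h' s - t *\<^sub>R D w)) \<le> e * t"
        by (rule onorm_bound) (use bnd[OF s] t \<open>e > 0\<close> in \<open>auto simp: mult.commute intro:
          mult_left_mono\<close>)
    qed (use t in auto)
    then show ?thesis using t by (simp add: power2_eq_square algebra_simps)
  qed
  show ?thesis
    unfolding eventually_at_right_field using R main by blast
qed

text \<open>Interchanging \<open>v\<close> and \<open>w\<close> leaves the second difference
  unchanged, so its two quadratic approximations have the same coefficient.\<close>

lemma symmetric_second_derivative:
  fixes f :: "'a::real_normed_vector \<Rightarrow> 'b::real_normed_vector"
  assumes f: "\<And>y. y \<in> ball x r \<Longrightarrow> (f has_derivative f' y) (at y)" and r: "r > 0"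
    and D: "((\<lambda>y. f' y v) has_derivative D) (at x)" "((\<lambda>y. f' y w) has_derivative D') (at x)"
  shows "D w = D' v"
proof (rule ccontr)
  assume ne: "D w \<noteq> D' v"
  define e where "e = norm (D w - D' v) / 3"
  have e: "e > 0" using ne by (simp add: e_def)
  have "eventually (\<lambda>t::real. t > 0) (at_right 0)" by (simp add: eventually_at_filter)
  moreover have "eventually (\<lambda>t. norm (f (x + t *\<^sub>R v + t *\<^sub>R w) - f (x + t *\<^sub>R v) - f
    (x + t *\<^sub>R w) + f x - t\<^sup>2 *\<^sub>R D w)
           \<le> e * t\<^sup>2) (at_right 0)"
    by (rule second_difference_bound[where f=f and f'=f' and x=x and r=r and v=v and w=w
      and D=D]) (use f r D e in auto)
  moreover have "eventually (\<lambda>t. norm (f (x + t *\<^sub>R w + t *\<^sub>R v) - f (x + t *\<^sub>R w) - f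
    (x + t *\<^sub>R v) + f x - t\<^sup>2 *\<^sub>R D' v)
           \<le> e * t\<^sup>2) (at_right 0)"
    by (rule second_difference_bound[where f=f and f'=f' and x=x and r=r and v=w and w=v
      and D=D']) (use f r D e in auto)
  ultimately have "eventually (\<lambda>t::real. False) (at_right 0)"
  proof eventually_elim
    case (elim t)
    have "t\<^sup>2 *\<^sub>R (D w - D' v) = (f (x + t *\<^sub>R w + t *\<^sub>R v) - f (x + t *\<^sub>R w) - f (x + t *\<^sub>R v)
      + f x - t\<^sup>2 *\<^sub>R D' v)
        - (f (x + t *\<^sub>R v + t *\<^sub>R w) - f (x + t *\<^sub>R v) - f (x + t *\<^sub>R w) + f x - t\<^sup>2 *\<^sub>R D w)"
      by (simp add: algebra_simps)
    then have "norm (t\<^sup>2 *\<^sub>R (D w - D' v)) \<le> e * t\<^sup>2 + e * t\<^sup>2"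
      using elim norm_triangle_le_diff[OF add_mono] by (simp only:)
    then have "t\<^sup>2 * norm (D w - D' v) \<le> 2 * (e * t\<^sup>2)" by simp
    moreover have "norm (D w - D' v) = 3 * e" by (simp add: e_def)
    ultimately have "t\<^sup>2 * (3 * e) \<le> t\<^sup>2 * (2 * e)" by (simp add: mult_ac)
    then show False using elim e by simp
  qed
  then show False by (simp add: trivial_limit_at_right_real)
qed


text \<open>Differentiate \<open>f' y (V y) = P (f y)\<close> along \<open>W x\<close>, and the
  relation between \<open>W\<close> and \<open>Q\<close> along \<open>V x\<close>. In the difference
  the second derivatives of \<open>f\<close> cancel by symmetry.\<close>

lemma bracket_related:
  fixes f :: "'e::{real_normed_vector,heine_borel} \<Rightarrow> 'f::real_normed_vector"
  assumes S: "open S" "x \<in> S"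
    and f: "\<And>y. y \<in> S \<Longrightarrow> (f has_derivative f' y) (at y)"
    and f'': "\<And>v. ((\<lambda>y. f' y v) has_derivative f'' v) (at x)"
    and V: "(V has_derivative V') (at x)" and W: "(W has_derivative W') (at x)"
    and P: "(P has_derivative P') (at (f x))" and Q: "(Q has_derivative Q') (at (f x))"
    and VP: "\<And>y. y \<in> S \<Longrightarrow> f' y (V y) = P (f y)"
    and WQ: "\<And>y. y \<in> S \<Longrightarrow> f' y (W y) = Q (f y)"
  shows "f' x (W' (V x) - V' (W x)) = Q' (P (f x)) - P' (Q (f x))"
proof -
  interpret fx: bounded_linear "f' x" using f[OF S(2)] by (rule has_derivative_bounded_linear)
  have ev: "eventually (\<lambda>y. y \<in> S) (at x)" using S by (rule eventually_at_in_open')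
  have lin: "eventually (\<lambda>y. bounded_linear (f' y)) (at x)"
    using ev by eventually_elim (rule has_derivative_bounded_linear[OF f])
  have *: "f'' (U x) h + f' x (U' h) = R' (f' x h)"
    if U: "(U has_derivative U') (at x)" and R: "(R has_derivative R') (at (f x))"
      and UR: "\<And>y. y \<in> S \<Longrightarrow> f' y (U y) = R (f y)" for U U' R R' h
  proof -
    have "((\<lambda>y. f' y (U y)) has_derivative (\<lambda>h. f'' (U x) h + f' x (U' h))) (at x)"
      by (rule has_derivative_linear_apply[OF f'' lin fx.bounded_linear_axioms U])
    moreover have "((\<lambda>y. R (f y)) has_derivative (\<lambda>h. R' (f' x h))) (at x)"
      by (rule has_derivative_compose[OF f[OF S(2)] R])
    then have "((\<lambda>y. f' y (U y)) has_derivative (\<lambda>h. R' (f' x h))) (at x)"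
      by (rule has_derivative_transform_within_open[OF _ S]) (simp add: UR)
    ultimately show ?thesis by (metis has_derivative_unique)
  qed
  obtain r where r: "r > 0" "ball x r \<subseteq> S" using S open_contains_ball by blast
  have "f'' (V x) (W x) = f'' (W x) (V x)"
    by (rule symmetric_second_derivative[where f=f, OF _ r(1) f'' f'']) (use f r in auto)
  with *[OF V P VP, of "W x", symmetric] *[OF W Q WQ, of "V x", symmetric] show ?thesis
    by (simp add: fx.diff VP[OF S(2)] WQ[OF S(2)])
qed

section \<open>Smooth functions under affine substitutions\<close>

lemma Ck_on_cong:
  assumes "open S" "Ck_on k S f" "\<And>x. x \<in> S \<Longrightarrow> f x = g x"
  shows "Ck_on k S g"
  using assms(2,3)
proof (induction k arbitrary: f g)
  case 0
  then show ?case by (auto intro: continuous_on_eq)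
next
  case (Suc k)
  have der: "(g has_derivative frechet_derivative f (at x)) (at x)" if "x \<in> S" for x
    using Suc.prems that assms(1)
    by (auto simp: frechet_derivative_works intro!: has_derivative_transform_within_open[of f _
      x UNIV S g])
  then have "frechet_derivative f (at x) = frechet_derivative g (at x)" if "x \<in> S" for x
    using that frechet_derivative_at by blast
  moreover have "g differentiable (at x)" if "x \<in> S" for x
    using der[OF that] by (auto simp: differentiable_def)
  ultimately show ?case
    using Suc by (auto intro: Suc.IH)
qed

text \<open>The derivative in direction \<open>v\<close> is that of \<open>f\<close> in the constant
  direction \<open>L v\<close>, so the induction passes without a chain rule for higher derivatives.
  The use is for slices of functions on a product.\<close>

lemma Ck_on_compose_affine:
  assumes L: "bounded_linear L" and "open T" "\<And>x. x \<in> T \<Longrightarrow> a + L x \<in> S" "Ck_on k S f"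
  shows "Ck_on k T (\<lambda>x. f (a + L x))"
  using assms(4)
proof (induction k arbitrary: f)
  case 0
  have "continuous_on T (\<lambda>x. a + L x)"
    by (intro continuous_intros linear_continuous_on L)
  then show ?case
    using 0 assms(3) by (auto intro!: continuous_on_compose2[of S f T "\<lambda>x. a + L x"])
next
  case (Suc k)
  have der: "((\<lambda>x. f (a + L x)) has_derivative (\<lambda>h. frechet_derivative f (at (a + L x)) (L h)))
    (at x)"
    if "x \<in> T" for x
  proof (rule has_derivative_compose[where f="\<lambda>x. a + L x"])
    show "((\<lambda>x. a + L x) has_derivative L) (at x)"
      by (auto intro!: derivative_eq_intros bounded_linear_imp_has_derivative L)
    show "(f has_derivative frechet_derivative f (at (a + L x))) (at (a + L x))"
      using Suc.prems assms(3)[OF that] by (auto simp: frechet_derivative_works)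
  qed
  have eq: "frechet_derivative (\<lambda>x. f (a + L x)) (at x) = (\<lambda>h. frechet_derivative f (at
    (a + L x)) (L h))"
    if "x \<in> T" for x
    using frechet_derivative_at[OF der[OF that]] by simp
  have "Ck_on k T (\<lambda>x. frechet_derivative (\<lambda>x. f (a + L x)) (at x) v)" for v
    by (rule Ck_on_cong[OF assms(2) Suc.IH[of "\<lambda>z. frechet_derivative f (at z) (L v)"]])
      (use Suc.prems eq in auto)
  then show ?case using der by (auto simp: differentiable_def)
qed

lemma smooth_on_cong: "\<lbrakk>open S; smooth_on S f; \<And>x. x \<in> S \<Longrightarrow> f x = g x\<rbrakk> \<Longrightarrow> smooth_on S g"
  unfolding smooth_on_def using Ck_on_cong by blast

lemma smooth_on_Pair_left:
  assumes "open T" "\<And>x. x \<in> T \<Longrightarrow> (x, a) \<in> S" "smooth_on S f"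
  shows "smooth_on T (\<lambda>x. f (x, a))"
  using assms Ck_on_compose_affine[of "\<lambda>x. (x, 0)" T "(0, a)" S _ f]
  unfolding smooth_on_def by (simp add: bounded_linear_Pair bounded_linear_ident
    bounded_linear_zero)

lemma smooth_on_Pair_right:
  assumes "open T" "\<And>x. x \<in> T \<Longrightarrow> (a, x) \<in> S" "smooth_on S f"
  shows "smooth_on T (\<lambda>x. f (a, x))"
  using assms Ck_on_compose_affine[of "\<lambda>x. (0, x)" T "(a, 0)" S _ f]
  unfolding smooth_on_def by (simp add: bounded_linear_Pair bounded_linear_ident
    bounded_linear_zero)

lemma smooth_on_has_derivative:
  "\<lbrakk>smooth_on S f; x \<in> S\<rbrakk> \<Longrightarrow> (f has_derivative frechet_derivative f (at x)) (at x)"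
  unfolding smooth_on_def using Ck_on.simps(2) frechet_derivative_works by blast

lemma smooth_on_frechet_derivative:
  "smooth_on S f \<Longrightarrow> smooth_on S (\<lambda>x. frechet_derivative f (at x) v)"
  unfolding smooth_on_def using Ck_on.simps(2) by blast

lemma smooth_on_imp_continuous_on: "smooth_on S f \<Longrightarrow> continuous_on S f"
  unfolding smooth_on_def using Ck_on.simps(1) by blast

section \<open>Derivatives in charts\<close>

text \<open>A coordinate map is arbitrary outside its domain. For a chart with open domain,
  continuity of \<open>f\<close> together with \<open>f z \<in> fst c\<close> confines
  \<open>f\<close> to the domain near \<open>z\<close>, which gives the derivative its
  meaning.\<close>

definition chart_deriv ::
  "('a::topological_space, 'e::real_normed_vector) chart \<Rightarrow> ('z::real_normed_vector \<Rightarrow> 'a) \<Rightarrow> 'z \<Rightarrow>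
    ('z \<Rightarrow> 'e) \<Rightarrow> bool" where
  "chart_deriv c f z L \<longleftrightarrow> isCont f z \<and> f z \<in> fst c \<and> ((\<lambda>z. snd c (f z)) has_derivative L) (at z)"

lemma chart_deriv_unique: "\<lbrakk>chart_deriv c f z L; chart_deriv c f z L'\<rbrakk> \<Longrightarrow> L = L'"
  unfolding chart_deriv_def by (blast intro: has_derivative_unique)

lemma chart_deriv_bounded_linear: "chart_deriv c f z L \<Longrightarrow> bounded_linear L"
  unfolding chart_deriv_def by (blast intro: has_derivative_bounded_linear)

lemma chart_deriv_frechet_derivative:
  "chart_deriv c f z L \<Longrightarrow> frechet_derivative (\<lambda>z. snd c (f z)) (at z) = L"
  unfolding chart_deriv_def using frechet_derivative_at by metis

lemma chart_deriv_const: "p \<in> fst c \<Longrightarrow> chart_deriv c (\<lambda>_. p) z (\<lambda>_. 0)"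
  unfolding chart_deriv_def by simp

lemma chart_deriv_cong:
  assumes "chart_deriv c f z L" "open S" "z \<in> S" "\<And>y. y \<in> S \<Longrightarrow> f y = g y"
  shows "chart_deriv c g z L"
proof -
  have "eventually (\<lambda>y. f y = g y) (nhds z)"
    using eventually_nhds_in_open[OF assms(2,3)] by eventually_elim (rule assms(4))
  then have "isCont g z" using assms(1) isCont_cong unfolding chart_deriv_def by blast
  moreover have "((\<lambda>z. snd c (g z)) has_derivative L) (at z)"
    using assms unfolding chart_deriv_def
    by (auto intro: has_derivative_transform_within_open[of "\<lambda>z. snd c (f z)" L z UNIV S])
  ultimately show ?thesis using assms unfolding chart_deriv_def by simp
qed

lemma chart_deriv_compose:
  assumes "chart_deriv c f (u w) L" "(u has_derivative u') (at w)"
  shows "chart_deriv c (\<lambda>w. f (u w)) w (\<lambda>h. L (u' h))"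
proof -
  have "isCont u w" using assms(2) by (rule has_derivative_continuous)
  then show ?thesis
    using assms has_derivative_compose[OF assms(2), of "\<lambda>z. snd c (f z)"
      L] unfolding chart_deriv_def
    by (auto intro: isCont_o2)
qed

context lie_group begin

lemma chart_open: "c \<in> A \<Longrightarrow> open (fst c)"
  and chart_image_open: "c \<in> A \<Longrightarrow> open (snd c ` fst c)"
  and chart_homeomorphism: "c \<in> A \<Longrightarrow> homeomorphism (fst c) (snd c ` fst c) (snd c) (chart_inv c)"
  using smooth_atlas unfolding smooth_atlas_def by blast+

lemma chart_inv_left [simp]: "\<lbrakk>c \<in> A; p \<in> fst c\<rbrakk> \<Longrightarrow> chart_inv c (snd c p) = p"
  using chart_homeomorphism unfolding homeomorphism_def by blast

lemma chart_inv_right: "\<lbrakk>c \<in> A; x \<in> snd c ` fst c\<rbrakk> \<Longrightarrow> snd c (chart_inv c x) = x"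
  and chart_inv_in: "\<lbrakk>c \<in> A; x \<in> snd c ` fst c\<rbrakk> \<Longrightarrow> chart_inv c x \<in> fst c"
  using chart_homeomorphism unfolding homeomorphism_def by blast+

lemma isCont_chart_inv: "\<lbrakk>c \<in> A; x \<in> snd c ` fst c\<rbrakk> \<Longrightarrow> isCont (chart_inv c) x"
  using chart_homeomorphism chart_image_open unfolding homeomorphism_def
  by (metis continuous_on_eq_continuous_at)

lemma isCont_chart: "\<lbrakk>c \<in> A; p \<in> fst c\<rbrakk> \<Longrightarrow> isCont (snd c) p"
  using chart_homeomorphism chart_open unfolding homeomorphism_def
  by (metis continuous_on_eq_continuous_at)

lemma chart_exists: obtains c where "c \<in> charts_at A p"
  using smooth_atlas unfolding smooth_atlas_def charts_at_def by blast

lemma charts_atD: "c \<in> charts_at A p \<Longrightarrow> c \<in> A" "c \<in> charts_at A p \<Longrightarrow> p \<in> fst c"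
  by (auto simp: charts_at_def)

lemma continuous_on_mul: "continuous_on UNIV (\<lambda>(x, y). mul x y)"
  using smooth_mult unfolding smooth_map_def by blast

lemma tendsto_mul:
  "\<lbrakk>(f \<longlongrightarrow> p) F; (g \<longlongrightarrow> q) F\<rbrakk> \<Longrightarrow> ((\<lambda>x. mul (f x) (g x)) \<longlongrightarrow> mul p q) F"
  using continuous_on_tendsto_compose[OF continuous_on_mul tendsto_Pair[of f p F g q]] by simp

lemma tendsto_inver: "(f \<longlongrightarrow> p) F \<Longrightarrow> ((\<lambda>x. inver (f x)) \<longlongrightarrow> inver p) F"
  using smooth_inver continuous_on_tendsto_compose[of UNIV inver f p F]
  unfolding smooth_map_def by simp

lemma continuous_on_mul' [continuous_intros]:
  "\<lbrakk>continuous_on S f; continuous_on S g\<rbrakk> \<Longrightarrow> continuous_on S (\<lambda>x. mul (f x) (g x))"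
  unfolding continuous_on_def by (auto intro: tendsto_mul)

lemma continuous_on_inver' [continuous_intros]:
  "continuous_on S f \<Longrightarrow> continuous_on S (\<lambda>x. inver (f x))"
  unfolding continuous_on_def by (auto intro: tendsto_inver)

lemma isCont_mul: "\<lbrakk>isCont f z; isCont g z\<rbrakk> \<Longrightarrow> isCont (\<lambda>z. mul (f z) (g z)) z"
  unfolding isCont_def by (rule tendsto_mul)

lemma chart_deriv_chart_inv: "\<lbrakk>c \<in> A; x \<in> snd c ` fst c\<rbrakk> \<Longrightarrow> chart_deriv c (chart_inv c) x (\<lambda>h. h)"
  unfolding chart_deriv_def
  by (auto simp: isCont_chart_inv intro!: has_derivative_transform_within_open
      [OF has_derivative_ident chart_image_open])

lemma chart_deriv_chart_inv_at: "\<lbrakk>c \<in> A; p \<in> fst c\<rbrakk> \<Longrightarrow> chart_deriv c (chart_inv c) (snd c p) (\<lambda>h. h)"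
  by (simp add: chart_deriv_chart_inv)

section \<open>Multiplication in charts\<close>

definition mul_coord :: "('a,'e) chart \<Rightarrow> ('a,'e) chart \<Rightarrow> ('a,'e) chart \<Rightarrow> 'e \<times> 'e \<Rightarrow> 'e" where
  "mul_coord c d k z = snd k (mul (chart_inv c (fst z)) (chart_inv d (snd z)))"

definition mul_dom :: "('a,'e) chart \<Rightarrow> ('a,'e) chart \<Rightarrow> ('a,'e) chart \<Rightarrow> ('e \<times> 'e) set" where
  "mul_dom c d k = {z. fst z \<in> snd c ` fst c \<and> snd z \<in> snd d ` fst d \<and>
     mul (chart_inv c (fst z)) (chart_inv d (snd z)) \<in> fst k}"

lemma open_mul_dom:
  assumes "c \<in> A" "d \<in> A" "k \<in> A"
  shows "open (mul_dom c d k)"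
proof -
  let ?S = "(snd c ` fst c) \<times> (snd d ` fst d)"
  have "continuous_on (snd c ` fst c) (chart_inv c)" "continuous_on (snd d ` fst d) (chart_inv d)"
    using chart_homeomorphism assms unfolding homeomorphism_def by blast+
  then have "continuous_on ?S (\<lambda>z. mul (chart_inv c (fst z)) (chart_inv d (snd z)))"
    by (intro continuous_on_mul')
       (auto intro!: continuous_on_compose2[of _ "chart_inv c"
         _ fst] continuous_on_compose2[of _ "chart_inv d" _ snd] continuous_intros)
  then have "open (?S \<inter> (\<lambda>z. mul (chart_inv c (fst z)) (chart_inv d (snd z))) -` fst k)"
    by (intro continuous_open_preimage open_Times chart_image_open chart_open assms)
  also have "\<dots> = mul_dom c d k" by (auto simp: mul_dom_def)
  finally show ?thesis .
qed

text \<open>\<open>chart_inv\<close> of a product chart is a choice function on the product domain;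
  injectivity of both coordinate maps identifies it on \<open>mul_dom\<close> with the pair of the
  two inverses.\<close>

lemma smooth_mul_coord:
  assumes "c \<in> A" "d \<in> A" "k \<in> A"
  shows "smooth_on (mul_dom c d k) (mul_coord c d k)"
proof -
  let ?cd = "(fst c \<times> fst d, map_prod (snd c) (snd d))"
  have "?cd \<in> product_atlas A A" using assms unfolding product_atlas_def by blast
  then have sm: "smooth_on (snd ?cd ` (fst ?cd \<inter> (\<lambda>(x, y). mul x y) -` fst k))
     (snd k \<circ> (\<lambda>(x, y). mul x y) \<circ> chart_inv ?cd)"
    using smooth_mult assms unfolding smooth_map_def by blast
  have inj: "inj_on (snd c) (fst c)" "inj_on (snd d) (fst d)"
    using assms by (auto intro: inj_on_inverseI chart_inv_left)
  have inv: "chart_inv ?cd z = (chart_inv c (fst z), chart_inv d (snd z))" if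
    "z \<in> mul_dom c d k" for z
  proof -
    have "inj_on (map_prod (snd c) (snd d)) (fst c \<times> fst d)"
      using inj by (auto simp: inj_on_def)
    then show ?thesis
      unfolding chart_inv_def fst_conv snd_conv
      by (rule inv_into_f_eq)
         (use that assms in \<open>auto simp: mul_dom_def chart_inv_in chart_inv_right simp flip:
           chart_inv_def\<close>)
  qed
  have "snd ?cd ` (fst ?cd \<inter> (\<lambda>(x, y). mul x y) -` fst k) = mul_dom c d k"
  proof (intro set_eqI iffI)
    fix z assume "z \<in> mul_dom c d k"
    then have "z = map_prod (snd c) (snd d) (chart_inv c (fst z), chart_inv d (snd z))"
      "(chart_inv c (fst z), chart_inv d (snd z)) \<in> fst ?cd \<inter> (\<lambda>(x, y). mul x y) -` fst k"
      using assms by (auto simp: mul_dom_def chart_inv_in chart_inv_right intro!: prod_eqI)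
    then show "z \<in> snd ?cd ` (fst ?cd \<inter> (\<lambda>(x, y). mul x y) -` fst k)"
      by (metis imageI snd_conv)
  qed (auto simp: mul_dom_def assms)
  with sm have "smooth_on (mul_dom c d k) (snd k \<circ> (\<lambda>(x, y). mul x y) \<circ> chart_inv ?cd)" by simp
  then show ?thesis
    by (rule smooth_on_cong[OF open_mul_dom[OF assms]]) (simp add: inv mul_coord_def)
qed

text \<open>The derivatives of \<open>p \<mapsto> p q\<close> and of \<open>q \<mapsto> p q\<close>, read in charts \<open>c\<close> and \<open>d\<close>. For the unit as
  the other factor they are the coordinate changes.\<close> 

definition dright :: "('a,'e) chart \<Rightarrow> ('a,'e) chart \<Rightarrow> 'a \<Rightarrow> 'a \<Rightarrow> 'e \<Rightarrow> 'e" where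
  "dright c d p q = frechet_derivative (\<lambda>x. snd d (mul (chart_inv c x) q)) (at (snd c p))"

definition dleft :: "('a,'e) chart \<Rightarrow> ('a,'e) chart \<Rightarrow> 'a \<Rightarrow> 'a \<Rightarrow> 'e \<Rightarrow> 'e" where
  "dleft c d p q = frechet_derivative (\<lambda>x. snd d (mul p (chart_inv c x))) (at (snd c q))"

definition dmul :: "('a,'e) chart \<Rightarrow> ('a,'e) chart \<Rightarrow> ('a,'e) chart \<Rightarrow> 'a \<Rightarrow> 'a \<Rightarrow> 'e \<times> 'e \<Rightarrow> 'e" where
  "dmul c d k p q = frechet_derivative (mul_coord c d k) (at (snd c p, snd d q))"

lemma mul_dom_at:
  "\<lbrakk>c \<in> A; d \<in> A; p \<in> fst c; q \<in> fst d; mul p q \<in> fst k\<rbrakk> \<Longrightarrow> (snd c p, snd d q) \<in> mul_dom c d k"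
  by (auto simp: mul_dom_def)

lemma mul_coord_has_derivative:
  assumes "c \<in> A" "d \<in> A" "k \<in> A" "p \<in> fst c" "q \<in> fst d" "mul p q \<in> fst k"
  shows "(mul_coord c d k has_derivative dmul c d k p q) (at (snd c p, snd d q))"
  unfolding dmul_def
  by (rule smooth_on_has_derivative[OF smooth_mul_coord mul_dom_at]) (use assms in auto)

lemma chart_deriv_dmul:
  assumes "chart_deriv c f z L" "chart_deriv d g z L'" "c \<in> A" "d \<in> A" "k \<in> A" "mul (f z) (g z)
    \<in> fst k"
  shows "chart_deriv k (\<lambda>z. mul (f z) (g z)) z (\<lambda>h. dmul c d k (f z) (g z) (L h, L' h))"
proof -
  have fg: "isCont f z" "isCont g z" "f z \<in> fst c" "g z \<in> fst d"
    using assms unfolding chart_deriv_def by auto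
  have "((\<lambda>z. (snd c (f z), snd d (g z))) has_derivative (\<lambda>h. (L h, L' h))) (at z)"
    using assms(1,2) unfolding chart_deriv_def by (auto intro: has_derivative_Pair)
  then have "((\<lambda>z. mul_coord c d k (snd c (f z), snd d (g z))) has_derivative
      (\<lambda>h. dmul c d k (f z) (g z) (L h, L' h))) (at z)"
    by (rule has_derivative_compose) (use mul_coord_has_derivative assms fg in auto)
  then have 1: "chart_deriv k (\<lambda>z. mul (chart_inv c (snd c (f z))) (chart_inv d (snd d (g z)))) z
     (\<lambda>h. dmul c d k (f z) (g z) (L h, L' h))" if "isCont (\<lambda>z. mul (chart_inv c (snd c (f z)))
       (chart_inv d (snd d (g z)))) z"
    unfolding chart_deriv_def mul_coord_def using that assms fg by simp
  have "eventually (\<lambda>y. f y \<in> fst c) (nhds z)" "eventually (\<lambda>y. g y \<in> fst d) (nhds z)"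
    using fg assms(3,4)[THEN chart_open] by (simp_all add: isCont_def tendsto_def
      eventually_nhds_conv_at)
  then have ev: "eventually (\<lambda>y. f y \<in> fst c \<and> g y \<in> fst d) (nhds z)" by eventually_elim simp
  then obtain S where S: "open S" "z \<in> S" "\<And>y. y \<in> S \<Longrightarrow> f y \<in> fst c \<and> g y \<in> fst d"
    unfolding eventually_nhds by auto
  have "isCont (\<lambda>z. mul (f z) (g z)) z" using fg by (intro isCont_mul)
  moreover have "eventually (\<lambda>y. mul (chart_inv c (snd c (f y))) (chart_inv d (snd d (g y)))
    = mul (f y) (g y)) (nhds z)"
    using ev by eventually_elim (use assms in simp)
  ultimately have "isCont (\<lambda>z. mul (chart_inv c (snd c (f z))) (chart_inv d (snd d (g z)))) z"
    by (simp add: isCont_cong)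
  from 1[OF this] show ?thesis
    by (rule chart_deriv_cong[OF _ S(1,2)]) (use assms S in simp)
qed

lemma dright_dmul:
  assumes "c \<in> A" "d \<in> A" "k \<in> A" "p \<in> fst c" "q \<in> fst d" "mul p q \<in> fst k"
  shows "dright c k p q = (\<lambda>v. dmul c d k p q (v, 0))"
  unfolding dright_def
  using chart_deriv_frechet_derivative[OF chart_deriv_dmul[OF chart_deriv_chart_inv_at
    chart_deriv_const, of c p q d k]] assms
  by simp

lemma dleft_dmul:
  assumes "c \<in> A" "d \<in> A" "k \<in> A" "p \<in> fst c" "q \<in> fst d" "mul p q \<in> fst k"
  shows "dleft d k p q = (\<lambda>v. dmul c d k p q (0, v))"
  unfolding dleft_def
  using chart_deriv_frechet_derivative[OF chart_deriv_dmul[OF chart_deriv_const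
    chart_deriv_chart_inv_at, of p c d q k]] assms
  by simp

lemma dmul_eq:
  assumes "c \<in> A" "d \<in> A" "k \<in> A" "p \<in> fst c" "q \<in> fst d" "mul p q \<in> fst k"
  shows "dmul c d k p q (v, w) = dright c k p q v + dleft d k p q w"
proof -
  interpret bounded_linear "dmul c d k p q"
    using mul_coord_has_derivative[OF assms] by (rule has_derivative_bounded_linear)
  show ?thesis
    unfolding dright_dmul[OF assms] dleft_dmul[OF assms] by (simp flip: add)
qed

lemma chart_deriv_mul:
  assumes "chart_deriv c f z L" "chart_deriv d g z L'" "c \<in> A" "d \<in> A" "k \<in> A" "mul (f z) (g z)
    \<in> fst k"
  shows "chart_deriv k (\<lambda>z. mul (f z) (g z)) z (\<lambda>h. dright c k (f z) (g z) (L h) + dleft d k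
    (f z) (g z) (L' h))"
  using chart_deriv_dmul[OF assms] assms by (simp add: dmul_eq chart_deriv_def)

lemma bounded_linear_dright: "\<lbrakk>c \<in> A; k \<in> A; p \<in> fst c; mul p q \<in> fst k\<rbrakk> \<Longrightarrow> bounded_linear
  (dright c k p q)"
  and bounded_linear_dleft: "\<lbrakk>d \<in> A; k \<in> A; q \<in> fst d; mul p q \<in> fst k\<rbrakk> \<Longrightarrow> bounded_linear
    (dleft d k p q)"
proof -
  assume *: "c \<in> A" "k \<in> A" "p \<in> fst c" "mul p q \<in> fst k"
  obtain d where d: "d \<in> charts_at A q" by (rule chart_exists)
  show "bounded_linear (dright c k p q)"
    using chart_deriv_bounded_linear[OF chart_deriv_dmul[OF chart_deriv_chart_inv_at
      chart_deriv_const, of c p q d k]]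
      * charts_atD[OF d] by (simp add: dright_dmul[of c d k p q])
next
  assume *: "d \<in> A" "k \<in> A" "q \<in> fst d" "mul p q \<in> fst k"
  obtain c where c: "c \<in> charts_at A p" by (rule chart_exists)
  show "bounded_linear (dleft d k p q)"
    using chart_deriv_bounded_linear[OF chart_deriv_dmul[OF chart_deriv_const
      chart_deriv_chart_inv_at, of p c d q k]]
      * charts_atD[OF c] by (simp add: dleft_dmul[of c d k p q])
qed

lemma chart_deriv_dright:
  assumes "chart_deriv c f z L" "c \<in> A" "k \<in> A" "mul (f z) q \<in> fst k"
  shows "chart_deriv k (\<lambda>z. mul (f z) q) z (\<lambda>h. dright c k (f z) q (L h))"
proof -
  obtain d where d: "d \<in> charts_at A q" by (rule chart_exists)
  have "f z \<in> fst c" using assms by (simp add: chart_deriv_def)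
  with chart_deriv_dmul[OF assms(1) chart_deriv_const, of q d k] show ?thesis
    using assms charts_atD[OF d] by (simp add: dright_dmul[of c d])
qed

lemma chart_deriv_dleft:
  assumes "chart_deriv c f z L" "c \<in> A" "k \<in> A" "mul p (f z) \<in> fst k"
  shows "chart_deriv k (\<lambda>z. mul p (f z)) z (\<lambda>h. dleft c k p (f z) (L h))"
proof -
  obtain d where d: "d \<in> charts_at A p" by (rule chart_exists)
  have "f z \<in> fst c" using assms by (simp add: chart_deriv_def)
  with chart_deriv_dmul[OF chart_deriv_const assms(1), of p d k] show ?thesis
    using assms charts_atD[OF d] by (simp add: dleft_dmul[of d c])
qed

lemma chart_deriv_dright_chart:
  "\<lbrakk>c \<in> A; k \<in> A; p \<in> fst c; mul p q \<in> fst k\<rbrakk> \<Longrightarrow> chart_deriv k (\<lambda>x. mul (chart_inv c x) q)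
    (snd c p) (dright c k p q)"
  using chart_deriv_dright[OF chart_deriv_chart_inv_at, of c p k q] by simp

lemma chart_deriv_dleft_chart:
  "\<lbrakk>c \<in> A; k \<in> A; p \<in> fst c; mul q p \<in> fst k\<rbrakk> \<Longrightarrow> chart_deriv k (\<lambda>x. mul q (chart_inv c x))
    (snd c p) (dleft c k q p)"
  using chart_deriv_dleft[OF chart_deriv_chart_inv_at, of c p k q] by simp

lemma chart_deriv_change:
  assumes "chart_deriv c f z L" "c \<in> A" "d \<in> A" "f z \<in> fst d"
  shows "chart_deriv d f z (\<lambda>h. dright c d (f z) one (L h))"
  using chart_deriv_dright[OF assms(1-3), of one] assms by simp

text \<open>The chain rule for \<open>(x q) r = x (q r)\<close>; with \<open>q\<close> or
  \<open>r\<close> the unit it includes coordinate changes.\<close>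

lemma dright_dright:
  assumes "c \<in> A" "d \<in> A" "k \<in> A" "p \<in> fst c" "mul p q \<in> fst d" "mul p (mul q r) \<in> fst k"
  shows "dright d k (mul p q) r (dright c d p q v) = dright c k p (mul q r) v"
proof -
  have 1: "chart_deriv d (\<lambda>z. mul (chart_inv c z) q) (snd c p) (\<lambda>h. dright c d p q h)"
    using chart_deriv_dright[OF chart_deriv_chart_inv_at, of c p d q] assms by simp
  have 2: "chart_deriv k (\<lambda>z. mul (chart_inv c z) (mul q r)) (snd c p) (\<lambda>h. dright d k (mul p q)
    r (dright c d p q h))"
    using chart_deriv_dright[OF 1, of k r] assms(1-3,5,6) chart_inv_left[OF assms(1,4)] by
      (simp add: assoc)
  have 3: "chart_deriv k (\<lambda>z. mul (chart_inv c z) (mul q r)) (snd c p) (\<lambda>h. dright c k p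
    (mul q r) h)"
    using chart_deriv_dright[OF chart_deriv_chart_inv_at, of c p k "mul q r"] assms by simp
  show ?thesis using chart_deriv_unique[OF 2 3] by (rule fun_cong)
qed

lemma dleft_dleft:
  assumes "c \<in> A" "d \<in> A" "k \<in> A" "p \<in> fst c" "mul q p \<in> fst d" "mul r (mul q p) \<in> fst k"
  shows "dleft d k r (mul q p) (dleft c d q p v) = dleft c k (mul r q) p v"
proof -
  have 1: "chart_deriv d (\<lambda>z. mul q (chart_inv c z)) (snd c p) (\<lambda>h. dleft c d q p h)"
    using chart_deriv_dleft[OF chart_deriv_chart_inv_at, of c p d q] assms by simp
  have 2: "chart_deriv k (\<lambda>z. mul r (mul q (chart_inv c z))) (snd c p) (\<lambda>h. dleft d k r
    (mul q p) (dleft c d q p h))"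
    using chart_deriv_dleft[OF 1, of k r] assms by simp
  have 3: "chart_deriv k (\<lambda>z. mul r (mul q (chart_inv c z))) (snd c p) (\<lambda>h. dleft c k (mul r q)
    p h)"
    using chart_deriv_dleft[OF chart_deriv_chart_inv_at, of c p k "mul r q"] assms by
      (simp add: assoc)
  show ?thesis using chart_deriv_unique[OF 2 3] by (rule fun_cong)
qed

lemma dright_one [simp]: "\<lbrakk>c \<in> A; p \<in> fst c\<rbrakk> \<Longrightarrow> dright c c p one v = v"
  using chart_deriv_unique[of c "chart_inv c" "snd c p" "dright c c p one"
    "\<lambda>h. h"] chart_deriv_chart_inv_at[of c p]
    chart_deriv_dright_chart[of c c p one] by (simp add: fun_eq_iff)

lemma dleft_one [simp]: "\<lbrakk>c \<in> A; p \<in> fst c\<rbrakk> \<Longrightarrow> dleft c c one p v = v"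
  using chart_deriv_unique[of c "chart_inv c" "snd c p" "dleft c c one p"
    "\<lambda>h. h"] chart_deriv_chart_inv_at[of c p]
    chart_deriv_dleft_chart[of c c p one] by (simp add: fun_eq_iff)

section \<open>Tangent vectors and differentials\<close>

lemma dright_one_right: "dright c d p one = frechet_derivative (snd d \<circ> chart_inv c) (at (snd c p))"
  by (simp add: dright_def comp_def)

lemma tangent_space_change:
  assumes "w \<in> tangent_space A p" "c \<in> charts_at A p" "d \<in> charts_at A p"
  shows "w d = dright c d p one (w c)"
  using assms unfolding tangent_space_def dright_one_right by blast

lemma tangent_spaceI:
  assumes "\<And>c. c \<notin> charts_at A p \<Longrightarrow> w c = 0"
    "\<And>c d. \<lbrakk>c \<in> charts_at A p; d \<in> charts_at A p\<rbrakk> \<Longrightarrow> w d = dright c d p one (w c)"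
  shows "w \<in> tangent_space A p"
  using assms unfolding tangent_space_def dright_one_right by blast

text \<open>\<open>differential\<close> reads the vector in a chart picked by \<open>SOME\<close>.
  The compatibility of the components of \<open>w\<close> cancels against the coordinate change, so
  any chart at \<open>p\<close> may be used.\<close>

lemma differential_eq:
  assumes c: "c \<in> charts_at A p" and d: "d \<in> A" and w: "w \<in> tangent_space A p"
    and L: "chart_deriv d (\<lambda>x. F (chart_inv c x)) (snd c p) L"
  shows "differential A A F p w d = L (w c)"
proof -
  note c' = charts_atD[OF c]
  define k where "k = (SOME c. c \<in> charts_at A p)"
  have k: "k \<in> charts_at A p" unfolding k_def using c by (rule someI)
  note k' = charts_atD[OF k]
  have tr: "chart_deriv c (chart_inv k) (snd k p) (\<lambda>h. dright k c p one h)"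
    using chart_deriv_change[OF chart_deriv_chart_inv_at, of k p c] c' k' by simp
  then have "((\<lambda>x. snd c (chart_inv k x)) has_derivative (\<lambda>h. dright k c p one h)) (at (snd k p))"
    and cont: "isCont (chart_inv k) (snd k p)"
    by (simp_all add: chart_deriv_def)
  then have 1: "chart_deriv d (\<lambda>x. F (chart_inv c (snd c (chart_inv k x)))) (snd k p) (\<lambda>h. L
    (dright k c p one h))"
    by (intro chart_deriv_compose[OF _ \<open>(_ has_derivative _) _\<close>]) (use L c' k' in simp)
  have S: "open (snd k ` fst k \<inter> chart_inv k -` fst c)"
    using chart_homeomorphism[of k] k' c'
    by (intro continuous_open_preimage chart_image_open chart_open) (auto simp: homeomorphism_def)
  have "chart_deriv d (\<lambda>x. F (chart_inv k x)) (snd k p) (\<lambda>h. L (dright k c p one h))"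
    by (rule chart_deriv_cong[OF 1 S]) (use c' k' in auto)
  note fr = chart_deriv_frechet_derivative[OF this]
  have "F p \<in> fst d" using L c' by (simp add: chart_deriv_def)
  then have "d \<in> charts_at A (F p)" using d by (simp add: charts_at_def)
  then have "differential A A F p w d = L (dright k c p one (w k))"
    unfolding differential_def k_def[symmetric] using fr by (simp add: comp_def)
  then show ?thesis using tangent_space_change[OF w k c] by simp
qed

lemma differential_zero: "d \<notin> charts_at A (F p) \<Longrightarrow> differential A A F p w d = 0"
  by (simp add: differential_def)

text \<open>The derivative is left unspecified; at the unit it is later determined by
  differentiating the product of \<open>x\<close> and \<open>inver x\<close>.\<close>

lemma chart_deriv_inver:
  assumes "chart_deriv c f z L" "c \<in> A" "d \<in> A" "inver (f z) \<in> fst d"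
  shows "\<exists>L'. chart_deriv d (\<lambda>z. inver (f z)) z L'"
proof -
  have f: "f z \<in> fst c" "isCont f z" and f': "((\<lambda>z. snd c (f z)) has_derivative L) (at z)"
    using assms by (auto simp: chart_deriv_def)
  have "smooth_on (snd c ` (fst c \<inter> inver -` fst d)) (snd d \<circ> inver \<circ> chart_inv c)"
    using smooth_inver assms unfolding smooth_map_def by blast
  then have "((snd d \<circ> inver \<circ> chart_inv c) has_derivative
     frechet_derivative (snd d \<circ> inver \<circ> chart_inv c) (at (snd c (f z)))) (at (snd c (f z)))"
    by (rule smooth_on_has_derivative) (use f assms in auto)
  then have 1: "((\<lambda>y. snd d (inver (chart_inv c (snd c (f y))))) has_derivative
     (\<lambda>h. frechet_derivative (snd d \<circ> inver \<circ> chart_inv c) (at (snd c (f z))) (L h))) (at z)"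
    using has_derivative_compose[OF f'] by (simp add: comp_def)
  have "eventually (\<lambda>y. f y \<in> fst c) (nhds z)"
    using f chart_open[OF assms(2)]
    by (simp add: isCont_def tendsto_def eventually_nhds_conv_at)
  then obtain S where S: "open S" "z \<in> S" "\<And>y. y \<in> S \<Longrightarrow> f y \<in> fst c"
    unfolding eventually_nhds by auto
  have "((\<lambda>y. snd d (inver (f y))) has_derivative
     (\<lambda>h. frechet_derivative (snd d \<circ> inver \<circ> chart_inv c) (at (snd c (f z))) (L h))) (at z)"
    by (rule has_derivative_transform_within_open[OF 1 S(1,2)]) (use S assms in simp)
  moreover have "isCont (\<lambda>y. inver (f y)) z"
    using f unfolding isCont_def by (intro tendsto_inver)
  ultimately show ?thesis using assms unfolding chart_deriv_def by blast
qed

section \<open>Invariant vector fields\<close>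

text \<open>A fixed chart at the unit identifies the Lie algebra with the model space
  \<open>'e\<close>.\<close>

definition base :: "('a, 'e) chart" where
  "base = (SOME c. c \<in> charts_at A one)"

lemma base_chart: "base \<in> charts_at A one"
  unfolding base_def by (rule chart_exists[of one]) (rule someI)

lemma base_in [simp]: "base \<in> A" "one \<in> fst base"
  using base_chart by (auto simp: charts_at_def)

text \<open>\<open>rfield v\<close> and \<open>lfield v\<close> are the right and the left invariant field with value \<open>v\<close> at the
  unit, in the chart \<open>base\<close>.\<close> 

definition rfield :: "'e \<Rightarrow> ('a, 'e) vfield" where
  "rfield v = (\<lambda>g c. if c \<in> charts_at A g then dright base c one g v else 0)"

definition lfield :: "'e \<Rightarrow> ('a, 'e) vfield" where
  "lfield v = (\<lambda>g c. if c \<in> charts_at A g then dleft base c g one v else 0)"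

lemma rfield_apply: "c \<in> charts_at A g \<Longrightarrow> rfield v g c = dright base c one g v"
  and lfield_apply: "c \<in> charts_at A g \<Longrightarrow> lfield v g c = dleft base c g one v"
  by (simp_all add: rfield_def lfield_def)

lemma bounded_linear_rfield: "bounded_linear (\<lambda>v. rfield v g c)"
proof (cases "c \<in> charts_at A g")
  case True
  then show ?thesis using bounded_linear_dright[of base c one g] by
    (simp add: rfield_apply charts_at_def)
qed (simp add: rfield_def)

lemma rfield_add: "rfield (v + w) = rfield v + rfield w"
  by (simp add: fun_eq_iff linear_add[OF bounded_linear.linear[OF bounded_linear_rfield]])

lemma rfield_scaleR: "rfield (r *\<^sub>R v) = r *\<^sub>R rfield v"
  by (simp add: fun_eq_iff scaleR_fun_def linear_cmul[OF bounded_linear.linear[OF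
    bounded_linear_rfield]])

lemma rfield_zero: "rfield 0 = 0"
  by (simp add: fun_eq_iff linear_0[OF bounded_linear.linear[OF bounded_linear_rfield]])

lemma rfield_base [simp]: "rfield v one base = v"
  and lfield_base [simp]: "lfield v one base = v"
  using base_chart by (simp_all add: rfield_apply lfield_apply)

lemma rfield_mul:
  assumes "d \<in> charts_at A g" "c \<in> charts_at A (mul g h)"
  shows "rfield v (mul g h) c = dright d c g h (rfield v g d)"
  using assms dright_dright[of base d c one g h v] by (simp add: rfield_apply charts_at_def)

lemma lfield_mul:
  assumes "d \<in> charts_at A g" "c \<in> charts_at A (mul h g)"
  shows "lfield v (mul h g) c = dleft d c h g (lfield v g d)"
  using assms dleft_dleft[of base d c one g h v] by (simp add: lfield_apply charts_at_def)

lemma rfield_tangent: "rfield v g \<in> tangent_space A g"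
proof (rule tangent_spaceI)
  show "rfield v g d = dright c d g one (rfield v g c)" if "c \<in> charts_at A g"
    "d \<in> charts_at A g" for c d
    using rfield_mul[of c g d one v] that by simp
qed (simp add: rfield_def)

text \<open>In the chart \<open>c\<close> the field is the partial derivative of multiplication
  along \<open>(v, 0)\<close> with the unit as left factor, hence a slice of a smooth
  function.\<close>

lemma smooth_rfield: "c \<in> A \<Longrightarrow> smooth_on (snd c ` fst c) (\<lambda>x. rfield v (chart_inv c x) c)"
proof (rule smooth_on_cong[OF chart_image_open])
  assume c: "c \<in> A"
  show "smooth_on (snd c ` fst c) (\<lambda>x. frechet_derivative (mul_coord base c c) (at
    (snd base one, x)) (v, 0))"
    by (rule smooth_on_Pair_right[OF chart_image_open _ smooth_on_frechet_derivative[OF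
      smooth_mul_coord[of base c c]]])
      (use c in \<open>auto simp: mul_dom_def\<close>)
  show "frechet_derivative (mul_coord base c c) (at (snd base one, x)) (v, 0) = rfield v
    (chart_inv c x) c"
    if "x \<in> snd c ` fst c" for x
    using that c chart_inv_in[OF c that] chart_inv_right[OF c that]
    by (simp add: rfield_def charts_at_def dright_dmul[of base c] dmul_def)
qed

lemma smooth_lfield: "c \<in> A \<Longrightarrow> smooth_on (snd c ` fst c) (\<lambda>x. lfield v (chart_inv c x) c)"
proof (rule smooth_on_cong[OF chart_image_open])
  assume c: "c \<in> A"
  show "smooth_on (snd c ` fst c) (\<lambda>x. frechet_derivative (mul_coord c base c) (at (x,
    snd base one)) (0, v))"
    by (rule smooth_on_Pair_left[OF chart_image_open _ smooth_on_frechet_derivative[OF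
      smooth_mul_coord[of c base c]]])
      (use c in \<open>auto simp: mul_dom_def\<close>)
  show "frechet_derivative (mul_coord c base c) (at (x, snd base one)) (0, v) = lfield v
    (chart_inv c x) c"
    if "x \<in> snd c ` fst c" for x
    using that c chart_inv_in[OF c that] chart_inv_right[OF c that]
    by (simp add: lfield_def charts_at_def dleft_dmul[of c base] dmul_def)
qed

lemma rfield_in_lie_algebra: "rfield v \<in> lie_algebra A mul"
proof -
  have "differential A A (\<lambda>x. mul x h) g (rfield v g) c = rfield v (mul g h) c" for g h c
  proof (cases "c \<in> charts_at A (mul g h)")
    case True
    obtain d where d: "d \<in> charts_at A g" by (rule chart_exists)
    have "differential A A (\<lambda>x. mul x h) g (rfield v g) c = dright d c g h (rfield v g d)"
      by (rule differential_eq[OF d _ rfield_tangent chart_deriv_dright_chart])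
        (use True d in \<open>auto simp: charts_at_def\<close>)
    then show ?thesis using rfield_mul[OF d True] by simp
  next
    case False
    then show ?thesis using differential_zero[of c "\<lambda>x. mul x h" g] by (simp add: rfield_def)
  qed
  then show ?thesis
    unfolding lie_algebra_def vector_field_def by (auto simp: rfield_tangent smooth_rfield)
qed

text \<open>Invariance under right translation by \<open>g\<close>, applied at the unit, determines
  \<open>X g\<close> from \<open>X one\<close>.\<close>

lemma lie_algebra_eq_rfield:
  assumes "X \<in> lie_algebra A mul"
  shows "X = rfield (X one base)"
proof (intro ext)
  fix g c
  have t: "X g \<in> tangent_space A g" for g
    using assms unfolding lie_algebra_def vector_field_def by auto
  have d: "differential A A (\<lambda>x. mul x g) one (X one) = X (mul one g)"
    using assms unfolding lie_algebra_def by auto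
  show "X g c = rfield (X one base) g c"
  proof (cases "c \<in> charts_at A g")
    case True
    have "differential A A (\<lambda>x. mul x g) one (X one) c = dright base c one g (X one base)"
      by (rule differential_eq[OF base_chart _ t chart_deriv_dright_chart])
        (use True in \<open>auto simp: charts_at_def\<close>)
    then show ?thesis using d True by (simp add: rfield_apply)
  next
    case False
    then have "X g c = 0" using t[of g] unfolding tangent_space_def by blast
    then show ?thesis using False by (simp add: rfield_def)
  qed
qed

lemma lie_algebra_rfield: "lie_algebra A mul = range rfield"
  using lie_algebra_eq_rfield rfield_in_lie_algebra by blast

section \<open>Brackets of invariant fields\<close>

definition diff_field :: "('a, 'e) vfield \<Rightarrow> bool" where
  "diff_field V \<longleftrightarrow> (\<forall>c\<in>A. \<forall>x\<in>snd c ` fst c. (\<lambda>x. V (chart_inv c x) c) differentiable (at x))"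

definition dfield :: "('a, 'e) vfield \<Rightarrow> ('a, 'e) chart \<Rightarrow> 'a \<Rightarrow> 'e \<Rightarrow> 'e" where
  "dfield V c p = frechet_derivative (\<lambda>x. V (chart_inv c x) c) (at (snd c p))"

lemma diff_fieldD:
  "\<lbrakk>diff_field V; c \<in> charts_at A p\<rbrakk> \<Longrightarrow>
    ((\<lambda>x. V (chart_inv c x) c) has_derivative dfield V c p) (at (snd c p))"
  unfolding diff_field_def charts_at_def dfield_def by (auto simp: frechet_derivative_works)

lemma dfield_eqI: "((\<lambda>x. V (chart_inv c x) c) has_derivative V') (at (snd c p)) \<Longrightarrow> dfield V c p = V'"
  unfolding dfield_def by (rule frechet_derivative_at[symmetric])

lemma bounded_linear_dfield: "\<lbrakk>diff_field V; c \<in> charts_at A p\<rbrakk> \<Longrightarrow> bounded_linear (dfield V c p)"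
  using diff_fieldD by (blast intro: has_derivative_bounded_linear)

lemma diff_field_smooth:
  assumes "\<And>c. c \<in> A \<Longrightarrow> smooth_on (snd c ` fst c) (\<lambda>x. V (chart_inv c x) c)"
  shows "diff_field V"
  unfolding diff_field_def using smooth_on_has_derivative[OF assms] by
    (blast intro: differentiableI)

lemma diff_field_rfield: "diff_field (rfield v)" and diff_field_lfield: "diff_field (lfield v)"
  by (intro diff_field_smooth smooth_rfield smooth_lfield; assumption)+

lemma lie_bracket_eq:
  "c \<in> charts_at A p \<Longrightarrow> lie_bracket A V W p c = dfield W c p (V p c) - dfield V c p (W p c)"
  by (simp add: lie_bracket_def Let_def charts_at_def dfield_def)

lemma lie_bracket_zero: "c \<notin> charts_at A p \<Longrightarrow> lie_bracket A V W p c = 0"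
  by (simp add: lie_bracket_def)

lemma lie_bracket_antisym: "lie_bracket A V W = - lie_bracket A W V"
  by (simp add: fun_eq_iff lie_bracket_def Let_def)

lemma dfield_diff:
  "\<lbrakk>diff_field V; diff_field W; c \<in> charts_at A p\<rbrakk> \<Longrightarrow> dfield (V - W) c p =
    (\<lambda>h. dfield V c p h - dfield W c p h)"
  by (rule dfield_eqI) (simp add: has_derivative_diff diff_fieldD)

lemma dfield_add:
  "\<lbrakk>diff_field V; diff_field W; c \<in> charts_at A p\<rbrakk> \<Longrightarrow> dfield (V + W) c p =
    (\<lambda>h. dfield V c p h + dfield W c p h)"
  by (rule dfield_eqI) (simp add: has_derivative_add diff_fieldD)

lemma dfield_scaleR:
  "\<lbrakk>diff_field V; c \<in> charts_at A p\<rbrakk> \<Longrightarrow> dfield (r *\<^sub>R V) c p = (\<lambda>h. r *\<^sub>R dfield V c p h)"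
  by (rule dfield_eqI) (simp add: has_derivative_scaleR_right diff_fieldD scaleR_fun_def)

lemma diff_field_diff:
  assumes "diff_field V" "diff_field W"
  shows "diff_field (V - W)"
  using assms unfolding diff_field_def by (auto intro: differentiable_diff)

lemma lie_bracket_diff_left:
  assumes V: "diff_field V" and V': "diff_field V'" and W: "diff_field W"
  shows "lie_bracket A (V - V') W = lie_bracket A V W - lie_bracket A V' W"
proof (intro ext)
  fix p c
  show "lie_bracket A (V - V') W p c = (lie_bracket A V W - lie_bracket A V' W) p c"
  proof (cases "c \<in> charts_at A p")
    case c: True
    show ?thesis
      using linear_diff[OF bounded_linear.linear[OF bounded_linear_dfield[OF W c]]]
      by (simp add: lie_bracket_eq[OF c] dfield_diff[OF V V' c])
  qed (simp add: lie_bracket_zero)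
qed

lemma lie_bracket_add_right:
  assumes V: "diff_field V" and V': "diff_field V'" and W: "diff_field W"
  shows "lie_bracket A W (V + V') = lie_bracket A W V + lie_bracket A W V'"
proof (intro ext)
  fix p c
  show "lie_bracket A W (V + V') p c = (lie_bracket A W V + lie_bracket A W V') p c"
  proof (cases "c \<in> charts_at A p")
    case c: True
    show ?thesis
      using linear_add[OF bounded_linear.linear[OF bounded_linear_dfield[OF W c]]]
      by (simp add: lie_bracket_eq[OF c] dfield_add[OF V V' c])
  qed (simp add: lie_bracket_zero)
qed

lemma lie_bracket_scaleR_right:
  assumes V: "diff_field V" and W: "diff_field W"
  shows "lie_bracket A W (r *\<^sub>R V) = r *\<^sub>R lie_bracket A W V"
proof (intro ext)
  fix p c
  show "lie_bracket A W (r *\<^sub>R V) p c = (r *\<^sub>R lie_bracket A W V) p c"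
  proof (cases "c \<in> charts_at A p")
    case c: True
    have "(r *\<^sub>R V) p c = r *\<^sub>R V p c" "(r *\<^sub>R lie_bracket A W V) p c = r *\<^sub>R lie_bracket A W V p c"
      by (simp_all add: scaleR_fun_def)
    then show ?thesis
      using linear_cmul[OF bounded_linear.linear[OF bounded_linear_dfield[OF W c]]]
      by (simp add: lie_bracket_eq[OF c] dfield_scaleR[OF V c] scaleR_diff_right)
  qed (simp add: lie_bracket_zero scaleR_fun_def)
qed

text \<open>Right translation by \<open>p\<close> relates every right invariant field to itself,
  hence also the bracket of two of them, whose value at \<open>p\<close> is therefore transported
  from the unit.\<close>

lemma lie_bracket_rfield_rfield: "lie_bracket A (rfield v) (rfield w) = rfield (lie_bracket A
  (rfield v) (rfield w) one base)"
proof (intro ext)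
  fix p c
  show "lie_bracket A (rfield v) (rfield w) p c = rfield (lie_bracket A (rfield v) (rfield w)
    one base) p c"
  proof (cases "c \<in> charts_at A p")
    case c: True
    note c' = charts_atD[OF c]
    let ?f = "\<lambda>y. snd c (mul (chart_inv base y) p)"
    let ?f' = "\<lambda>y. dright base c (chart_inv base y) p"
    let ?e = "snd base one"
    \<comment> \<open>The auxiliary chart \<open>d\<close> exhibits right translation by
      \<open>p\<close> as a slice of \<open>mul_coord base d c\<close>, so that its second
      derivative comes from the smoothness of multiplication.\<close>
    obtain d where d: "d \<in> charts_at A p" by (rule chart_exists)
    note d' = charts_atD[OF d]
    define S where "S = (\<lambda>y. (y, snd d p)) -` mul_dom base d c"
    have S: "open S" unfolding S_def
      by (intro continuous_open_vimage open_mul_dom continuous_intros) (use c' d' in auto)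
    have e: "?e \<in> S" using c' d' by (simp add: S_def mul_dom_def)
    have in_S: "y \<in> snd base ` fst base" "chart_inv base y \<in> fst base" "snd base
      (chart_inv base y) = y"
        "mul (chart_inv base y) p \<in> fst c" if "y \<in> S" for y
      using that d' by (auto simp: S_def mul_dom_def chart_inv_in chart_inv_right)
    have f: "(?f has_derivative ?f' y) (at y)" if "y \<in> S" for y
      using chart_deriv_dright_chart[of base c "chart_inv base y" p] in_S[OF that] c'
      by (simp add: chart_deriv_def)
    let ?G = "\<lambda>u z. frechet_derivative (mul_coord base d c) (at z) (u, 0)"
    have f'': "((\<lambda>y. ?f' y u) has_derivative (\<lambda>h. frechet_derivative (?G u) (at (?e, snd d p))
      (h, 0))) (at ?e)" for u
    proof (rule has_derivative_transform_within_open[OF _ S e])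
      have "(?G u has_derivative frechet_derivative (?G u) (at (?e, snd d p))) (at (?e, snd d p))"
        by (rule smooth_on_has_derivative[OF smooth_on_frechet_derivative[OF smooth_mul_coord]])
          (use e c' d' in \<open>auto simp: S_def\<close>)
      moreover have "((\<lambda>y. (y, snd d p)) has_derivative (\<lambda>h. (h, 0))) (at ?e)"
        by (auto intro!: derivative_eq_intros)
      ultimately show "((\<lambda>y. ?G u (y, snd d p)) has_derivative (\<lambda>h. frechet_derivative (?G u)
        (at (?e, snd d p)) (h, 0))) (at ?e)"
        by (rule has_derivative_compose[rotated])
      show "?G u (y, snd d p) = ?f' y u" if "y \<in> S" for y
        using in_S[OF that] c' d' by (simp add: dright_dmul[of base d] dmul_def)
    qed
    have rel: "?f' y (rfield u (chart_inv base y) base) = rfield u (chart_inv c (?f y)) c" if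
      "y \<in> S" for y u
      using rfield_mul[of base "chart_inv base y" c p u] in_S[OF that] c' by
        (simp add: charts_at_def)
    have fe: "?f ?e = snd c p" by simp
    note dd = diff_fieldD[OF diff_field_rfield]
    let ?D = "\<lambda>u c p. dfield (rfield u) c p"
    have "?f' ?e (?D w base one (rfield v (chart_inv base ?e) base) - ?D v base one (rfield w
      (chart_inv base ?e) base))
      = ?D w c p (rfield v (chart_inv c (?f ?e)) c) - ?D v c p (rfield w (chart_inv c (?f ?e)) c)"
      by (rule bracket_related[OF S e f f'' dd dd _ _ rel rel])
        (use dd[OF c] base_chart in \<open>simp_all add: fe\<close>)
    also have "\<dots> = lie_bracket A (rfield v) (rfield w) p c"
      using c' by (simp add: lie_bracket_eq[OF c])
    finally show ?thesis
      using c by (simp add: rfield_apply lie_bracket_eq[OF base_chart])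
  qed (simp add: lie_bracket_zero rfield_def)
qed

text \<open>Left and right translations commute: differentiate \<open>(a y) b = a (y b)\<close> in \<open>a\<close> and then in
  \<open>b\<close>.\<close> 

lemma lie_bracket_rfield_lfield: "lie_bracket A (rfield v) (lfield w) = 0"
proof (intro ext)
  fix p c
  show "lie_bracket A (rfield v) (lfield w) p c = 0 p c"
  proof (cases "c \<in> charts_at A p")
    case c: True
    note c' = charts_atD[OF c]
    let ?M = "mul_coord c base c" and ?y = "snd c p" and ?e = "snd base one"
    let ?z = "(?y, ?e)"
    have dom: "open (mul_dom c base c)" "?z \<in> mul_dom c base c"
      by (rule open_mul_dom) (use c' in \<open>auto simp: mul_dom_def\<close>)
    have M: "(?M has_derivative frechet_derivative ?M (at z)) (at z)" if "z \<in> mul_dom c base c"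
      for z
      by (rule smooth_on_has_derivative[OF smooth_mul_coord that]) (use c' in auto)
    let ?G = "\<lambda>u z. frechet_derivative ?M (at z) u"
    have G: "(?G u has_derivative frechet_derivative (?G u) (at ?z)) (at ?z)" for u
      by (rule smooth_on_has_derivative[OF smooth_on_frechet_derivative[OF smooth_mul_coord]
        dom(2)])
        (use c' in auto)
    let ?R = "\<lambda>x. rfield v (chart_inv c x) c" and ?L = "\<lambda>x. lfield w (chart_inv c x) c"
    let ?R' = "dfield (rfield v) c p" and ?L' = "dfield (lfield w) c p"
    have R': "(?R has_derivative ?R') (at ?y)" and L': "(?L has_derivative ?L') (at ?y)"
      by (rule diff_fieldD[OF diff_field_rfield c] diff_fieldD[OF diff_field_lfield c])+
    let ?r = "rfield v p c"
    have dM: "frechet_derivative ?M (at ?z) (0, h) = lfield h p c" for h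
      using c c' by (simp add: lfield_apply dleft_dmul[of c base] dmul_def)
    obtain r where r: "r > 0" "ball ?z r \<subseteq> mul_dom c base c" using dom open_contains_ball by blast
    \<comment> \<open>The mixed second derivatives of multiplication at \<open>(p, one)\<close>: one
      direction moves the left factor by \<open>?r\<close>, the other the right factor by
      \<open>w\<close>.\<close>
    have sym: "frechet_derivative (?G (?r, 0)) (at ?z) (0, w) = frechet_derivative (?G (0, w))
      (at ?z) (?r, 0)"
      by (rule symmetric_second_derivative[OF _ r(1) G G, of ?M]) (use M r in auto)
    have "(?L has_derivative (\<lambda>h. frechet_derivative (?G (0, w)) (at ?z) (h, 0))) (at ?y)"
    proof (rule has_derivative_transform_within_open[OF _ chart_image_open[OF c'(1)]])
      show "((\<lambda>x. ?G (0, w) (x, ?e)) has_derivative (\<lambda>h. frechet_derivative (?G (0, w)) (at ?z)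
        (h, 0))) (at ?y)"
        by (rule has_derivative_compose[where f="\<lambda>x. (x, ?e)", OF _ G])
          (auto intro!: derivative_eq_intros)
      show "?G (0, w) (x, ?e) = ?L x" if "x \<in> snd c ` fst c" for x
        using that c' chart_inv_in[OF c'(1) that] chart_inv_right[OF c'(1) that]
        by (simp add: lfield_def charts_at_def dleft_dmul[of c base] dmul_def)
    qed (use c' in auto)
    then have L'_eq: "?L' = (\<lambda>h. frechet_derivative (?G (0, w)) (at ?z) (h, 0))"
      using L' has_derivative_unique by blast
    let ?T = "(\<lambda>b. (?y, b)) -` mul_dom c base c"
    have T: "open ?T" "?e \<in> ?T"
      using dom by (auto intro!: continuous_open_vimage continuous_intros)
    \<comment> \<open>By right invariance the partial derivative along \<open>(?r, 0)\<close> is the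
      value of \<open>rfield v\<close> at the product of \<open>p\<close> and the point with
      coordinate \<open>b\<close>; differentiating in \<open>b\<close> in both forms gives two
      expressions for the mixed derivative.\<close>
    have "((\<lambda>b. ?G (?r, 0) (?y, b)) has_derivative (\<lambda>h. frechet_derivative (?G (?r, 0)) (at ?z)
      (0, h))) (at ?e)"
      by (rule has_derivative_compose[where f="\<lambda>b. (?y, b)", OF _ G])
        (auto intro!: derivative_eq_intros)
    moreover have "((\<lambda>b. ?G (?r, 0) (?y, b)) has_derivative (\<lambda>h. ?R' (lfield h p c))) (at ?e)"
    proof (rule has_derivative_transform_within_open[OF _ T])
      have "(Pair ?y has_derivative Pair 0) (at ?e)" by (auto intro!: derivative_eq_intros)
      from has_derivative_compose[OF this M[OF dom(2)]]
      have "((\<lambda>b. ?M (?y, b)) has_derivative (\<lambda>h. lfield h p c)) (at ?e)" by (simp add: dM)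
      moreover have "?M (?y, ?e) = ?y" using c' by (simp add: mul_coord_def)
      with R' have "(?R has_derivative ?R') (at (?M (?y, ?e)))" by simp
      ultimately show "((\<lambda>b. ?R (?M (?y, b))) has_derivative (\<lambda>h. ?R' (lfield h p c))) (at ?e)"
        by (rule has_derivative_compose)
      fix b assume b: "b \<in> ?T"
      then have b': "chart_inv base b \<in> fst base" "snd base (chart_inv base b) = b" "mul p
        (chart_inv base b) \<in> fst c"
        using c' by (auto simp: mul_dom_def chart_inv_in chart_inv_right)
      have "?R (?M (?y, b)) = rfield v (mul p (chart_inv base b)) c"
        using b' c' by (simp add: mul_coord_def)
      also have "\<dots> = dright c c p (chart_inv base b) ?r"
        by (rule rfield_mul[OF c]) (use b' c' in \<open>simp add: charts_at_def\<close>)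
      also have "\<dots> = ?G (?r, 0) (?y, b)"
        using b' c' by (simp add: dright_dmul[of c base] dmul_def)
      finally show "?R (?M (?y, b)) = ?G (?r, 0) (?y, b)" .
    qed
    ultimately have "frechet_derivative (?G (?r, 0)) (at ?z) (0, w) = ?R' (lfield w p c)"
      using has_derivative_unique by metis
    then show ?thesis
      using sym by (simp add: lie_bracket_eq[OF c] L'_eq)
  qed (simp add: lie_bracket_zero)
qed

end

section \<open>Integral curves and one-parameter subgroups\<close>

text \<open>Each directional derivative is continuous; the finite net turns this into a bound on the
  operator norm of the derivative near \<open>x0\<close>, and the mean value inequality applies on a
  ball.\<close>

lemma smooth_on_locally_lipschitz:
  fixes V :: "'e::{real_normed_vector,heine_borel} \<Rightarrow> 'f::real_normed_vector"
  assumes S: "open S" "x0 \<in> S" and V: "smooth_on S V"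
  obtains r K where "r > 0" "K \<ge> 0" "cball x0 r \<subseteq> S"
    "\<And>x y. \<lbrakk>x \<in> cball x0 r; y \<in> cball x0 r\<rbrakk> \<Longrightarrow> norm (V x - V y) \<le> K * norm (x - y)"
proof -
  let ?D = "\<lambda>x. frechet_derivative V (at x)"
  have D: "(V has_derivative ?D x) (at x)" if "x \<in> S" for x
    using smooth_on_has_derivative[OF V that] .
  have bl: "bounded_linear (?D x)" if "x \<in> S" for x using D[OF that] by (rule
    has_derivative_bounded_linear)
  have S': "eventually (\<lambda>x. x \<in> S) (nhds x0)" using S by (rule eventually_nhds_in_open)
  have "((\<lambda>x. ?D x v) \<longlongrightarrow> ?D x0 v) (nhds x0)" for v
    using smooth_on_imp_continuous_on[OF smooth_on_frechet_derivative[OF V, of v]] S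
    by (metis continuous_on_eq_continuous_at isCont_def tendsto_at_iff_tendsto_nhds)
  from eventually_uniform_pointwise_linear[OF this _ bl[OF S(2)], of 1]
  have "eventually (\<lambda>x. \<forall>v. norm (?D x v - ?D x0 v) \<le> 1 * norm v) (nhds x0)"
    using eventually_mono[OF S' bl] by simp
  with S' have "eventually (\<lambda>x. x \<in> S \<and> (\<forall>v. norm (?D x v - ?D x0 v) \<le> norm v)) (nhds x0)"
    by eventually_elim simp
  then obtain d where d: "d > 0" "\<And>x. dist x x0 < d \<Longrightarrow> x \<in> S \<and> (\<forall>v. norm (?D x v - ?D x0 v)
    \<le> norm v)"
    unfolding eventually_nhds_metric by blast
  define K where "K = onorm (?D x0) + 1"
  have K: "K \<ge> 0" unfolding K_def using onorm_pos_le[OF bl[OF S(2)]] by simp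
  have sub: "x \<in> S \<and> onorm (?D x) \<le> K" if "x \<in> cball x0 (d/2)" for x
  proof -
    have x: "dist x x0 < d" using that d(1) by (simp add: dist_commute)
    have "onorm (?D x) \<le> K"
    proof (rule onorm_bound[OF K])
      fix v
      have "norm (?D x v) \<le> norm (?D x0 v) + norm (?D x v - ?D x0 v)" by (rule norm_triangle_sub)
      also have "\<dots> \<le> onorm (?D x0) * norm v + norm v"
        using d(2)[OF x] onorm[OF bl[OF S(2)]] by (intro add_mono) auto
      finally show "norm (?D x v) \<le> K * norm v" by (simp add: K_def algebra_simps)
    qed
    with d(2)[OF x] show ?thesis by blast
  qed
  show thesis
  proof
    show "d/2 > 0" "K \<ge> 0" "cball x0 (d/2) \<subseteq> S" using d K sub by auto
    fix x y assume xy: "x \<in> cball x0 (d/2)" "y \<in> cball x0 (d/2)"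
    show "norm (V x - V y) \<le> K * norm (x - y)"
      by (rule differentiable_bound[OF convex_cball _ _ xy, where f'="?D"])
        (use sub D has_derivative_at_withinI in blast)+
  qed
qed

lemma has_vector_derivative_norm_bound:
  fixes f :: "real \<Rightarrow> 'b::real_normed_vector"
  assumes "convex S" "x \<in> S" "y \<in> S"
    and "\<And>t. t \<in> S \<Longrightarrow> (f has_vector_derivative f' t) (at t within S)"
    and "\<And>t. t \<in> S \<Longrightarrow> norm (f' t) \<le> B"
  shows "norm (f x - f y) \<le> B * \<bar>x - y\<bar>"
proof -
  have B: "B \<ge> 0" using assms(2) assms(5) norm_ge_zero order_trans by blast
  have "norm (f x - f y) \<le> B * norm (x - y)"
  proof (rule differentiable_bound[OF assms(1) _ _ assms(2,3), where f'="\<lambda>t h. h *\<^sub>R f' t"])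
    show "(f has_derivative (\<lambda>h. h *\<^sub>R f' t)) (at t within S)" if "t \<in> S" for t
      using assms(4)[OF that] by (simp add: has_vector_derivative_def)
    show "onorm (\<lambda>h. h *\<^sub>R f' t) \<le> B" if "t \<in> S" for t
      by (rule onorm_bound[OF B]) (use assms(5)[OF that] in \<open>simp add: mult.commute[of B]
        mult_left_mono\<close>)
  qed
  then show ?thesis by simp
qed

text \<open>At a maximum of the distance over a short interval, the mean value inequality bounds the
  distance by half of itself.\<close>

lemma ode_unique_local:
  fixes V :: "'e::real_normed_vector \<Rightarrow> 'e"
  assumes lip: "\<And>x y. \<lbrakk>x \<in> S; y \<in> S\<rbrakk> \<Longrightarrow> norm (V x - V y) \<le> K * norm (x - y)"
    and "d > 0" and K: "K \<ge> 0"
    and f: "\<And>t. \<bar>t - t0\<bar> < d \<Longrightarrow> f t \<in> S \<and> (f has_vector_derivative V (f t)) (at t)"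
    and g: "\<And>t. \<bar>t - t0\<bar> < d \<Longrightarrow> g t \<in> S \<and> (g has_vector_derivative V (g t)) (at t)"
    and eq: "f t0 = g t0"
  obtains e where "e > 0" "\<And>t. \<bar>t - t0\<bar> < e \<Longrightarrow> f t = g t"
proof -
  \<comment> \<open>\<open>d/2\<close> keeps the closed interval inside the domain, and the second
    term makes \<open>K * e\<close> at most \<open>1/2\<close>.\<close>
  define e where "e = min (d/2) (1 / (2 * (K + 1)))"
  have e: "e > 0" "e < d" "K * e \<le> 1/2"
  proof -
    show "e > 0" "e < d" using \<open>d > 0\<close> K by (auto simp: e_def)
    have "K * e \<le> K * (1 / (2 * (K + 1)))" using K by (intro mult_left_mono) (auto simp: e_def)
    also have "\<dots> \<le> 1/2" using K by (simp add: field_simps)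
    finally show "K * e \<le> 1/2" .
  qed
  let ?I = "{t0 - e..t0 + e}" and ?h = "\<lambda>t. f t - g t"
  have I: "\<bar>t - t0\<bar> < d" if "t \<in> ?I" for t using that e by auto
  have der: "(?h has_vector_derivative V (f t) - V (g t)) (at t within ?I)" if "t \<in> ?I" for t
    using f[OF I[OF that]] g[OF I[OF that]] by (blast intro: has_vector_derivative_diff
      has_vector_derivative_at_within)
  have "continuous_on ?I (\<lambda>t. norm (?h t))"
    using der by (intro continuous_on_norm) (meson continuous_on_eq_continuous_within
      has_vector_derivative_continuous)
  then obtain s where s: "s \<in> ?I" "\<And>t. t \<in> ?I \<Longrightarrow> norm (?h t) \<le> norm (?h s)"
    using continuous_attains_sup[of ?I "\<lambda>t. norm (?h t)"] e(1) by fastforce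
  have "norm (?h s - ?h t0) \<le> (K * norm (?h s)) * \<bar>s - t0\<bar>"
  proof (rule has_vector_derivative_norm_bound[OF _ s(1) _ der])
    fix t assume t: "t \<in> ?I"
    have "norm (V (f t) - V (g t)) \<le> K * norm (?h t)" using f[OF I[OF t]] g[OF I[OF t]] by
      (intro lip) auto
    also have "\<dots> \<le> K * norm (?h s)" using s(2)[OF t] K by (intro mult_left_mono)
    finally show "norm (V (f t) - V (g t)) \<le> K * norm (?h s)" .
  qed (use e in auto)
  also have "\<dots> \<le> (K * norm (?h s)) * e" using s(1) K by (intro mult_left_mono) auto
  also have "\<dots> = (K * e) * norm (?h s)" by simp
  also have "\<dots> \<le> 1/2 * norm (?h s)" using e(3) by (intro mult_right_mono) auto
  finally have "norm (?h s) \<le> 0" using eq by simp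
  then have "f t = g t" if "\<bar>t - t0\<bar> < e" for t
    using s(2)[of t] that by (simp add: abs_diff_less_iff)
  with e(1) show thesis by (rule that)
qed

text \<open>Picard iteration. Freezing the time outside \<open>{-a..a}\<close> lets the integral
  operator act on the bounded continuous functions from the whole line to the ball, a complete
  space.\<close>

lemma ode_exists_local:
  fixes V :: "'e::banach \<Rightarrow> 'e"
  assumes r: "r > 0" and K: "K \<ge> 0"
    and lip: "\<And>x y. \<lbrakk>x \<in> cball x0 r; y \<in> cball x0 r\<rbrakk> \<Longrightarrow> norm (V x - V y) \<le> K * norm (x - y)"
  obtains a y where "a > 0" "y 0 = x0"
    "\<forall>t. \<bar>t\<bar> < a \<longrightarrow> y t \<in> cball x0 r \<and> (y has_vector_derivative V (y t)) (at t)"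
proof -
  let ?B = "cball x0 r"
  define M where "M = norm (V x0) + K * r"
  have M: "M \<ge> 0" using r K by (simp add: M_def)
  have V_bound: "norm (V x) \<le> M" if "x \<in> ?B" for x
  proof -
    have "norm (V x - V x0) \<le> K * norm (x - x0)" using that r by (intro lip) auto
    also have "\<dots> \<le> K * r" using that K by (intro mult_left_mono)
      (auto simp: dist_norm norm_minus_commute)
    finally show ?thesis using norm_triangle_sub[of "V x" "V x0"] by (simp add: M_def)
  qed
  have contV: "continuous_on ?B V"
    by (rule lipschitz_on_continuous_on[of K], rule lipschitz_onI)
      (use lip K in \<open>auto simp: dist_norm\<close>)
  \<comment> \<open>The first bound keeps the iterates in the ball, the second makes the operator a
    contraction with factor \<open>1/2\<close>.\<close>
  define a where "a = min (r / (M + 1)) (1 / (2 * (K + 1)))"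
  have a: "a > 0" "M * a \<le> r" "K * a \<le> 1/2"
  proof -
    show "a > 0" using r M K by (simp add: a_def)
    have "M * a \<le> M * (r / (M + 1))" using M by (intro mult_left_mono) (auto simp: a_def)
    also have "\<dots> \<le> r" using M r by (simp add: field_simps)
    finally show "M * a \<le> r" .
    have "K * a \<le> K * (1 / (2 * (K + 1)))" using K by (intro mult_left_mono) (auto simp: a_def)
    also have "\<dots> \<le> 1/2" using K by (simp add: field_simps)
    finally show "K * a \<le> 1/2" .
  qed
  let ?I = "{-a..a}"
  define clamp where "clamp t = max (-a) (min a t)" for t :: real
  have clamp: "clamp t \<in> ?I" for t using a(1) by (auto simp: clamp_def)
  have clamp_id: "clamp t = t" if "t \<in> ?I" for t using that by (auto simp: clamp_def)
  have cont_clamp: "continuous_on UNIV clamp" unfolding clamp_def by (intro continuous_intros)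
  \<comment> \<open>The difference of two integrals from \<open>-a\<close> is the oriented integral
    from \<open>0\<close> to \<open>t\<close>, for \<open>t\<close> of either sign.\<close>
  define J where "J y t = integral {-a..t} (\<lambda>s. V (apply_bcontfun y s)) - integral {-a..0}
    (\<lambda>s. V (apply_bcontfun y s))"
    for y t
  let ?X = "PiC (UNIV :: real set) (\<lambda>_. ?B)"
  have X: "apply_bcontfun y t \<in> ?B" if "y \<in> ?X" for y t using that by (auto simp: mem_PiC_iff)
  have J_der: "(J y has_vector_derivative V (apply_bcontfun y t)) (at t within ?I)" if "y \<in> ?X"
    "t \<in> ?I" for y t
  proof -
    have "continuous_on ?I (\<lambda>s. V (apply_bcontfun y s))"
      by (rule continuous_on_compose2[OF contV]) (use X[OF that(1)] in auto)
    then have "((\<lambda>t. integral {-a..t} (\<lambda>s. V (apply_bcontfun y s))) has_vector_derivative V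
      (apply_bcontfun y t)) (at t within ?I)"
      using that(2) by (rule integral_has_vector_derivative)
    then show ?thesis unfolding J_def
      by (simp add: has_vector_derivative_diff_const)
  qed
  have J0: "J y 0 = 0" for y by (simp add: J_def)
  have J_bound: "norm (J y t) \<le> r" if "y \<in> ?X" "t \<in> ?I" for y t
  proof -
    have "norm (J y t - J y 0) \<le> M * \<bar>t - 0\<bar>"
      by (rule has_vector_derivative_norm_bound[OF _ that(2) _ J_der[OF that(1)]])
        (use a V_bound X[OF that(1)] in auto)
    also have "\<dots> \<le> M * a" using M that by (intro mult_left_mono) auto
    finally show ?thesis using a by (simp add: J0)
  qed
  have J_cont: "continuous_on ?I (J y)" if "y \<in> ?X" for y
    using J_der[OF that] by (meson continuous_on_eq_continuous_within
      has_vector_derivative_continuous)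
  define P where "P y = Bcontfun (\<lambda>t. x0 + J y (clamp t))" for y
  have P_apply: "apply_bcontfun (P y) = (\<lambda>t. x0 + J y (clamp t))" if "y \<in> ?X" for y
    unfolding P_def
  proof (rule Bcontfun_inverse)
    have "continuous_on UNIV (\<lambda>t. x0 + J y (clamp t))"
      by (intro continuous_intros continuous_on_compose2[OF J_cont[OF that] cont_clamp])
        (use clamp in auto)
    moreover have "bounded (range (\<lambda>t. x0 + J y (clamp t)))"
    proof (rule bounded_subset[OF bounded_cball])
      show "range (\<lambda>t. x0 + J y (clamp t)) \<subseteq> ?B" using J_bound[OF that clamp] by
        (auto simp: dist_norm)
    qed
    ultimately show "(\<lambda>t. x0 + J y (clamp t)) \<in> bcontfun" by (simp add: bcontfun_def)
  qed
  have "\<exists>!y. y \<in> ?X \<and> P y = y"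
  proof (rule Banach_fix[of _ "1/2"])
    show "complete ?X" using closed_PiC[of UNIV "\<lambda>_. ?B"] by (simp add: complete_eq_closed)
    show "?X \<noteq> {}"
    proof -
      have "const_bcontfun x0 \<in> ?X" using r by (auto simp: mem_PiC_iff const_bcontfun.rep_eq)
      then show ?thesis by blast
    qed
    show "P ` ?X \<subseteq> ?X"
    proof safe
      fix y assume "y \<in> ?X"
      then show "P y \<in> ?X" using J_bound[OF _ clamp] by (auto simp: mem_PiC_iff P_apply dist_norm)
    qed
    fix y z assume yz: "y \<in> ?X" "z \<in> ?X"
    show "dist (P y) (P z) \<le> 1/2 * dist y z"
    proof (rule dist_bound)
      fix t
      let ?t = "clamp t"
      have "norm ((J y ?t - J z ?t) - (J y 0 - J z 0)) \<le> (K * dist y z) * \<bar>?t - 0\<bar>"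
      proof (rule has_vector_derivative_norm_bound[OF _ clamp])
        fix s assume s: "s \<in> ?I"
        show "((\<lambda>s. J y s - J z s) has_vector_derivative V (apply_bcontfun y s) - V
          (apply_bcontfun z s)) (at s within ?I)"
          by (intro has_vector_derivative_diff J_der yz s)
        have "norm (V (apply_bcontfun y s) - V (apply_bcontfun z s)) \<le> K * norm
          (apply_bcontfun y s - apply_bcontfun z s)"
          by (intro lip X yz)
        also have "\<dots> \<le> K * dist y z"
          using dist_bounded[of y s z] K by (intro mult_left_mono) (auto simp: dist_norm)
        finally show "norm (V (apply_bcontfun y s) - V (apply_bcontfun z s)) \<le> K * dist y z" .
      qed (use a in auto)
      also have "\<dots> \<le> (K * dist y z) * a" using clamp[of t] K by (intro mult_left_mono) auto
      also have "\<dots> = (K * a) * dist y z" by simp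
      also have "\<dots> \<le> 1/2 * dist y z" using a by (intro mult_right_mono) auto
      finally show "dist (apply_bcontfun (P y) t) (apply_bcontfun (P z) t) \<le> 1/2 * dist y z"
        by (simp add: P_apply yz J0 dist_norm)
    qed
  qed auto
  then obtain y where y: "y \<in> ?X" "P y = y" by blast
  have y_eq: "apply_bcontfun y t = x0 + J y (clamp t)" for t
    using P_apply[OF y(1)] y(2) by metis
  show thesis
  proof
    show "a > 0" by fact
    show "apply_bcontfun y 0 = x0" using a(1) by (simp add: y_eq clamp_id J0)
    have "apply_bcontfun y t \<in> ?B \<and> (apply_bcontfun y has_vector_derivative V
      (apply_bcontfun y t)) (at t)"
      if t: "\<bar>t\<bar> < a" for t
    proof -
    have "t \<in> interior ?I" using t by auto
    then have "(J y has_vector_derivative V (apply_bcontfun y t)) (at t)"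
      using J_der[OF y(1), of t] t at_within_interior[of t ?I] by (metis interior_subset subsetD)
    then have "((\<lambda>t. x0 + J y t) has_vector_derivative V (apply_bcontfun y t)) (at t)"
      by (simp add: has_vector_derivative_add_const add.commute[of x0])
    then have "(apply_bcontfun y has_vector_derivative V (apply_bcontfun y t)) (at t)"
      by (rule has_vector_derivative_transform_within_open[where S="{-a<..<a}"])
        (use t in \<open>auto simp: y_eq clamp_id\<close>)
    with X[OF y(1)] show ?thesis by blast
    qed
    then show "\<forall>t. \<bar>t\<bar> < a \<longrightarrow> apply_bcontfun y t \<in> ?B \<and>
        (apply_bcontfun y has_vector_derivative V (apply_bcontfun y t)) (at t)" by blast
  qed
qed

text \<open>Halving the argument \<open>n\<close> times and squaring the value \<open>n\<close>
  times cancel, so \<open>F n t\<close> is the same for all large \<open>n\<close>. Values at small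
  arguments commute because addition does, hence squaring is multiplicative on them.\<close>

lemma (in group) extend_local_hom:
  fixes \<gamma> :: "real \<Rightarrow> 'a"
  assumes b: "b > 0" and hom: "\<And>s t. \<lbrakk>\<bar>s\<bar> < b; \<bar>t\<bar> < b\<rbrakk> \<Longrightarrow> \<gamma> (s + t) = \<gamma> s \<^bold>* \<gamma> t"
  obtains \<Gamma> where "\<And>s t. \<Gamma> (s + t) = \<Gamma> s \<^bold>* \<Gamma> t" "\<And>t. \<bar>t\<bar> < b \<Longrightarrow> \<Gamma> t = \<gamma> t"
proof -
  define sq where "sq x = x \<^bold>* x" for x
  define F where "F n t = (sq ^^ n) (\<gamma> (t / 2 ^ n))" for n t
  have F_Suc: "F (Suc n) t = F n t" if "\<bar>t\<bar> < 2 ^ n * b" for n t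
  proof -
    have "\<bar>t / 2 ^ Suc n\<bar> < b"
    proof -
      have "\<bar>t\<bar> < 2 ^ Suc n * b" using that b by (simp add: less_le_trans)
      then show ?thesis by (simp add: abs_divide field_simps)
    qed
    note small = this
    have "sq (\<gamma> (t / 2 ^ Suc n)) = \<gamma> (t / 2 ^ Suc n + t / 2 ^ Suc n)"
      unfolding sq_def by (rule hom[OF small small, symmetric])
    also have "t / 2 ^ Suc n + t / 2 ^ Suc n = t / 2 ^ n" by simp
    finally show ?thesis by (simp add: F_def funpow_swap1)
  qed
  have F_mono: "F (n + k) t = F n t" if "\<bar>t\<bar> < 2 ^ n * b" for n k t
  proof (induction k)
    case (Suc k)
    have "\<bar>t\<bar> < 2 ^ (n + k) * b"
      using less_le_trans[OF that, of "2 ^ (n + k) * b"] b by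
        (simp add: mult_right_mono power_increasing)
    with Suc show ?case by (simp add: F_Suc)
  qed simp
  have bound_ex: "\<exists>n. \<bar>t\<bar> < 2 ^ n * b" for t
    using real_arch_pow[of 2 "\<bar>t\<bar> / b"] b by (auto simp: field_simps)
  define N where "N t = (LEAST n. \<bar>t\<bar> < 2 ^ n * b)" for t
  have N: "\<bar>t\<bar> < 2 ^ N t * b" for t unfolding N_def using bound_ex by (rule LeastI_ex)
  have N_le: "N t \<le> n" if "\<bar>t\<bar> < 2 ^ n * b" for t n unfolding N_def using that by (rule Least_le)
  define \<Gamma> where "\<Gamma> t = F (N t) t" for t
  have \<Gamma>: "\<Gamma> t = F n t" if "\<bar>t\<bar> < 2 ^ n * b" for n t
    using F_mono[OF N, of t "n - N t"] N_le[OF that] by (simp add: \<Gamma>_def)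
  have sq_mult: "(sq ^^ n) (x \<^bold>* y) = (sq ^^ n) x \<^bold>* (sq ^^ n) y" if "x \<^bold>* y = y \<^bold>* x" for n x y
    using that
  proof (induction n arbitrary: x y)
    case (Suc n)
    have 1: "sq (x \<^bold>* y) = sq x \<^bold>* sq y" and 2: "sq x \<^bold>* sq y = sq y \<^bold>* sq x"
      unfolding sq_def using Suc.prems by (metis assoc)+
    show ?case using Suc.IH[OF 2] by (simp add: funpow_Suc_right 1 del: funpow.simps)
  qed simp
  show thesis
  proof
    fix t :: real assume "\<bar>t\<bar> < b"
    then show "\<Gamma> t = \<gamma> t" using \<Gamma>[of t 0] by (simp add: F_def)
  next
    fix s t :: real
    obtain n where n: "\<bar>s\<bar> + \<bar>t\<bar> < 2 ^ n * b" using bound_ex[of "\<bar>s\<bar> + \<bar>t\<bar>"] by auto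
    have "\<bar>s\<bar> < 2 ^ n * b" "\<bar>t\<bar> < 2 ^ n * b" "\<bar>s + t\<bar> < 2 ^ n * b" using n by linarith+
    note eq = this[THEN \<Gamma>]
    have st: "\<bar>s / 2 ^ n\<bar> < b" "\<bar>t / 2 ^ n\<bar> < b"
      using n by (auto simp: abs_divide field_simps)
    have split: "\<gamma> ((s + t) / 2 ^ n) = \<gamma> (s / 2 ^ n) \<^bold>* \<gamma> (t / 2 ^ n)"
      using hom[OF st] by (simp add: add_divide_distrib)
    have comm: "\<gamma> (s / 2 ^ n) \<^bold>* \<gamma> (t / 2 ^ n) = \<gamma> (t / 2 ^ n) \<^bold>* \<gamma> (s / 2 ^ n)"
      using hom[OF st] hom[OF st(2,1)] by (simp add: add.commute)
    show "\<Gamma> (s + t) = \<Gamma> s \<^bold>* \<Gamma> t"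
      unfolding eq F_def split by (rule sq_mult[OF comm])
  qed
qed

section \<open>Integral curves on the group\<close>

context lie_group begin

text \<open>The set of times is a parameter because the solution near the unit exists on a short
  interval before it is extended to the line.\<close>

definition curve_on :: "real set \<Rightarrow> ('a, 'e) vfield \<Rightarrow> (real \<Rightarrow> 'a) \<Rightarrow> bool" where
  "curve_on I V \<gamma> \<longleftrightarrow> (\<forall>t\<in>I. \<forall>c\<in>charts_at A (\<gamma> t). chart_deriv c \<gamma> t (\<lambda>h. h *\<^sub>R V (\<gamma> t) c))"

lemma curve_onD: "\<lbrakk>curve_on I V \<gamma>; t \<in> I; c \<in> charts_at A (\<gamma> t)\<rbrakk> \<Longrightarrow> chart_deriv c \<gamma> t
  (\<lambda>h. h *\<^sub>R V (\<gamma> t) c)"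
  by (simp add: curve_on_def)

lemma curve_on_subset: "\<lbrakk>curve_on J V \<gamma>; I \<subseteq> J\<rbrakk> \<Longrightarrow> curve_on I V \<gamma>"
  by (auto simp: curve_on_def)

lemma curve_on_isCont: "\<lbrakk>curve_on I V \<gamma>; t \<in> I\<rbrakk> \<Longrightarrow> isCont \<gamma> t"
  by (metis chart_deriv_def chart_exists curve_onD)

lemma integral_curve_iff: "integral_curve A V \<gamma> \<longleftrightarrow> curve_on UNIV V \<gamma>"
proof
  assume *: "curve_on UNIV V \<gamma>"
  then have "continuous_on UNIV \<gamma>"
    by (simp add: continuous_at_imp_continuous_on curve_on_isCont)
  with * show "integral_curve A V \<gamma>"
    by (auto simp: integral_curve_def curve_on_def chart_deriv_def has_vector_derivative_def)
next
  assume "integral_curve A V \<gamma>"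
  then show "curve_on UNIV V \<gamma>"
    by (auto simp: integral_curve_def curve_on_def chart_deriv_def has_vector_derivative_def
        charts_at_def continuous_on_eq_continuous_at)
qed

lemma chart_deriv_tangent_change:
  assumes "V p \<in> tangent_space A p" "f t = p" "c \<in> charts_at A p" "d \<in> charts_at A p"
    "chart_deriv c f t (\<lambda>h. h *\<^sub>R V p c)"
  shows "chart_deriv d f t (\<lambda>h. h *\<^sub>R V p d)"
proof -
  note cd = charts_atD[OF assms(3)] charts_atD[OF assms(4)]
  have "chart_deriv d f t (\<lambda>h. dright c d p one (h *\<^sub>R V p c))"
    using chart_deriv_change[OF assms(5) cd(1,3)] cd assms(2) by simp
  moreover have "bounded_linear (dright c d p one)" using bounded_linear_dright[of c d p one] cd
    by simp
  ultimately show ?thesis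
    using tangent_space_change[OF assms(1,3,4)] by (simp add: linear_cmul[OF bounded_linear.linear])
qed

text \<open>Velocities of curves and components of tangent vectors both change by
  \<open>dright c d p one\<close>, so one chart at each time suffices.\<close>

lemma curve_onI:
  assumes "\<And>p. V p \<in> tangent_space A p"
    "\<And>t. t \<in> I \<Longrightarrow> \<exists>c\<in>charts_at A (\<gamma> t). chart_deriv c \<gamma> t (\<lambda>h. h *\<^sub>R V (\<gamma> t) c)"
  shows "curve_on I V \<gamma>"
  unfolding curve_on_def using assms chart_deriv_tangent_change by blast

text \<open>The times of agreement form an open set by local uniqueness in a chart, the others by
  the Hausdorff property; a connected set admits no such splitting.\<close>

lemma curve_on_unique:
  assumes V: "\<And>c. c \<in> A \<Longrightarrow> smooth_on (snd c ` fst c) (\<lambda>x. V (chart_inv c x) c)"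
    and I: "open I" "connected I"
    and \<gamma>: "curve_on I V \<gamma>" and \<delta>: "curve_on I V \<delta>"
    and t0: "t0 \<in> I" "\<gamma> t0 = \<delta> t0" and t: "t \<in> I"
  shows "\<gamma> t = \<delta> t"
proof -
  let ?U = "{t \<in> I. \<gamma> t = \<delta> t}" and ?W = "{t \<in> I. \<gamma> t \<noteq> \<delta> t}"
  have "open ?U"
  proof (subst open_subopen, safe)
    fix s assume s: "s \<in> I" "\<gamma> s = \<delta> s"
    obtain c where c: "c \<in> charts_at A (\<gamma> s)" by (rule chart_exists)
    note c' = charts_atD[OF c]
    obtain r K where rK: "r > 0" "K \<ge> 0" "cball (snd c (\<gamma> s)) r \<subseteq> snd c ` fst c"
      "\<And>x y. \<lbrakk>x \<in> cball (snd c (\<gamma> s)) r; y \<in> cball (snd c (\<gamma> s)) r\<rbrakk>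
         \<Longrightarrow> norm (V (chart_inv c x) c - V (chart_inv c y) c) \<le> K * norm (x - y)"
      using smooth_on_locally_lipschitz[OF chart_image_open[OF c'(1)] imageI[OF c'(2)] V[OF
        c'(1)]] by blast
    have near: "eventually (\<lambda>u. u \<in> I \<and> f u \<in> fst c \<and> snd c (f u) \<in> cball (snd c (\<gamma> s)) r) (nhds s)"
      if "curve_on I V f" "f s = \<gamma> s" for f
    proof -
      have f: "isCont f s" using curve_on_isCont[OF that(1) s(1)] .
      have "eventually (\<lambda>u. u \<in> I) (nhds s)" using I(1) s(1) by (rule eventually_nhds_in_open)
      moreover have "(f \<longlongrightarrow> f s) (nhds s)" using f by (simp add: isCont_def
        tendsto_at_iff_tendsto_nhds)
      then have "eventually (\<lambda>u. f u \<in> fst c) (nhds s)"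
        by (rule topological_tendstoD) (use chart_open c' that in auto)
      moreover have "isCont (\<lambda>u. snd c (f u)) s"
        by (rule isCont_o2[OF f]) (use isCont_chart c' that in simp)
      then have "((\<lambda>u. snd c (f u)) \<longlongrightarrow> snd c (f s)) (nhds s)"
        using tendsto_at_iff_tendsto_nhds[of "\<lambda>u. snd c (f u)" s] by (simp add: isCont_def)
      then have "eventually (\<lambda>u. snd c (f u) \<in> ball (snd c (\<gamma> s)) r) (nhds s)"
        by (rule topological_tendstoD) (use rK that in auto)
      ultimately show ?thesis by eventually_elim auto
    qed
    have "eventually (\<lambda>u. u \<in> I \<and> (\<gamma> u \<in> fst c \<and> snd c (\<gamma> u) \<in> cball (snd c (\<gamma> s)) r) \<and>
        (\<delta> u \<in> fst c \<and> snd c (\<delta> u) \<in> cball (snd c (\<gamma> s)) r)) (nhds s)"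
      using near[OF \<gamma> refl] near[OF \<delta> s(2)[symmetric]] by eventually_elim blast
    then obtain d where d: "d > 0"
      "\<And>u. \<bar>u - s\<bar> < d \<Longrightarrow> u \<in> I \<and> (\<gamma> u \<in> fst c \<and> snd c (\<gamma> u) \<in> cball (snd c (\<gamma> s)) r) \<and>
        (\<delta> u \<in> fst c \<and> snd c (\<delta> u) \<in> cball (snd c (\<gamma> s)) r)"
      unfolding eventually_nhds_metric dist_real_def by blast
    have der: "((\<lambda>u. snd c (f u)) has_vector_derivative V (chart_inv c (snd c (f u))) c) (at u)"
      if "curve_on I V f" "u \<in> I" "f u \<in> fst c" for f u
      using curve_onD[OF that(1,2), of c] that(3) c'
      by (simp add: charts_at_def chart_deriv_def has_vector_derivative_def)
    have d\<gamma>: "snd c (\<gamma> u) \<in> cball (snd c (\<gamma> s)) r \<and>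
        ((\<lambda>u. snd c (\<gamma> u)) has_vector_derivative V (chart_inv c (snd c (\<gamma> u))) c) (at u)" if
          "\<bar>u - s\<bar> < d" for u
      using d(2)[OF that] der[OF \<gamma>] by blast
    have d\<delta>: "snd c (\<delta> u) \<in> cball (snd c (\<gamma> s)) r \<and>
        ((\<lambda>u. snd c (\<delta> u)) has_vector_derivative V (chart_inv c (snd c (\<delta> u))) c) (at u)" if
          "\<bar>u - s\<bar> < d" for u
      using d(2)[OF that] der[OF \<delta>] by blast
    obtain e where e: "e > 0" "\<And>u. \<bar>u - s\<bar> < e \<Longrightarrow> snd c (\<gamma> u) = snd c (\<delta> u)"
      by (rule ode_unique_local[OF rK(4) d(1) rK(2) d\<gamma> d\<delta>]) (use s(2) in auto)
    have "ball s (min e d) \<subseteq> ?U"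
    proof safe
      fix u assume u: "u \<in> ball s (min e d)"
      then have "\<bar>u - s\<bar> < e" "\<bar>u - s\<bar> < d" by (auto simp: dist_real_def)
      with e(2) d(2) have "snd c (\<gamma> u) = snd c (\<delta> u)" "\<gamma> u \<in> fst c" "\<delta> u \<in> fst c" "u \<in> I" by auto
      then show "u \<in> I" "\<gamma> u = \<delta> u" using chart_inv_left[OF c'(1)] by metis+
    qed
    then show "\<exists>T. open T \<and> s \<in> T \<and> T \<subseteq> ?U"
      using e(1) d(1) by (intro exI[of _ "ball s (min e d)"]) auto
  qed
  moreover have "open ?W"
  proof -
    have "continuous_on I (\<lambda>t. (\<gamma> t, \<delta> t))"
      by (intro continuous_on_Pair continuous_at_imp_continuous_on ballI curve_on_isCont[OF \<gamma>]
        curve_on_isCont[OF \<delta>])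
    then have "open (I \<inter> (\<lambda>t. (\<gamma> t, \<delta> t)) -` {(x, y) |x y. x \<noteq> y})"
      using I(1) open_diagonal_complement by (rule continuous_open_preimage)
    also have "I \<inter> (\<lambda>t. (\<gamma> t, \<delta> t)) -` {(x, y) |x y. x \<noteq> y} = ?W" by auto
    finally show ?thesis .
  qed
  ultimately have "?U \<inter> I = {} \<or> ?W \<inter> I = {}"
    by (intro connectedD[OF I(2)]) auto
  with t0 t show ?thesis by auto
qed

lemma curve_on_mul_right:
  assumes "curve_on I (rfield v) \<gamma>"
  shows "curve_on I (rfield v) (\<lambda>t. mul (\<gamma> t) g)"
proof (rule curve_onI[OF rfield_tangent])
  fix t assume t: "t \<in> I"
  obtain c d where c: "c \<in> charts_at A (\<gamma> t)" and d: "d \<in> charts_at A (mul (\<gamma> t) g)"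
    using chart_exists by metis
  note cd = charts_atD[OF c] charts_atD[OF d]
  have "chart_deriv d (\<lambda>t. mul (\<gamma> t) g) t (\<lambda>h. dright c d (\<gamma> t) g (h *\<^sub>R rfield v (\<gamma> t) c))"
    using chart_deriv_dright[OF curve_onD[OF assms t c]] cd by blast
  moreover have "linear (dright c d (\<gamma> t) g)" using bounded_linear_dright[of c d "\<gamma> t" g] cd by
    (blast intro: bounded_linear.linear)
  ultimately show "\<exists>c\<in>charts_at A (mul (\<gamma> t) g). chart_deriv c (\<lambda>t. mul (\<gamma> t) g) t
    (\<lambda>h. h *\<^sub>R rfield v (mul (\<gamma> t) g) c)"
    using rfield_mul[OF c d] by (intro bexI[OF _ d]) (simp add: linear_cmul)
qed

lemma chart_deriv_shift:
  assumes "chart_deriv c \<gamma> (t + s) L"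
  shows "chart_deriv c (\<lambda>t. \<gamma> (t + s)) t L"
proof -
  have "((\<lambda>t. t + s) has_derivative (\<lambda>h. h)) (at t)" by (auto intro!: derivative_eq_intros)
  from chart_deriv_compose[of c \<gamma> "\<lambda>t. t + s", OF assms this] show ?thesis .
qed

lemma curve_on_shift:
  assumes "curve_on I V \<gamma>"
  shows "curve_on {t. t + s \<in> I} V (\<lambda>t. \<gamma> (t + s))"
  using assms by (auto simp: curve_on_def intro: chart_deriv_shift)

lemma curve_on_scale:
  assumes "curve_on UNIV V \<gamma>"
  shows "curve_on UNIV (r *\<^sub>R V) (\<lambda>t. \<gamma> (r * t))"
  unfolding curve_on_def
proof safe
  fix t c1 c2 assume c: "(c1, c2) \<in> charts_at A (\<gamma> (r * t))"
  have "((\<lambda>t. r * t) has_derivative (\<lambda>h. r * h)) (at t)" by (auto intro!: derivative_eq_intros)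
  from chart_deriv_compose[OF curve_onD[OF assms UNIV_I c] this]
  show "chart_deriv (c1, c2) (\<lambda>t. \<gamma> (r * t)) t (\<lambda>h. h *\<^sub>R (r *\<^sub>R V) (\<gamma> (r * t)) (c1, c2))"
    by (simp add: scaleR_fun_def mult.commute)
qed

text \<open>For fixed \<open>t\<close>, the shift of \<gamma> by \<open>t\<close> and its right
  translate by \<open>\<gamma> t\<close> are integral curves with the same start, so \<gamma> is a
  local homomorphism. Its extension \<Gamma> is near each time a right translate of a shift of
  \<gamma>, and these operations preserve integral curves.\<close>

lemma one_parameter_subgroup:
  obtains \<Gamma> where "\<And>s t. \<Gamma> (s + t) = mul (\<Gamma> s) (\<Gamma> t)" "curve_on UNIV (rfield v) \<Gamma>"
proof -
  let ?e = "snd base one" and ?V = "\<lambda>x. rfield v (chart_inv base x) base"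
  obtain r K where rK: "r > 0" "K \<ge> 0" "cball ?e r \<subseteq> snd base ` fst base"
    "\<And>x y. \<lbrakk>x \<in> cball ?e r; y \<in> cball ?e r\<rbrakk> \<Longrightarrow> norm (?V x - ?V y) \<le> K * norm (x - y)"
    by (rule smooth_on_locally_lipschitz[OF chart_image_open imageI smooth_rfield]) auto
  obtain a y where a: "a > 0" and y0: "y 0 = ?e"
    and y: "\<And>t. \<bar>t\<bar> < a \<Longrightarrow> y t \<in> cball ?e r \<and> (y has_vector_derivative ?V (y t)) (at t)"
    using ode_exists_local[of r K ?e ?V, OF rK(1,2,4)] by metis
  define \<gamma> where "\<gamma> t = chart_inv base (y t)" for t
  have \<gamma>0: "\<gamma> 0 = one" by (simp add: \<gamma>_def y0)
  let ?I = "{-a<..<a}"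
  have \<gamma>: "curve_on ?I (rfield v) \<gamma>"
  proof (rule curve_onI[OF rfield_tangent], rule bexI)
    fix t assume "t \<in> ?I"
    then have t: "\<bar>t\<bar> < a" by auto
    then have yt: "y t \<in> snd base ` fst base" using y rK by blast
    show "base \<in> charts_at A (\<gamma> t)"
      using chart_inv_in[OF base_in(1) yt] by (simp add: \<gamma>_def charts_at_def)
    show "chart_deriv base \<gamma> t (\<lambda>h. h *\<^sub>R rfield v (\<gamma> t) base)"
      unfolding \<gamma>_def
      by (rule chart_deriv_compose[where u=y and L="\<lambda>h. h",
        OF chart_deriv_chart_inv[OF base_in(1) yt]])
        (use y[OF t] in \<open>simp add: has_vector_derivative_def\<close>)
  qed
  \<comment> \<open>Two arguments below \<open>a / 2\<close> have their sum in the domain of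
    \<gamma>.\<close>
  define b where "b = a / 2"
  have b: "b > 0" using a by (simp add: b_def)
  have hom: "\<gamma> (s + t) = mul (\<gamma> s) (\<gamma> t)" if "\<bar>s\<bar> < b" "\<bar>t\<bar> < b" for s t
  proof (rule curve_on_unique[where I="{-b<..<b}" and ?t0.0=0 and t=s
        and \<gamma>="\<lambda>s. \<gamma> (s + t)" and \<delta>="\<lambda>s. mul (\<gamma> s) (\<gamma> t)", OF smooth_rfield])
    show "curve_on {-b<..<b} (rfield v) (\<lambda>s. \<gamma> (s + t))"
      by (rule curve_on_subset[OF curve_on_shift[OF \<gamma>]]) (use that in \<open>auto simp: b_def\<close>)
    show "curve_on {-b<..<b} (rfield v) (\<lambda>s. mul (\<gamma> s) (\<gamma> t))"
      by (rule curve_on_subset[OF curve_on_mul_right[OF \<gamma>]]) (use b in \<open>auto simp: b_def\<close>)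
  qed (use that b \<gamma>0 in auto)
  obtain \<Gamma> where \<Gamma>: "\<And>s t. \<Gamma> (s + t) = mul (\<Gamma> s) (\<Gamma> t)" "\<And>t. \<bar>t\<bar> < b \<Longrightarrow> \<Gamma> t = \<gamma> t"
    using extend_local_hom[of b \<gamma>, OF b hom] by metis
  have "curve_on UNIV (rfield v) \<Gamma>"
  proof (rule curve_onI[OF rfield_tangent])
    fix t
    have "curve_on {s. s + - t \<in> ?I} (rfield v) (\<lambda>s. mul (\<gamma> (s + - t)) (\<Gamma> t))"
      by (rule curve_on_mul_right[OF curve_on_shift[OF \<gamma>]])
    moreover have eq: "mul (\<gamma> (s + - t)) (\<Gamma> t) = \<Gamma> s" if "s \<in> ball t b" for s
      using that \<Gamma>(2)[of "s - t"] \<Gamma>(1)[of "s - t" t] by (auto simp: dist_real_def abs_minus_commute)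
    moreover obtain c where c: "c \<in> charts_at A (\<Gamma> t)" by (rule chart_exists)
    moreover have "t \<in> ball t b" using b by simp
    note eq[OF this]
    ultimately have "chart_deriv c (\<lambda>s. mul (\<gamma> (s + - t)) (\<Gamma> t)) t (\<lambda>h. h *\<^sub>R rfield v (\<Gamma> t) c)"
      using curve_onD[of _ "rfield v" "\<lambda>s. mul (\<gamma> (s + - t)) (\<Gamma> t)" t c] a by simp
    then have "chart_deriv c \<Gamma> t (\<lambda>h. h *\<^sub>R rfield v (\<Gamma> t) c)"
      by (rule chart_deriv_cong[of _ _ _ _ "ball t b"]) (use b eq in auto)
    with c show "\<exists>c\<in>charts_at A (\<Gamma> t). chart_deriv c \<Gamma> t (\<lambda>h. h *\<^sub>R rfield v (\<Gamma> t) c)" by blast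
  qed
  with \<Gamma>(1) show thesis by (rule that)
qed

lemma hom_zero:
  assumes "\<And>s t :: real. \<Gamma> (s + t) = mul (\<Gamma> s) (\<Gamma> t)"
  shows "\<Gamma> 0 = one"
  using assms[of 0 0] left_cancel[of "\<Gamma> 0" "\<Gamma> 0" one] by simp

lemma lie_exp_rfield:
  assumes hom: "\<And>s t. \<Gamma> (s + t) = mul (\<Gamma> s) (\<Gamma> t)" and \<Gamma>: "curve_on UNIV (rfield v) \<Gamma>"
  shows "lie_exp A one (t *\<^sub>R rfield v) = \<Gamma> t"
  unfolding lie_exp_def integral_curve_iff
proof (rule the_equality)
  have \<Gamma>t: "curve_on UNIV (t *\<^sub>R rfield v) (\<lambda>s. \<Gamma> (t * s))" by (rule curve_on_scale[OF \<Gamma>])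
  moreover have \<Gamma>0: "\<Gamma> 0 = one" using hom by (rule hom_zero)
  ultimately show "\<exists>\<gamma>. curve_on UNIV (t *\<^sub>R rfield v) \<gamma> \<and> \<gamma> 0 = one \<and> \<gamma> 1 = \<Gamma> t"
    by (intro exI[of _ "\<lambda>s. \<Gamma> (t * s)"]) simp
  fix g assume "\<exists>\<gamma>. curve_on UNIV (t *\<^sub>R rfield v) \<gamma> \<and> \<gamma> 0 = one \<and> \<gamma> 1 = g"
  then obtain \<gamma> where \<gamma>: "curve_on UNIV (rfield (t *\<^sub>R v)) \<gamma>" "\<gamma> 0 = one" "\<gamma> 1 = g"
    by (auto simp: rfield_scaleR)
  have "\<gamma> 1 = \<Gamma> (t * 1)"
    by (rule curve_on_unique[where ?t0.0=0 and t=1 and \<delta>="\<lambda>s. \<Gamma> (t * s)",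
      OF smooth_rfield _ _ \<gamma>(1)]) (use \<Gamma>t \<gamma> \<Gamma>0 in \<open>auto simp: rfield_scaleR\<close>)
  then show "g = \<Gamma> t" using \<gamma> by simp
qed

end

section \<open>One-parameter subgroups with pointwise periodic conjugation\<close>

text \<open>Otherwise Dirichlet approximation of \<open>s / r\<close> yields arbitrarily small
  positive elements of \<open>P\<close> of the form \<open>\<bar>k s - h r\<bar>\<close>; their
  multiples are dense, and a closed \<open>P\<close> would be the whole line.\<close>

lemma closed_real_subgroup_commensurable:
  fixes P :: "real set"
  assumes P: "closed P" "P \<noteq> UNIV" "\<And>x y. \<lbrakk>x \<in> P; y \<in> P\<rbrakk> \<Longrightarrow> x - y \<in> P"
    and sr: "s \<in> P" "r \<in> P" "s > 0" "r > 0"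
  obtains a b :: nat where "a > 0" "b > 0" "of_nat a * s = of_nat b * r"
proof (rule ccontr)
  assume not: "\<not> thesis"
  note witness = that
  have zero: "0 \<in> P" using P(3)[OF sr(1,1)] by simp
  have minus: "- x \<in> P" if "x \<in> P" for x using P(3)[OF zero that] by simp
  have add: "x + y \<in> P" if "x \<in> P" "y \<in> P" for x y using P(3)[OF that(1) minus[OF that(2)]] by simp
  have nat_mult: "of_nat n * x \<in> P" if "x \<in> P" for n :: nat and x
    by (induction n) (auto simp: zero add that distrib_right)
  have int_mult: "of_int n * x \<in> P" if "x \<in> P" for n :: int and x
    using nat_mult[OF that] minus by (cases n rule: int_cases2) fastforce+
  have small: "\<exists>e\<in>P. 0 < e \<and> e < d" if d: "d > 0" for d
  proof -
    obtain N :: nat where N: "N > 0" "r / N < d"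
    proof -
      obtain N :: nat where "r / d < N" using reals_Archimedean2 by blast
      moreover from this have "N > 0" using sr d by (cases N) (auto simp: field_simps)
      ultimately show thesis using d that by (simp add: field_simps)
    qed
    obtain h k where hk: "0 < k" "\<bar>of_int k * (s / r) - of_int h\<bar> < 1 / real N"
      using Dirichlet_approx[OF N(1), of "s / r"] by metis
    let ?e = "of_int k * s - of_int h * r"
    have e: "?e \<in> P" using int_mult sr P(3) by blast
    have eq: "?e = r * (of_int k * (s / r) - of_int h)" using sr by (simp add: field_simps)
    have "\<bar>?e\<bar> = r * \<bar>of_int k * (s / r) - of_int h\<bar>" unfolding eq using sr by (simp add: abs_mult)
    also have "\<dots> < r * (1 / real N)" using hk(2) sr by (intro mult_strict_left_mono) auto
    finally have less: "\<bar>?e\<bar> < d" using N by simp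
    \<comment> \<open>A vanishing combination would itself be the commensurability sought.\<close>
    have "?e \<noteq> 0"
    proof
      assume "?e = 0"
      then have *: "of_int k * s = of_int h * r" by simp
      then have "of_int h > (0::real)" using hk(1) sr by
        (metis mult_pos_pos of_int_0_less_iff zero_less_mult_pos2)
      then have "h > 0" by simp
      then show False using not witness[of "nat k" "nat h"] * hk(1) by simp
    qed
    then show ?thesis
      using e minus[OF e] less by (intro bexI[of _ "\<bar>?e\<bar>"]) (auto simp: abs_if)
  qed
  have "x \<in> closure P" for x
    unfolding closure_approachable
  proof safe
    fix d :: real assume "d > 0"
    then obtain e where e: "e \<in> P" "0 < e" "e < d" using small by blast
    have "of_int \<lfloor>x / e\<rfloor> * e \<in> P" by (rule int_mult[OF e(1)])
    moreover have "of_int \<lfloor>x / e\<rfloor> * e \<le> x" "x < (of_int \<lfloor>x / e\<rfloor> + 1) * e"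
      using floor_divide_lower[OF e(2)] floor_divide_upper[OF e(2)] by blast+
    then have "dist (of_int \<lfloor>x / e\<rfloor> * e) x < d" using e(3) by
      (simp add: dist_real_def distrib_right)
    ultimately show "\<exists>y\<in>P. dist y x < d" by blast
  qed
  then have "P = UNIV" using P(1) by auto
  with P(2) show False by blast
qed

lemma tube_lemma_point:
  fixes W :: "('a::topological_space \<times> 'b::topological_space) set"
  assumes "open W" "compact (UNIV :: 'b set)" "\<And>y. (x, y) \<in> W"
  shows "\<exists>U. open U \<and> x \<in> U \<and> U \<times> UNIV \<subseteq> W"
proof -
  have "openin (prod_topology euclidean euclidean) W"
    using assms(1) unfolding openin_prod_topology_alt open_prod_def by fastforce
  from tube_lemma_right[OF this, of UNIV x] assms show ?thesis
    by (auto simp: subset_iff)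
qed

context lie_group begin

text \<open>Squaring has derivative 2 at the unit, so in a chart it increases the distance of a
  nearby point from the unit by a factor of at least \<open>3/2\<close>. Iterated squares of a
  nontrivial element must leave the neighbourhood.\<close>

lemma no_small_subgroups:
  obtains U where "open U" "one \<in> U" "\<And>z. (\<And>n. ((\<lambda>x. mul x x) ^^ n) z \<in> U) \<Longrightarrow> z = one"
proof -
  let ?e = "snd base one" and ?sq = "\<lambda>x. mul x x"
  let ?f = "\<lambda>y. snd base (?sq (chart_inv base y))"
  have ci: "chart_deriv base (chart_inv base) ?e (\<lambda>h. h)" by (rule chart_deriv_chart_inv_at) auto
  have "(?f has_derivative (\<lambda>h. h + h)) (at ?e)"
    using chart_deriv_mul[OF ci ci, of base] by (simp add: chart_deriv_def)
  \<comment> \<open>A remainder of at most half the distance leaves the factor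
    \<open>2 - 1/2\<close> for growth.\<close>
  then obtain d where d: "d > 0"
    "\<And>y. norm (y - ?e) < d \<Longrightarrow> norm (?f y - ?f ?e - (y - ?e + (y - ?e))) \<le> 1/2 * norm (y - ?e)"
    unfolding has_derivative_at_alt by (meson half_gt_zero_iff zero_less_one)
  let ?N = "\<lambda>x. norm (snd base x - ?e)"
  define U where "U = {x \<in> fst base. ?N x < d}"
  have "continuous_on (fst base) (snd base)"
    using chart_homeomorphism[OF base_in(1)] by (simp add: homeomorphism_def)
  then have "open (fst base \<inter> snd base -` ball ?e d)"
    by (rule continuous_open_preimage) (auto intro: chart_open)
  also have "fst base \<inter> snd base -` ball ?e d = U"
    by (auto simp: U_def dist_norm norm_minus_commute)
  finally have "open U" .
  moreover have "one \<in> U" using d by (simp add: U_def)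
  moreover have "z = one" if z: "\<And>n. (?sq ^^ n) z \<in> U" for z
  proof -
    have step: "3/2 * ?N x \<le> ?N (?sq x)" if "x \<in> U" for x
    proof -
      let ?y = "snd base x"
      have "norm (?f ?y - ?f ?e - (?y - ?e + (?y - ?e))) \<le> 1/2 * norm (?y - ?e)"
        using that by (intro d) (simp add: U_def)
      then have "norm (snd base (?sq x) - ?e - (?y - ?e + (?y - ?e))) \<le> 1/2 * ?N x"
        using that by (simp add: U_def)
      moreover have "norm (?y - ?e + (?y - ?e)) = 2 * ?N x"
        by (metis norm_scaleR real_norm_def scaleR_2 abs_numeral)
      ultimately show ?thesis
        using norm_triangle_ineq2[of "?y - ?e + (?y - ?e)" "snd base (?sq x) - ?e"]
        by (simp add: norm_minus_commute)
    qed
    have grow: "(3/2) ^ n * ?N z \<le> ?N ((?sq ^^ n) z)" for n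
    proof (induction n)
      case (Suc n)
      have "(3/2) ^ Suc n * ?N z \<le> 3/2 * ?N ((?sq ^^ n) z)" using Suc by simp
      also have "\<dots> \<le> ?N ((?sq ^^ Suc n) z)" using step[OF z] by simp
      finally show ?case .
    qed simp
    have "?N z = 0"
    proof (rule ccontr)
      assume "?N z \<noteq> 0"
      then have pos: "?N z > 0" by simp
      obtain n where "d / ?N z < (3/2) ^ n" using real_arch_pow[of "3/2" "d / ?N z"] by auto
      then have "d < (3/2) ^ n * ?N z" using pos by (simp add: field_simps)
      with grow[of n] have "d < ?N ((?sq ^^ n) z)" by linarith
      with z[of n] show False by (simp add: U_def)
    qed
    moreover have "z \<in> fst base" using z[of 0] by (simp add: U_def)
    ultimately show "z = one" using chart_inv_left[of base] by
      (metis base_in eq_iff_diff_eq_0 norm_eq_zero)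
  qed
  ultimately show thesis by (rule that)
qed

text \<open>Translates of a neighbourhood of an interior point make \<open>H\<close> open; its
  complement is a union of cosets, hence open as well.\<close>

lemma subgroup_eq_UNIV:
  assumes conn: "connected (UNIV :: 'a set)"
    and H: "\<And>x y. \<lbrakk>x \<in> H; y \<in> H\<rbrakk> \<Longrightarrow> mul (inver x) y \<in> H" and int: "interior H \<noteq> {}"
  shows "H = UNIV"
proof -
  obtain u where u: "u \<in> interior H" using int by blast
  then have uH: "u \<in> H" using interior_subset by blast
  have one: "one \<in> H" using H[OF uH uH] by simp
  have inv: "inver x \<in> H" if "x \<in> H" for x using H[OF that one] by simp
  have mul: "mul x y \<in> H" if "x \<in> H" "y \<in> H" for x y using H[OF inv[OF that(1)] that(2)] by simp
  have translate: "open ((\<lambda>y. mul x y) -` W)" if "open W" for x W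
    by (intro open_vimage[OF that] continuous_intros)
  have "open H"
  proof (subst open_subopen, safe)
    fix x assume x: "x \<in> H"
    let ?T = "(\<lambda>y. mul (mul u (inver x)) y) -` interior H"
    have "y \<in> H" if "y \<in> ?T" for y
    proof -
      have "mul (mul u (inver x)) y \<in> H" using that interior_subset by blast
      from mul[OF mul[OF x inv[OF uH]] this] show ?thesis
        by (simp add: assoc) (metis assoc left_inverse left_neutral right_inverse)
    qed
    moreover have "x \<in> ?T" using u by (simp add: assoc)
    moreover have "open ?T" by (intro translate open_interior)
    ultimately show "\<exists>T. open T \<and> x \<in> T \<and> T \<subseteq> H" by blast
  qed
  moreover have "open (- H)"
  proof (subst open_subopen, safe)
    fix x assume x: "x \<notin> H"
    let ?T = "(\<lambda>y. mul (inver x) y) -` H"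
    have "y \<notin> H" if "y \<in> ?T" for y
    proof
      assume y: "y \<in> H"
      have "mul y (inver (mul (inver x) y)) \<in> H" using mul[OF y inv] that by simp
      moreover have "mul y (inver (mul (inver x) y)) = x"
        by (metis assoc inverse_inverse inverse_distrib_swap left_inverse right_inverse
          right_neutral left_neutral)
      ultimately show False using x by simp
    qed
    moreover have "x \<in> ?T" using one by simp
    moreover have "open ?T" by (intro translate \<open>open H\<close>)
    ultimately show "\<exists>T. open T \<and> x \<in> T \<and> T \<subseteq> - H" by blast
  qed
  then have "closed H" by (simp add: closed_def)
  ultimately show ?thesis using conn one connected_clopen[of "UNIV :: 'a set"] by auto
qed

text \<open>Two elements close to the identity have a common period: if \<open>q\<close> is a period of \<open>v w\<close>, then
  \<open>z = v\<^sup>-\<^sup>1 \<phi>\<^sub>q(v) = w \<phi>\<^sub>q(w)\<^sup>-\<^sup>1\<close> shares all periods of \<open>v\<close> and of \<open>w\<close>. Either \<open>z\<close> is not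
  fixed, and then the periods of \<open>v\<close> and \<open>w\<close> are commensurable, or it is fixed, and then its
  powers are \<open>v\<^sup>-\<^sup>1 \<phi>\<^sub>n\<^sub>q(v)\<close>, which stay close to the identity, so that \<open>z\<close> is trivial.\<close> 

lemma pointwise_periodic_imp_central:
  assumes conn: "connected (UNIV :: 'a set)" and comp: "compact (UNIV :: 'a set)"
    and hom: "\<And>s t :: real. \<Gamma> (s + t) = mul (\<Gamma> s) (\<Gamma> t)" and cont: "continuous_on UNIV \<Gamma>"
    and per: "\<And>g. \<exists>s>0. mul (\<Gamma> s) g = mul g (\<Gamma> s)"
  obtains q where "q > 0" "\<And>g. mul (\<Gamma> q) g = mul g (\<Gamma> q)"
proof -
  have \<Gamma>0: "\<Gamma> 0 = one" using hom by (rule hom_zero)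
  have \<Gamma>m: "\<Gamma> (- t) = inver (\<Gamma> t)" for t
    using hom[of t "- t"] by (simp add: \<Gamma>0 inverse_unique)
  define \<phi> where "\<phi> t x = mul (mul (\<Gamma> t) x) (inver (\<Gamma> t))" for t x
  have fixed_iff: "\<phi> t x = x \<longleftrightarrow> mul (\<Gamma> t) x = mul x (\<Gamma> t)" for t x
    unfolding \<phi>_def by (metis assoc left_inverse right_inverse right_neutral)
  have \<phi>_mul: "\<phi> t (mul x y) = mul (\<phi> t x) (\<phi> t y)" for t x y
  proof -
    have "mul (mul (\<Gamma> t) x) (mul (inver (\<Gamma> t)) (mul (\<Gamma> t) (mul y (inver (\<Gamma> t))))) = mul (mul
      (\<Gamma> t) x) (mul y (inver (\<Gamma> t)))"
      by (metis assoc left_inverse left_neutral)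
    then show ?thesis by (simp add: \<phi>_def assoc)
  qed
  have \<phi>_one: "\<phi> t one = one" for t by (simp add: \<phi>_def)
  have \<phi>_inver: "\<phi> t (inver x) = inver (\<phi> t x)" for t x
    using \<phi>_mul[of t x "inver x"] by (simp add: \<phi>_one inverse_unique)
  have \<phi>_add: "\<phi> (s + t) x = \<phi> s (\<phi> t x)" for s t x
    by (simp add: \<phi>_def hom inverse_distrib_swap assoc)
  define P where "P x = {t. \<phi> t x = x}" for x
  have P0: "0 \<in> P x" for x by (simp add: P_def \<phi>_def \<Gamma>0)
  have P_add: "s + t \<in> P x" if "s \<in> P x" "t \<in> P x" for s t x
    using that by (simp add: P_def \<phi>_add)
  have P_diff: "s - t \<in> P x" if "s \<in> P x" "t \<in> P x" for s t x
  proof -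
    have "\<phi> (s - t) (\<phi> t x) = \<phi> s x" by (simp flip: \<phi>_add)
    then show ?thesis using that by (simp add: P_def)
  qed
  have P_nat: "of_nat n * s \<in> P x" if "s \<in> P x" for n :: nat and s x
    by (induction n) (auto simp: P0 distrib_right intro: P_add that)
  have P_closed: "closed (P x)" for x
    unfolding P_def fixed_iff by (intro closed_Collect_eq continuous_intros cont)
  have P_pos: "\<exists>s>0. s \<in> P x" for x using per[of x] by (simp add: P_def fixed_iff)
  have P_mul: "t \<in> P (mul x y)" if "t \<in> P x" "t \<in> P y" for t x y
    using that by (simp add: P_def \<phi>_mul)
  have P_inver: "t \<in> P (inver x)" if "t \<in> P x" for t x
    using that by (simp add: P_def \<phi>_inver)
  have P_\<phi>: "t \<in> P (\<phi> s x)" if "t \<in> P x" for t s x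
    using that \<phi>_add[of t s x] \<phi>_add[of s t x] by (simp add: P_def add.commute)
  have comm: "\<exists>a b :: nat. a > 0 \<and> b > 0 \<and> of_nat a * s = of_nat b * r"
    if "s \<in> P x" "P x \<noteq> UNIV" "r \<in> P x" "s > 0" "r > 0" for s r x
    by (rule closed_real_subgroup_commensurable[OF P_closed that(2) P_diff that(1,3,4,5)]) auto
  let ?sq = "\<lambda>x. mul x x"
  obtain U where U: "open U" "one \<in> U" "\<And>z. (\<And>n. (?sq ^^ n) z \<in> U) \<Longrightarrow> z = one"
    by (rule no_small_subgroups) blast
  \<comment> \<open>At \<open>v = one\<close> the commutator is the unit for every \<open>g\<close>.
    Compactness gives one neighbourhood \<open>U0\<close> of the unit on which it stays in
    \<open>U\<close> for all \<open>g\<close> at once, hence for all times of the flow.\<close>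
  let ?W = "(\<lambda>(v, g). mul (inver v) (mul (mul g v) (inver g))) -` U"
  have "open ?W"
    by (rule open_vimage[OF U(1)]) (simp add: case_prod_unfold, intro continuous_intros)
  moreover have "(one, g) \<in> ?W" for g
  proof -
    have "inver one = one" by (rule inverse_unique) simp
    then show ?thesis using U(2) by simp
  qed
  ultimately have "\<exists>U0. open U0 \<and> one \<in> U0 \<and> U0 \<times> UNIV \<subseteq> ?W"
    by (intro tube_lemma_point comp)
  then obtain U0 where U0: "open U0" "one \<in> U0" "U0 \<times> UNIV \<subseteq> ?W"
    by blast
  have U0': "mul (inver v) (\<phi> t v) \<in> U" if "v \<in> U0" for v t
    using subsetD[OF U0(3), of "(v, \<Gamma> t)"] that by (simp add: \<phi>_def)
  have common: "\<exists>q>0. q \<in> P v \<and> q \<in> P w" if v: "v \<in> U0" and w: "w \<in> U0" for v w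
  proof -
    obtain q where q: "q > 0" "q \<in> P (mul v w)" using P_pos by blast
    obtain s where s: "s > 0" "s \<in> P v" using P_pos by blast
    obtain r where r: "r > 0" "r \<in> P w" using P_pos by blast
    define z where "z = mul (inver v) (\<phi> q v)"
    have \<phi>v: "\<phi> q v = mul v z" by (simp add: z_def flip: assoc)
    have "mul (mul v z) (\<phi> q w) = mul v w" using q(2) by (simp add: P_def \<phi>_mul \<phi>v)
    then have zw: "mul z (\<phi> q w) = w" by (simp add: assoc left_cancel)
    then have z2: "z = mul w (inver (\<phi> q w))"
      by (metis assoc right_inverse right_neutral)
    have sz: "s \<in> P z" unfolding z_def by (intro P_mul P_inver P_\<phi> s)
    have rz: "r \<in> P z" unfolding z2 by (intro P_mul P_inver P_\<phi> r)
    show ?thesis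
    proof (cases "P z = UNIV")
      case True
      have fixed: "\<phi> t ((?sq ^^ n) z) = (?sq ^^ n) z" for t n
        using True by (induction n) (auto simp: \<phi>_mul P_def)
      \<comment> \<open>Doubling the time squares the factor, because \<open>z\<close> and its
        powers are fixed by the flow.\<close>
      have "\<phi> (2 ^ n * q) v = mul v ((?sq ^^ n) z)" for n
      proof (induction n)
        case (Suc n)
        have "\<phi> (2 ^ Suc n * q) v = \<phi> (2 ^ n * q) (\<phi> (2 ^ n * q) v)"
          using \<phi>_add[of "2 ^ n * q" "2 ^ n * q" v] by (simp add: mult_ac)
        then show ?case by (simp add: Suc \<phi>_mul fixed assoc)
      qed (simp add: \<phi>v)
      then have "(?sq ^^ n) z = mul (inver v) (\<phi> (2 ^ n * q) v)" for n
        by (simp flip: assoc)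
      with U0'[OF v] have "(?sq ^^ n) z \<in> U" for n by metis
      then have "z = one" by (rule U(3))
      with \<phi>v zw have "q \<in> P v" "q \<in> P w" by (simp_all add: P_def)
      with q(1) show ?thesis by blast
    next
      case False
      then obtain a b :: nat where ab: "a > 0" "b > 0" "of_nat a * s = of_nat b * r"
        using comm[OF sz _ rz s(1) r(1)] by blast
      have "of_nat a * s \<in> P v" "of_nat a * s \<in> P w"
        using ab P_nat[OF s(2), of a] P_nat[OF r(2), of b] by simp_all
      moreover have "of_nat a * s > 0" using ab(1) s(1) by simp
      ultimately show ?thesis by blast
    qed
  qed
  \<comment> \<open>The centralizer of \<open>\<Gamma> t\<close>, a closed subgroup.\<close>
  define Z where "Z t = {x. t \<in> P x}" for t
  have Z_UNIV: "Z t = UNIV" if "interior (Z t) \<noteq> {}" for t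
    by (rule subgroup_eq_UNIV[OF conn _ that]) (auto simp: Z_def intro: P_mul P_inver)
  have finish: "\<exists>q>0. \<forall>g. mul (\<Gamma> q) g = mul g (\<Gamma> q)" if "interior (Z t) \<noteq> {}" "t > 0" for t
    using Z_UNIV[OF that(1)] that(2) by (auto simp: Z_def P_def fixed_iff)
  \<comment> \<open>Comparing periods requires a reference element that the flow moves. If
    \<open>U0\<close> contains none, every time is a period on all of \<open>U0\<close>.\<close>
  have "\<exists>t>0. interior (Z t) \<noteq> {}"
  proof (cases "\<forall>v\<in>U0. P v = UNIV")
    case True
    then have "U0 \<subseteq> Z 1" by (auto simp: Z_def)
    then have "one \<in> interior (Z 1)" using U0 interior_maximal by blast
    then show ?thesis by (intro exI[of _ 1]) auto
  next
    case False
    then obtain v where v: "v \<in> U0" "P v \<noteq> UNIV" by blast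
    obtain s where s: "s > 0" "s \<in> P v" using P_pos by blast
    \<comment> \<open>Each \<open>w\<close> in \<open>U0\<close> has a period in common with
      \<open>v\<close>, and it is commensurable with \<open>s\<close>; so some multiple of
      \<open>s\<close> is a period of \<open>w\<close>. The index \<open>Suc n\<close> keeps the
      multiples positive.\<close>
    have cover: "U0 \<subseteq> (\<Union>n. Z (of_nat (Suc n) * s))"
    proof
      fix w assume "w \<in> U0"
      with common[OF v(1)] obtain q where q: "q > 0" "q \<in> P v" "q \<in> P w" by blast
      obtain a b :: nat where ab: "a > 0" "b > 0" "of_nat a * s = of_nat b * q"
        using comm[OF s(2) v(2) q(2) s(1) q(1)] by blast
      then have "w \<in> Z (of_nat (Suc (a - 1)) * s)" using P_nat[OF q(3)] by (simp add: Z_def)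
      then show "w \<in> (\<Union>n. Z (of_nat (Suc n) * s))" by blast
    qed
    have Z_closed: "closed (Z t)" for t
      unfolding Z_def P_def fixed_iff mem_Collect_eq by (intro closed_Collect_eq continuous_intros)
    have "Hausdorff_space (euclidean :: 'a topology)"
      unfolding Hausdorff_space_def disjnt_def by simp (metis hausdorff)
    moreover have "compact_space (euclidean :: 'a topology)"
      by (simp add: compact_space_def comp)
    ultimately have baire: "locally_compact_space (euclidean :: 'a topology) \<and> regular_space
      (euclidean :: 'a topology)"
      by (simp add: compact_imp_locally_compact_space compact_Hausdorff_imp_regular_space)
    have "\<exists>n. interior (Z (of_nat (Suc n) * s)) \<noteq> {}"
    proof (rule ccontr)
      assume "\<not> ?thesis"
      then have "euclidean interior_of \<Union> (range (\<lambda>n. Z (of_nat (Suc n) * s))) = {}"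
        using Z_closed by (intro Baire_category_alt disjI2 baire) auto
      then have "interior (\<Union>n. Z (of_nat (Suc n) * s)) = {}" by simp
      then show False using interior_maximal[OF cover U0(1)] U0(2) by blast
    qed
    then show ?thesis using s(1) by (metis mult_pos_pos of_nat_0_less_iff zero_less_Suc)
  qed
  then show thesis using finish that by blast
qed

end

section \<open>The adjoint flow\<close>

lemma has_real_derivative_power_over_fact:
  "((\<lambda>s::real. s ^ Suc k / fact (Suc k)) has_real_derivative (s ^ k / fact k)) (at s within S)"
proof -
  have "((\<lambda>s::real. s ^ Suc k / fact (Suc k)) has_real_derivative (of_nat (Suc k) * s ^ k / fact
    (Suc k))) (at s within S)"
    using DERIV_cdivide[OF DERIV_pow[of "Suc k" s S], of "fact (Suc k)"] by (simp del: fact_Suc)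
  moreover have "of_nat (Suc k) * s ^ k / fact (Suc k) = s ^ k / fact k"
    unfolding fact_Suc by (simp del: of_nat_Suc)
  ultimately show ?thesis by simp
qed

text \<open>The derivative of the Taylor remainder \<open>R (Suc n)\<close> is
  \<open>T (R n)\<close>, and \<open>R (Suc n)\<close> vanishes at \<open>0\<close>. Integrating the
  bound repeatedly gives powers of \<open>K\<close> over factorials, which tend to zero.\<close>

lemma linear_ode_exp_series:
  fixes T :: "'e::real_normed_vector \<Rightarrow> 'e"
  assumes T: "bounded_linear T"
    and u: "\<And>s. s \<in> {0..1} \<Longrightarrow> (u has_vector_derivative T (u s)) (at s within {0..1})"
  shows "(\<lambda>k. (T ^^ k) (u 0) /\<^sub>R fact k) sums u 1"
proof -
  interpret T: bounded_linear T by fact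
  let ?a = "\<lambda>k. (T ^^ k) (u 0)"
  define R where "R n s = u s - (\<Sum>k<n. (s ^ k / fact k) *\<^sub>R ?a k)" for n and s :: real
  define K where "K = onorm T"
  have K: "K \<ge> 0" unfolding K_def by (rule onorm_pos_le[OF T])
  have cont: "continuous_on {0..1} u"
    using u by (meson continuous_on_eq_continuous_within has_vector_derivative_continuous)
  obtain M where M: "\<forall>s\<in>{0..1}. norm (u s) \<le> M"
    using compact_imp_bounded[OF compact_continuous_image[OF cont compact_Icc]] by
      (auto simp: bounded_iff)
  have R0: "R (Suc n) 0 = 0" for n
    by (simp add: R_def sum.lessThan_Suc_shift del: sum.lessThan_Suc)
  have R_der: "(R (Suc n) has_vector_derivative T (R n s)) (at s within {0..1})" if s:
    "s \<in> {0..1}" for n s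
  proof -
    have term_der: "((\<lambda>s. (s ^ Suc k / fact (Suc k)) *\<^sub>R ?a (Suc k)) has_vector_derivative
      (s ^ k / fact k) *\<^sub>R T (?a k)) (at s within {0..1})" for k
    proof -
      show ?thesis
        using has_vector_derivative_scaleR[OF has_real_derivative_power_over_fact
          has_vector_derivative_const] by fastforce
    qed
    have "R (Suc n) = (\<lambda>s. u s - (u 0 + (\<Sum>k<n. (s ^ Suc k / fact (Suc k)) *\<^sub>R ?a (Suc k))))"
      by (simp add: R_def fun_eq_iff sum.lessThan_Suc_shift del: sum.lessThan_Suc fact_Suc
        power_Suc)
    moreover have "((\<lambda>s. u s - (u 0 + (\<Sum>k<n. (s ^ Suc k / fact (Suc k)) *\<^sub>R ?a (Suc k))))
      has_vector_derivative
        T (u s) - (0 + (\<Sum>k<n. (s ^ k / fact k) *\<^sub>R T (?a k)))) (at s within {0..1})"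
      by (intro has_vector_derivative_diff has_vector_derivative_add has_vector_derivative_const
          has_vector_derivative_sum u term_der s)
    moreover have "T (R n s) = T (u s) - (\<Sum>k<n. (s ^ k / fact k) *\<^sub>R T (?a k))"
      by (simp add: R_def T.diff T.sum T.scaleR)
    ultimately show ?thesis by simp
  qed
  have bound: "norm (R n s) \<le> M * K ^ n * s ^ n / fact n" if "s \<in> {0..1}" for n s
    using that
  proof (induction n arbitrary: s)
    case 0
    then show ?case using M by (simp add: R_def)
  next
    case (Suc n)
    show ?case
    proof (cases "s = 0")
      case True
      then show ?thesis by (simp add: R0)
    next
      case False
      with Suc.prems have s: "0 < s" "s \<le> 1" by auto
      \<comment> \<open>\<open>?\<psi>\<close> is the antiderivative of the bound
        \<open>?\<psi>'\<close> on the derivative of the remainder.\<close>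
      let ?\<psi> = "\<lambda>r. M * K ^ Suc n * r ^ Suc n / fact (Suc n)" and ?\<psi>' =
        "\<lambda>r. M * K ^ Suc n * r ^ n / fact n"
      have "norm (R (Suc n) s - R (Suc n) 0) \<le> ?\<psi> s - ?\<psi> 0"
      proof (rule differentiable_bound_general[OF s(1), of "R (Suc n)" ?\<psi> "\<lambda>r. T (R n r)" ?\<psi>'])
        show "continuous_on {0..s} (R (Suc n))"
        proof (rule continuous_on_subset)
          show "continuous_on {0..1} (R (Suc n))"
            using R_der by (meson continuous_on_eq_continuous_within
              has_vector_derivative_continuous)
        qed (use s in auto)
        show "continuous_on {0..s} ?\<psi>" by (intro continuous_intros) auto
        fix r assume r: "0 < r" "r < s"
        then have r01: "r \<in> {0..1}" "r \<in> interior {0..1}" using s by auto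
        show "(R (Suc n) has_vector_derivative T (R n r)) (at r)"
          using R_der[OF r01(1), of n] at_within_interior[OF r01(2)] by simp
        have "((\<lambda>r. ?\<psi> r) has_real_derivative ?\<psi>' r) (at r)"
          using DERIV_cmult[OF has_real_derivative_power_over_fact[of n r UNIV], of "M * K ^ Suc n"]
          by (simp add: mult_ac del: power_Suc fact_Suc)
        then show "(?\<psi> has_vector_derivative ?\<psi>' r) (at r)"
          by (simp add: has_real_derivative_iff_has_vector_derivative)
        have "norm (T (R n r)) \<le> K * norm (R n r)" unfolding K_def by (rule onorm[OF T])
        also have "\<dots> \<le> K * (M * K ^ n * r ^ n / fact n)" by (intro mult_left_mono Suc.IH r01 K)
        finally show "norm (T (R n r)) \<le> ?\<psi>' r" by (simp add: mult_ac)
      qed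
      then show ?thesis by (simp add: R0)
    qed
  qed
  have "(\<lambda>n. K ^ n / fact n) \<longlonglongrightarrow> 0"
    using summable_LIMSEQ_zero[OF summable_exp_generic[of K]] by (simp add: divide_inverse_commute)
  then have "(\<lambda>n. M * (K ^ n / fact n)) \<longlonglongrightarrow> M * 0"
    by (intro tendsto_mult tendsto_const)
  moreover have "norm (R n 1) \<le> M * (K ^ n / fact n)" for n using bound[of 1 n] by simp
  ultimately have "(\<lambda>n. R n 1) \<longlonglongrightarrow> 0"
    by (intro Lim_null_comparison[of "\<lambda>n. R n 1" "\<lambda>n. M * (K ^ n / fact n)"]) auto
  then have "(\<lambda>n. u 1 - R n 1) \<longlonglongrightarrow> u 1 - 0" by (intro tendsto_diff tendsto_const)
  then show ?thesis unfolding sums_def by (simp add: R_def divide_inverse_commute)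
qed

text \<open>\<open>suminf\<close> is a description, so the limit has to be unique; limits in the
  product topology are compared coordinate by coordinate.\<close>

lemma sums_fun_imp_suminf:
  fixes f :: "nat \<Rightarrow> 'x \<Rightarrow> 'y \<Rightarrow> 'z::{t2_space, comm_monoid_add}"
  assumes "f sums s"
  shows "suminf f = s"
  unfolding suminf_def
proof (rule the_equality)
  show "f sums s" by fact
  fix r assume "f sums r"
  have coord: "(\<lambda>n. (\<Sum>k<n. f k) x y) \<longlonglongrightarrow> l x y" if "f sums l" for l x y
  proof -
    have "continuous_on UNIV (\<lambda>F :: 'x \<Rightarrow> 'y \<Rightarrow> 'z. F x y)"
      by (intro continuous_on_product_then_coordinatewise[of _ "\<lambda>F. F x"
        for x] continuous_on_product_coordinates)
    from continuous_on_tendsto_compose[OF this that[unfolded sums_def]] show ?thesis by simp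
  qed
  show "r = s"
    using coord[OF \<open>f sums r\<close>] coord[OF assms] by (intro ext) (rule LIMSEQ_unique)
qed

section \<open>The adjoint representation and its derivative\<close>

context lie_group begin

text \<open>This is \<open>Ad g\<close>, transported to the model space by
  \<open>rfield\<close>.\<close>

definition Ad_base :: "'a \<Rightarrow> 'e \<Rightarrow> 'e" where
  "Ad_base g = frechet_derivative (\<lambda>x. snd base (mul (mul g (chart_inv base x)) (inver g))) (at
    (snd base one))"

text \<open>One factorization through a chart at \<open>g\<close> is applied twice: to
  \<open>chart_inv base\<close>, which identifies \<open>Ad_base g\<close>, and to the given
  \<open>f\<close>.\<close>

lemma chart_deriv_conj:
  assumes "chart_deriv base f z L" "f z = one"
  shows "chart_deriv base (\<lambda>z. mul (mul g (f z)) (inver g)) z (\<lambda>h. Ad_base g (L h))"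
proof -
  obtain c where c: "c \<in> charts_at A g" by (rule chart_exists)
  note c' = charts_atD[OF c]
  have *: "chart_deriv base (\<lambda>z. mul (mul g (f z)) (inver g)) z (\<lambda>h. dright c base g (inver g)
    (dleft base c g one (L h)))"
    if f: "chart_deriv base f z L" "f z = one" for f and z :: "'w::real_normed_vector" and L
  proof -
    have "chart_deriv c (\<lambda>z. mul g (f z)) z (\<lambda>h. dleft base c g one (L h))"
      using chart_deriv_dleft[OF f(1), of c g] c' f(2) by simp
    from chart_deriv_dright[OF this, of base "inver g"] show ?thesis using c' f(2) by simp
  qed
  have ci: "chart_deriv base (chart_inv base) (snd base one) (\<lambda>h. h)"
    by (rule chart_deriv_chart_inv_at) auto
  have "Ad_base g = (\<lambda>h. dright c base g (inver g) (dleft base c g one h))"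
    unfolding Ad_base_def by (rule chart_deriv_frechet_derivative[OF *[OF ci]]) simp
  with *[OF assms] show ?thesis by simp
qed

lemma chart_deriv_Ad_base:
  "chart_deriv base (\<lambda>x. mul (mul g (chart_inv base x)) (inver g)) (snd base one) (Ad_base g)"
  using chart_deriv_conj[OF chart_deriv_chart_inv_at[of base one]] by simp

lemma Ad_base_mul: "Ad_base (mul g h) w = Ad_base g (Ad_base h w)"
proof -
  have "chart_deriv base (\<lambda>x. mul (mul g (mul (mul h (chart_inv base x)) (inver h))) (inver g))
    (snd base one)
      (\<lambda>w. Ad_base g (Ad_base h w))"
    by (rule chart_deriv_conj[OF chart_deriv_Ad_base]) simp
  then have "chart_deriv base (\<lambda>x. mul (mul (mul g h) (chart_inv base x)) (inver (mul g h)))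
    (snd base one)
      (\<lambda>w. Ad_base g (Ad_base h w))"
    by (simp add: assoc inverse_distrib_swap)
  then show ?thesis using chart_deriv_unique[OF chart_deriv_Ad_base] by metis
qed

text \<open>Left translation by \<open>g\<close> is conjugation by \<open>g\<close> followed by
  right translation by \<open>g\<close>. In particular \<open>Ad_base g w = w\<close> implies
  \<open>rfield w g = lfield w g\<close>.\<close>

lemma rfield_Ad_base: "rfield (Ad_base g w) g = lfield w g"
proof
  fix c
  show "rfield (Ad_base g w) g c = lfield w g c"
  proof (cases "c \<in> charts_at A g")
    case True
    note c' = charts_atD[OF True]
    have 1: "chart_deriv c (\<lambda>x. mul g (chart_inv base x)) (snd base one) (dleft base c g one)"
      by (rule chart_deriv_dleft_chart) (use c' in auto)
    have "chart_deriv c (\<lambda>x. mul (mul (mul g (chart_inv base x)) (inver g)) g) (snd base one)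
        (\<lambda>h. dright base c one g (Ad_base g h))"
      using chart_deriv_dright[OF chart_deriv_Ad_base, of c g g] c' by simp
    then have "chart_deriv c (\<lambda>x. mul g (chart_inv base x)) (snd base one)
      (\<lambda>h. dright base c one g (Ad_base g h))"
      by (simp add: assoc)
    from chart_deriv_unique[OF 1 this] show ?thesis
      using True by (simp add: rfield_apply lfield_apply)
  qed (simp add: rfield_def lfield_def)
qed

lemma rfield_eq_lfield_central:
  assumes "\<And>g. mul z g = mul g z"
  shows "rfield w z = lfield w z"
  by (simp add: fun_eq_iff rfield_def lfield_def dright_def dleft_def assms)

lemma lie_bracket_rfield_lfield': "lie_bracket A (lfield v) (rfield w) = 0"
  using lie_bracket_antisym[of "lfield v" "rfield w"] lie_bracket_rfield_lfield[of w v] by simp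

text \<open>The field \<open>lfield w - rfield w\<close> vanishes at the unit, so its bracket with
  \<open>rfield v\<close> reduces there to minus its derivative along \<open>v\<close>; the left
  invariant part contributes nothing to the bracket.\<close>

lemma dfield_lfield_rfield: "dfield (lfield w - rfield w) base one v = - lie_bracket A
  (rfield v) (rfield w) one base"
proof -
  have "lie_bracket A (lfield w - rfield w) (rfield v) one base = - lie_bracket A (rfield w)
    (rfield v) one base"
    by (simp add: lie_bracket_diff_left diff_field_rfield diff_field_lfield
      lie_bracket_rfield_lfield')
  also have "\<dots> = lie_bracket A (rfield v) (rfield w) one base"
    using lie_bracket_antisym[of "rfield v" "rfield w"] by simp
  finally have *: "lie_bracket A (lfield w - rfield w) (rfield v) one base = lie_bracket A
    (rfield v) (rfield w) one base" .
  have "bounded_linear (dfield (rfield v) base one)" by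
    (rule bounded_linear_dfield[OF diff_field_rfield base_chart])
  then have "dfield (rfield v) base one 0 = 0" by (rule linear_0[OF bounded_linear.linear])
  then have "lie_bracket A (lfield w - rfield w) (rfield v) one base = - dfield
    (lfield w - rfield w) base one v"
    by (simp add: lie_bracket_eq[OF base_chart])
  with * show ?thesis by (metis minus_minus)
qed

text \<open>The derivation D in the coordinates of \<open>rfield\<close>; the sign turns the bracket
  of right invariant fields into the usual \<open>ad v\<close>.\<close>

definition ad_op :: "'e \<Rightarrow> 'e \<Rightarrow> 'e" where
  "ad_op v w = - lie_bracket A (rfield v) (rfield w) one base"

text \<open>\<open>lfield v\<close> commutes with right invariant fields, so only
  \<open>rfield v\<close> acts.\<close>

lemma derivation_of_rfield: "derivation_of A (rfield v - lfield v) (rfield w) = rfield (ad_op v w)"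
proof -
  have "lie_bracket A (rfield v - lfield v) (rfield w) = rfield (lie_bracket A (rfield v)
    (rfield w) one base)"
    using lie_bracket_rfield_rfield[of v w]
    by (simp add: lie_bracket_diff_left diff_field_rfield diff_field_lfield
      lie_bracket_rfield_lfield')
  moreover have "rfield (- 1 *\<^sub>R u) = - rfield u" for u
    unfolding rfield_scaleR by (simp add: fun_eq_iff scaleR_fun_def)
  then have "rfield (- u) = - rfield u" for u by simp
  ultimately show ?thesis by (simp add: derivation_of_def ad_op_def)
qed

text \<open>Linearity in \<open>w\<close> holds because \<open>ad_op v\<close> is the derivative at
  the unit of the single field \<open>rfield v - lfield v\<close>, which vanishes there.\<close>

lemma bounded_linear_ad_op: "bounded_linear (ad_op v)"
proof -
  have df: "diff_field (rfield v - lfield v)" by (intro diff_field_diff diff_field_rfield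
    diff_field_lfield)
  have "ad_op v = dfield (rfield v - lfield v) base one"
  proof
    fix w
    have "bounded_linear (dfield (rfield w) base one)" by
      (rule bounded_linear_dfield[OF diff_field_rfield base_chart])
    then have 0: "dfield (rfield w) base one 0 = 0" by (rule linear_0[OF bounded_linear.linear])
    have "ad_op v w = - lie_bracket A (rfield v - lfield v) (rfield w) one base"
      by (simp add: ad_op_def lie_bracket_diff_left diff_field_rfield diff_field_lfield
        lie_bracket_rfield_lfield')
    also have "\<dots> = dfield (rfield v - lfield v) base one w"
      by (simp add: lie_bracket_eq[OF base_chart] 0)
    finally show "ad_op v w = dfield (rfield v - lfield v) base one w" .
  qed
  then show ?thesis using bounded_linear_dfield[OF df base_chart] by simp
qed

lemma Ad_base_one: "Ad_base one w = w"
  using fun_cong[OF rfield_Ad_base[of one w], of base] by simp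

text \<open>The derivative at \<open>0\<close> is read off from \<open>rfield (Ad_base (\<Gamma> t) w - w) = lfield w - rfield
  w\<close> at \<open>\<Gamma> t\<close>.\<close> 

lemma Ad_base_has_derivative_0:
  assumes \<Gamma>0: "\<Gamma> 0 = one" and \<Gamma>: "curve_on UNIV (rfield v) \<Gamma>"
  shows "((\<lambda>t. Ad_base (\<Gamma> t) w) has_vector_derivative ad_op v w) (at 0)"
proof -
  let ?q = "\<lambda>t. Ad_base (\<Gamma> t) w - w" and ?T = "ad_op v w"
  have cd: "chart_deriv base \<Gamma> 0 (\<lambda>h. h *\<^sub>R v)"
    using curve_onD[OF \<Gamma> UNIV_I, of base 0] base_chart \<Gamma>0 by simp
  then have y: "((\<lambda>t. snd base (\<Gamma> t)) has_derivative (\<lambda>h. h *\<^sub>R v)) (at 0)" and cont: "isCont \<Gamma> 0"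
    by (simp_all add: chart_deriv_def)
  have dom: "eventually (\<lambda>t. \<Gamma> t \<in> fst base) (nhds 0)"
    using cont chart_open[OF base_in(1)] \<Gamma>0 by (simp add: isCont_def tendsto_def
      eventually_nhds_conv_at)
  then obtain S where S: "open S" "0 \<in> S" "\<And>t. t \<in> S \<Longrightarrow> \<Gamma> t \<in> fst base"
    unfolding eventually_nhds by auto
  have comp: "((\<lambda>t. V (\<Gamma> t) base) has_derivative (\<lambda>h. dfield V base one (h *\<^sub>R v))) (at 0)"
    if "diff_field V" for V
  proof (rule has_derivative_transform_within_open[OF _ S(1,2)])
    show "((\<lambda>t. V (chart_inv base (snd base (\<Gamma> t))) base) has_derivative (\<lambda>h. dfield V base one
      (h *\<^sub>R v))) (at 0)"
      by (rule has_derivative_compose[OF y]) (use diff_fieldD[OF that base_chart] \<Gamma>0 in simp)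
  qed (use S in simp)
  let ?n = "\<lambda>t. (lfield w - rfield w) (\<Gamma> t) base"
  have "bounded_linear (dfield (lfield w - rfield w) base one)"
    by (intro bounded_linear_dfield base_chart diff_field_diff diff_field_lfield diff_field_rfield)
  then have "dfield (lfield w - rfield w) base one (h *\<^sub>R v) = h *\<^sub>R ?T" for h
    unfolding ad_op_def dfield_lfield_rfield[of w v, symmetric] by
      (rule linear_cmul[OF bounded_linear.linear])
  then have n: "(?n has_derivative (\<lambda>h. h *\<^sub>R ?T)) (at 0)"
    using comp[OF diff_field_diff[OF diff_field_lfield diff_field_rfield], of w w] by (simp only:)
  \<comment> \<open>\<open>?Q t\<close> tends to the identity and maps \<open>?q t\<close> to
    \<open>?n t\<close>, so \<open>?q\<close> inherits the known first-order behaviour of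
    \<open>?n\<close> at \<open>0\<close>.\<close>
  let ?Q = "\<lambda>t u. rfield u (\<Gamma> t) base"
  have Qq: "?Q t (?q t) = ?n t" for t
  proof -
    have "?Q t (?q t) = ?Q t (Ad_base (\<Gamma> t) w) - ?Q t w"
      by (rule linear_diff[OF bounded_linear.linear[OF bounded_linear_rfield]])
    then show ?thesis by (simp add: rfield_Ad_base)
  qed
  have Qlim: "((\<lambda>t. ?Q t u) \<longlongrightarrow> u) (at 0)" for u
    using has_derivative_continuous[OF comp[OF diff_field_rfield[of u]]] \<Gamma>0 by
      (simp add: continuous_within)
  show ?thesis
    unfolding has_vector_derivative_def has_derivative_at_alt
  proof (intro conjI allI impI)
    show "bounded_linear (\<lambda>h. h *\<^sub>R ?T)" by (rule bounded_linear_scaleR_left)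
    fix e :: real assume e: "e > 0"
    \<comment> \<open>The bound \<open>1/2\<close> absorbs \<open>norm (?q t)\<close> on the left.
      The remaining error is \<epsilon> times
      \<open>2 * (norm ?T + 1) + 1 = 2 * norm ?T + 3\<close>, relative to
      \<open>\<bar>t\<bar>\<close>.\<close>
    define \<epsilon> where "\<epsilon> = min (1/2) (e / (2 * norm ?T + 3))"
    have den: "2 * norm ?T + 3 > 0" by (intro add_nonneg_pos) auto
    have "\<epsilon> \<le> 1/2" unfolding \<epsilon>_def by (rule min.cobounded1)
    moreover have "\<epsilon> * (2 * norm ?T + 3) \<le> e / (2 * norm ?T + 3) * (2 * norm ?T + 3)"
      using den by (intro mult_right_mono) (auto simp: \<epsilon>_def)
    moreover have "\<epsilon> > 0" using e den by (simp add: \<epsilon>_def)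
    ultimately have \<epsilon>: "\<epsilon> > 0" "\<epsilon> \<le> 1/2" "\<epsilon> * (2 * norm ?T + 3) \<le> e"
      using den by simp_all
    have "eventually (\<lambda>t. \<forall>u. norm (?Q t u - u) \<le> \<epsilon> * norm u) (at 0)"
      by (rule eventually_uniform_pointwise_linear[OF Qlim])
        (simp_all add: bounded_linear_rfield bounded_linear_ident \<epsilon>)
    then obtain d1 where d1: "d1 > 0" "\<And>t u. \<lbrakk>t \<noteq> 0; \<bar>t\<bar> < d1\<rbrakk> \<Longrightarrow> norm (?Q t u - u) \<le> \<epsilon> * norm u"
      unfolding eventually_at by auto
    obtain d2 where d2: "d2 > 0" "\<And>t. \<bar>t\<bar> < d2 \<Longrightarrow> norm (?n t - t *\<^sub>R ?T) \<le> \<epsilon> * \<bar>t\<bar>"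
      using n \<epsilon>(1) \<Gamma>0 unfolding has_derivative_at_alt by (auto simp: base_chart)
    have "norm (Ad_base (\<Gamma> t) w - Ad_base (\<Gamma> 0) w - (t - 0) *\<^sub>R ?T) \<le> e * norm (t - 0)" if t:
      "norm (t - 0) < min d1 d2" for t
    proof (cases "t = 0")
      case False
      have 1: "norm (?n t - ?q t) \<le> \<epsilon> * norm (?q t)" using d1(2)[OF False, of "?q t"] t Qq by simp
      have 2: "norm (?n t - t *\<^sub>R ?T) \<le> \<epsilon> * \<bar>t\<bar>" using d2 t by simp
      have "norm (?n t) \<le> \<bar>t\<bar> * norm ?T + \<epsilon> * \<bar>t\<bar>"
        using norm_triangle_sub[of "?n t" "t *\<^sub>R ?T"] 2 by simp
      also have "\<dots> \<le> (norm ?T + 1) * \<bar>t\<bar>" using \<epsilon>(2) mult_right_mono[of \<epsilon> 1 "\<bar>t\<bar>"] by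
        (simp add: algebra_simps)
      finally have nt: "norm (?n t) \<le> (norm ?T + 1) * \<bar>t\<bar>" .
      have "norm (?q t) \<le> norm (?n t) + \<epsilon> * norm (?q t)"
        using norm_triangle_sub[of "?q t" "?n t"] 1 by (simp add: norm_minus_commute)
      also have "\<dots> \<le> norm (?n t) + 1/2 * norm (?q t)" using \<epsilon>(2) by
        (intro add_left_mono mult_right_mono) auto
      finally have q: "norm (?q t) \<le> 2 * ((norm ?T + 1) * \<bar>t\<bar>)" using nt by simp
      have "norm (?q t - t *\<^sub>R ?T) \<le> norm (?n t - ?q t) + norm (?n t - t *\<^sub>R ?T)"
      proof -
        have "?q t - t *\<^sub>R ?T = (?n t - t *\<^sub>R ?T) - (?n t - ?q t)" by simp
        then show ?thesis using norm_triangle_ineq4[of "?n t - t *\<^sub>R ?T" "?n t - ?q t"] by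
          (simp only: add.commute)
      qed
      also have "\<dots> \<le> \<epsilon> * (2 * ((norm ?T + 1) * \<bar>t\<bar>)) + \<epsilon> * \<bar>t\<bar>"
        using 1 2 q \<epsilon>(1) by (intro add_mono order_trans[OF 1] mult_left_mono) auto
      also have "\<dots> = \<epsilon> * (2 * norm ?T + 3) * \<bar>t\<bar>" by (simp add: algebra_simps)
      also have "\<dots> \<le> e * \<bar>t\<bar>" by (intro mult_right_mono \<epsilon>) auto
      finally show ?thesis by (simp add: \<Gamma>0 Ad_base_one)
    qed simp
    moreover have "min d1 d2 > 0" using d1 d2 by simp
    ultimately show "\<exists>d>0. \<forall>t. norm (t - 0) < d \<longrightarrow>
        norm (Ad_base (\<Gamma> t) w - Ad_base (\<Gamma> 0) w - (t - 0) *\<^sub>R ?T) \<le> e * norm (t - 0)" by blast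
  qed
qed

text \<open>The homomorphism property shifts the derivative at \<open>0\<close> to any time.\<close>

lemma Ad_base_has_derivative:
  assumes hom: "\<And>s t. \<Gamma> (s + t) = mul (\<Gamma> s) (\<Gamma> t)" and \<Gamma>: "curve_on UNIV (rfield v) \<Gamma>"
  shows "((\<lambda>t. Ad_base (\<Gamma> t) w) has_vector_derivative ad_op v (Ad_base (\<Gamma> t) w)) (at t)"
proof -
  have \<Gamma>0: "\<Gamma> 0 = one" using hom by (rule hom_zero)
  have "((\<lambda>s. Ad_base (\<Gamma> (s - t)) (Ad_base (\<Gamma> t) w)) has_vector_derivative 1 *\<^sub>R ad_op v
    (Ad_base (\<Gamma> t) w)) (at t)"
    using vector_diff_chain_at[of "\<lambda>s. s - t" 1 t "\<lambda>s. Ad_base (\<Gamma> s) (Ad_base (\<Gamma> t) w)"]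
      Ad_base_has_derivative_0[OF \<Gamma>0 \<Gamma>, of "Ad_base (\<Gamma> t) w"]
    by (simp add: comp_def has_vector_derivative_diff_const has_vector_derivative_id)
  moreover have "Ad_base (\<Gamma> (s - t)) (Ad_base (\<Gamma> t) w) = Ad_base (\<Gamma> s) w" for s
    using hom[of "s - t" t] by (simp flip: Ad_base_mul)
  ultimately show ?thesis by simp
qed

text \<open>\<open>rfield\<close> intertwines \<open>ad_op v\<close> with the derivation, and
  \<open>Ad_base (\<Gamma> (t * s)) w\<close> solves a linear equation in \<open>s\<close> whose
  value at \<open>1\<close> is the exponential series. Continuity of \<open>rfield\<close>
  transports the sum.\<close>

lemma operator_exp_rfield:
  assumes hom: "\<And>s t. \<Gamma> (s + t) = mul (\<Gamma> s) (\<Gamma> t)" and \<Gamma>: "curve_on UNIV (rfield v) \<Gamma>"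
  shows "operator_exp (\<lambda>Y. t *\<^sub>R derivation_of A (rfield v - lfield v) Y) (rfield w) = rfield
    (Ad_base (\<Gamma> t) w)"
proof -
  let ?T = "\<lambda>w. t *\<^sub>R ad_op v w"
  define \<X> where "\<X> = rfield v - lfield v"
  have der: "derivation_of A \<X> (rfield w) = rfield (ad_op v w)" for w
    unfolding \<X>_def by (rule derivation_of_rfield)
  have pow: "((\<lambda>Y. t *\<^sub>R derivation_of A \<X> Y) ^^ k) (rfield w) = rfield ((?T ^^ k) w)" for k
    by (induction k) (simp_all add: der rfield_scaleR)
  have "(\<lambda>k. (?T ^^ k) (Ad_base (\<Gamma> (t * 0)) w) /\<^sub>R fact k) sums Ad_base (\<Gamma> (t * 1)) w"
  proof (rule linear_ode_exp_series[of ?T "\<lambda>s. Ad_base (\<Gamma> (t * s)) w"])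
    show "bounded_linear ?T" by (intro bounded_linear_const_scaleR bounded_linear_ad_op)
    fix s :: real
    have "((\<lambda>s. Ad_base (\<Gamma> (t * s)) w) has_vector_derivative t *\<^sub>R ad_op v (Ad_base (\<Gamma> (t * s))
      w)) (at s)"
      using vector_diff_chain_at[of "\<lambda>s. t * s" t s "\<lambda>s. Ad_base (\<Gamma> s)
        w"] Ad_base_has_derivative[OF hom \<Gamma>, of w "t * s"]
      by (simp add: comp_def flip: has_real_derivative_iff_has_vector_derivative)
    then show "((\<lambda>s. Ad_base (\<Gamma> (t * s)) w) has_vector_derivative ?T (Ad_base (\<Gamma> (t * s)) w))
      (at s within {0..1})"
      by (rule has_vector_derivative_at_within)
  qed
  then have sums: "(\<lambda>k. (?T ^^ k) w /\<^sub>R fact k) sums Ad_base (\<Gamma> t) w"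
    using hom_zero[OF hom] by (simp add: Ad_base_one)
  have rfield_sum: "rfield (\<Sum>k\<in>I. f k) = (\<Sum>k\<in>I. rfield (f k))" if "finite I" for I :: "nat set"
    and f
    using that by induction (simp_all add: rfield_zero rfield_add)
  have "continuous_on UNIV rfield"
    by (intro continuous_on_coordinatewise_then_product linear_continuous_on bounded_linear_rfield)
  then have "isCont rfield (Ad_base (\<Gamma> t) w)" by (simp add: continuous_on_eq_continuous_at)
  from isCont_tendsto_compose[OF this sums[unfolded sums_def]]
  have "(\<lambda>k. rfield ((?T ^^ k) w /\<^sub>R fact k)) sums rfield (Ad_base (\<Gamma> t) w)"
    by (simp add: sums_def rfield_sum)
  then show ?thesis unfolding operator_exp_def \<X>_def[symmetric] pow
    by (intro sums_fun_imp_suminf) (simp add: rfield_scaleR)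
qed

section \<open>The kernel of the adjoint representation\<close>

text \<open>Elements of the kernel are zeros of every field \<open>lfield w - rfield w\<close>. If
  they accumulate at the unit, the derivatives of these fields vanish along a limit \<open>v\<close>
  of the normalized coordinate differences, which makes \<open>rfield v\<close> central.\<close>

lemma semisimple_center_discrete:
  assumes "lie_semisimple A mul"
  obtains U where "open U" "one \<in> U" "\<And>z. \<lbrakk>z \<in> U; \<And>w. rfield w z = lfield w z\<rbrakk> \<Longrightarrow> z = one"
proof (rule ccontr)
  note witness = that
  assume "\<not> thesis"
  then have no: "\<exists>z\<in>U. (\<forall>w. rfield w z = lfield w z) \<and> z \<noteq> one" if "open U" "one \<in> U" for U
    using that witness[of U] by blast
  let ?e = "snd base one"
  have "\<exists>z. z \<in> fst base \<and> norm (snd base z - ?e) < 1 / real (Suc n) \<and> (\<forall>w. rfield w z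
    = lfield w z) \<and> z \<noteq> one" for n
  proof -
    have "continuous_on (fst base) (snd base)"
      using chart_homeomorphism[OF base_in(1)] by (simp add: homeomorphism_def)
    then have "open (fst base \<inter> snd base -` ball ?e (1 / real (Suc n)))"
      by (rule continuous_open_preimage) (auto intro: chart_open)
    from no[OF this] show ?thesis by (auto simp: dist_norm norm_minus_commute)
  qed
  then obtain z where z: "\<And>n. z n \<in> fst base" "\<And>n. norm (snd base (z n) - ?e) < 1 / real (Suc n)"
      "\<And>n w. rfield w (z n) = lfield w (z n)" "\<And>n. z n \<noteq> one"
    by metis
  define y where "y n = snd base (z n) - ?e" for n
  have y0: "y n \<noteq> 0" for n
  proof
    assume "y n = 0"
    then have "chart_inv base (snd base (z n)) = chart_inv base ?e" by (simp add: y_def)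
    then show False using z(1,4) by simp
  qed
  have y_lim: "y \<longlonglongrightarrow> 0"
  proof (rule Lim_null_comparison)
    show "eventually (\<lambda>n. norm (y n) \<le> 1 / real (Suc n)) sequentially"
      using z(2) by (simp add: y_def less_imp_le)
    show "(\<lambda>n. 1 / real (Suc n)) \<longlonglongrightarrow> 0" using LIMSEQ_inverse_real_of_nat by
      (simp add: inverse_eq_divide)
  qed
  define u where "u n = y n /\<^sub>R norm (y n)" for n
  have u1: "norm (u n) = 1" for n using y0 by (simp add: u_def)
  have "bounded (range u)" by (rule boundedI[where B=1]) (auto simp: u1)
  then obtain v r where vr: "strict_mono r" "(u \<circ> r) \<longlonglongrightarrow> v"
    using bounded_imp_convergent_subsequence by blast
  have v1: "norm v = 1"
    using tendsto_norm[OF vr(2)] by (simp add: u1 comp_def LIMSEQ_const_iff)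
  have yr: "(\<lambda>n. y (r n)) \<longlonglongrightarrow> 0" using LIMSEQ_subseq_LIMSEQ[OF y_lim vr(1)] by (simp add: comp_def)
  have "dfield (lfield w - rfield w) base one v = 0" for w
  proof -
    let ?N = "\<lambda>x. (lfield w - rfield w) (chart_inv base x) base" and ?D = "dfield
      (lfield w - rfield w) base one"
    have df: "diff_field (lfield w - rfield w)" by (intro diff_field_diff diff_field_lfield
      diff_field_rfield)
    have D: "(?N has_derivative ?D) (at ?e)" by (rule diff_fieldD[OF df base_chart])
    interpret D: bounded_linear ?D using D by (rule has_derivative_bounded_linear)
    have N: "?N (?e + y n) = 0" "?N ?e = 0" for n
      using z(1,3) by (simp_all add: y_def)
    have D_lim: "(\<lambda>n. norm (?D (u (r n)))) \<longlonglongrightarrow> norm (?D v)"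
      using vr(2) by (intro tendsto_norm D.tendsto) (simp add: comp_def)
    have "norm (?D v) \<le> e" if e: "e > 0" for e
    proof -
      obtain d where d: "d > 0" "\<And>x. norm (x - ?e) < d \<Longrightarrow> norm (?N x - ?N ?e - ?D (x - ?e))
        \<le> e * norm (x - ?e)"
        using D e unfolding has_derivative_at_alt by blast
      have "eventually (\<lambda>n. norm (y (r n)) < d) sequentially"
        using tendstoD[OF yr d(1)] by simp
      then have "eventually (\<lambda>n. norm (?D (u (r n))) \<le> e) sequentially"
      proof eventually_elim
        case (elim n)
        have "norm (?D (y (r n))) \<le> e * norm (y (r n))"
          using d(2)[of "?e + y (r n)"] elim N by simp
        then show ?case using y0[of "r n"] by (simp add: u_def D.scaleR field_simps)
      qed
      then show ?thesis by (rule tendsto_upperbound[OF D_lim]) simp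
    qed
    then show ?thesis by (metis dense_ge norm_le_zero_iff)
  qed
  then have "lie_bracket A (rfield v) (rfield w) one base = 0" for w
    using dfield_lfield_rfield[of w v] by simp
  then have "lie_bracket A (rfield v) (rfield w) = 0" for w
    using lie_bracket_rfield_rfield[of v w] by (simp add: rfield_zero)
  then have central: "lie_bracket A (rfield w) (rfield v) = 0" for w
    using lie_bracket_antisym[of "rfield w" "rfield v"] by simp
  \<comment> \<open>The ideal is the whole centre of the Lie algebra; its brackets are zero, so it
    is solvable in one step.\<close>
  define I where "I = {rfield u |u. \<forall>w. lie_bracket A (rfield w) (rfield u) = 0}"
  have in_I: "rfield u \<in> I" if "\<And>w. lie_bracket A (rfield w) (rfield u) = 0" for u
    using that unfolding I_def by blast
  have sub: "subspace I"
    unfolding subspace_def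
  proof (intro conjI ballI allI)
    have "lie_bracket A (rfield w) (rfield (0 *\<^sub>R v)) = 0" for w
      unfolding rfield_scaleR lie_bracket_scaleR_right[OF diff_field_rfield diff_field_rfield]
        by simp
    then show "0 \<in> I" using in_I[of 0] by (simp add: rfield_zero)
    fix X assume "X \<in> I"
    then obtain x where x: "X = rfield x" "\<And>w. lie_bracket A (rfield w) (rfield x) = 0"
      unfolding I_def by blast
    show "r *\<^sub>R X \<in> I" for r
      using in_I[of "r *\<^sub>R x"] x
      by (simp add: rfield_scaleR lie_bracket_scaleR_right[OF diff_field_rfield diff_field_rfield])
    fix Y assume "Y \<in> I"
    then obtain y where y: "Y = rfield y" "\<And>w. lie_bracket A (rfield w) (rfield y) = 0"
      unfolding I_def by blast
    show "X + Y \<in> I"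
      using in_I[of "x + y"] x y
      by (simp add: rfield_add lie_bracket_add_right[OF diff_field_rfield diff_field_rfield
        diff_field_rfield])
  qed
  have zero: "lie_bracket A X Y = 0" if "X \<in> lie_algebra A mul" "Y \<in> I" for X Y
    using that unfolding I_def lie_algebra_rfield by blast
  have I_sub: "I \<subseteq> lie_algebra A mul" unfolding I_def lie_algebra_rfield by blast
  have "lie_ideal A (lie_algebra A mul) I"
    unfolding lie_ideal_def
  proof (intro conjI ballI)
    show "lie_bracket A X Y \<in> I" if "X \<in> lie_algebra A mul" "Y \<in> I" for X Y
      unfolding zero[OF that] by (rule subspace_0[OF sub])
  qed (fact I_sub sub)+
  moreover have "lie_solvable A I"
  proof -
    have "{lie_bracket A X Y |X Y. X \<in> I \<and> Y \<in> I} \<subseteq> {0}" using zero I_sub by blast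
    from span_mono[OF this] have "derived_algebra A I \<subseteq> {0}" unfolding derived_algebra_def by simp
    moreover have "0 \<in> derived_algebra A I" unfolding derived_algebra_def by (rule span_zero)
    ultimately have "(derived_algebra A ^^ 1) I = {0}" by auto
    then show ?thesis unfolding lie_solvable_def by blast
  qed
  ultimately have "I = {0}" using assms unfolding lie_semisimple_def by blast
  with in_I[OF central] have "rfield v = 0" by blast
  then have "rfield v one base = 0" by simp
  with v1 show False by simp
qed

text \<open>Finitely many open sets cover the group such that \<open>mul (inver x) y\<close> lies in
  \<open>U\<close> for \<open>x\<close> and \<open>y\<close> in the same set; by the pigeonhole
  principle two terms of the sequence share one.\<close>

lemma compact_recurrence:
  fixes a :: "nat \<Rightarrow> 'a"
  assumes comp: "compact (UNIV :: 'a set)" and U: "open U" "one \<in> U"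
  obtains i j where "i < j" "mul (inver (a i)) (a j) \<in> U"
proof -
  let ?W = "(\<lambda>(x, y). mul (inver x) y) -` U"
  have W: "open ?W"
    by (rule open_vimage[OF U(1)]) (simp add: case_prod_unfold, intro continuous_intros)
  have "\<exists>B. open B \<and> g \<in> B \<and> B \<times> B \<subseteq> ?W" for g
  proof -
    have "(g, g) \<in> ?W" using U(2) by simp
    with W obtain B C where "open B" "open C" "(g, g) \<in> B \<times> C" "B \<times> C \<subseteq> ?W"
      by (rule open_prod_elim)
    then show ?thesis by (intro exI[of _ "B \<inter> C"]) auto
  qed
  then have "\<forall>g. \<exists>B. open B \<and> g \<in> B \<and> B \<times> B \<subseteq> ?W" by blast
  from choice[OF this] obtain B where B: "\<And>g. open (B g)" "\<And>g. g \<in> B g" "\<And>g. B g \<times> B g \<subseteq> ?W"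
    by blast
  obtain G where G: "finite G" "UNIV \<subseteq> (\<Union>g\<in>G. B g)"
  proof (rule compactE_image[OF comp])
    show "open (B g)" for g by (rule B)
    show "UNIV \<subseteq> (\<Union>g\<in>UNIV. B g)" using B(2) by blast
  qed
  then have "\<forall>n. \<exists>g. g \<in> G \<and> a n \<in> B g" by blast
  from choice[OF this] obtain f where f: "\<And>n. f n \<in> G" "\<And>n. a n \<in> B (f n)" by blast
  have "finite (f ` UNIV)" using f(1) G(1) by (meson finite_subset image_subsetI)
  then have "\<not> inj f" using finite_imageD infinite_UNIV_nat by blast
  then obtain i j where ij: "i \<noteq> j" "f i = f j" unfolding inj_def by blast
  have *: "mul (inver (a i)) (a j) \<in> U" if "f i = f j" for i j
    using subsetD[OF B(3), of "(a i, a j)" "f i"] f(2)[of i] f(2)[of j] that by simp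
  show thesis
    using ij *[of i j] *[of j i] that[of i j] that[of j i] by (cases i j rule: linorder_cases) auto
qed

section \<open>Push-forwards by inversion and conjugation\<close>

lemma chart_deriv_chain:
  assumes F: "chart_deriv d (\<lambda>x. F (chart_inv c x)) (snd c (f z)) L" and f:
    "chart_deriv c f z L'" and c: "c \<in> A"
  shows "chart_deriv d (\<lambda>z. F (f z)) z (\<lambda>h. L (L' h))"
proof -
  have f': "isCont f z" "f z \<in> fst c" "((\<lambda>z. snd c (f z)) has_derivative L') (at z)"
    using f by (simp_all add: chart_deriv_def)
  have 1: "chart_deriv d (\<lambda>z. F (chart_inv c (snd c (f z)))) z (\<lambda>h. L (L' h))"
    by (rule chart_deriv_compose[where u="\<lambda>z. snd c (f z)", OF F f'(3)])
  have "eventually (\<lambda>y. f y \<in> fst c) (nhds z)"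
    using f' chart_open[OF c] by (simp add: isCont_def tendsto_def eventually_nhds_conv_at)
  then obtain S where S: "open S" "z \<in> S" "\<And>y. y \<in> S \<Longrightarrow> f y \<in> fst c"
    unfolding eventually_nhds by auto
  show ?thesis by (rule chart_deriv_cong[OF 1 S(1,2)]) (use S c in simp)
qed

text \<open>\<open>L\<close> is existential because in the applications only its value on
  \<open>rfield v\<close> is computed, from an identity between translations.\<close>

lemma pushforward_eq:
  assumes inv: "\<And>x. G (F x) = x" "\<And>y. F (G y) = y"
    and F: "\<And>q c d. \<lbrakk>c \<in> charts_at A (G q); d \<in> charts_at A q\<rbrakk> \<Longrightarrow>
        \<exists>L. chart_deriv d (\<lambda>x. F (chart_inv c x)) (snd c (G q)) L \<and> L (rfield v (G q) c) = W q d"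
    and W: "\<And>q d. d \<notin> charts_at A q \<Longrightarrow> W q d = 0"
  shows "pushforward A F (rfield v) = W"
proof (intro ext)
  fix q d
  have "bij F" using inv by (metis bij_betw_def inj_on_inverseI surjI)
  then have G: "inv F q = G q" by (metis inv_equality inv)
  show "pushforward A F (rfield v) q d = W q d"
  proof (cases "d \<in> charts_at A q")
    case True
    obtain c where c: "c \<in> charts_at A (G q)" by (rule chart_exists)
    then obtain L where L: "chart_deriv d (\<lambda>x. F (chart_inv c x)) (snd c (G q)) L" "L (rfield v
      (G q) c) = W q d"
      using F True by blast
    show ?thesis
      unfolding pushforward_def G using differential_eq[OF c charts_atD(1)[OF True]
        rfield_tangent L(1)] L(2) by simp
  next
    case False
    then show ?thesis
      unfolding pushforward_def G using differential_zero[of d F "G q"] W inv by simp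
  qed
qed

text \<open>Differentiating the product of \<open>x\<close> and \<open>inver x\<close> shows that
  inversion has derivative -1 at the unit. Inverting the right translate of \<open>x\<close> by
  \<open>inver q\<close> gives the left translate of \<open>inver x\<close> by \<open>q\<close>,
  which carries this to \<open>q\<close>.\<close>

lemma pushforward_inver_rfield: "pushforward A inver (rfield v) = - lfield v"
proof (rule pushforward_eq[where G=inver])
  let ?e = "snd base one"
  have ci: "chart_deriv base (chart_inv base) ?e (\<lambda>h. h)" by (rule chart_deriv_chart_inv_at) auto
  have inver_one: "inver one = one" by (rule inverse_unique) simp
  obtain L0 where L0: "chart_deriv base (\<lambda>x. inver (chart_inv base x)) ?e L0"
    using chart_deriv_inver[OF ci, of base] inver_one by auto
  have "chart_deriv base (\<lambda>x. mul (chart_inv base x) (inver (chart_inv base x))) ?e (\<lambda>h. h + L0 h)"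
    using chart_deriv_mul[OF ci L0, of base] inver_one by simp
  then have "chart_deriv base (\<lambda>x. one) ?e (\<lambda>h. h + L0 h)" by simp
  from fun_cong[OF chart_deriv_unique[OF this chart_deriv_const[OF base_in(2)]]]
  have L0_eq: "L0 h = - h" for h by (simp add: eq_neg_iff_add_eq_0 add.commute)
  fix q c d assume c: "c \<in> charts_at A (inver q)" and d: "d \<in> charts_at A q"
  note cd = charts_atD[OF c] charts_atD[OF d]
  obtain L where L: "chart_deriv d (\<lambda>x. inver (chart_inv c x)) (snd c (inver q)) L"
    using chart_deriv_inver[OF chart_deriv_chart_inv_at, of c "inver q" d] cd by auto
  have 1: "chart_deriv c (\<lambda>x. mul (chart_inv base x) (inver q)) ?e (dright base c one (inver q))"
    by (rule chart_deriv_dright_chart) (use cd in auto)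
  have "chart_deriv d (\<lambda>x. inver (mul (chart_inv base x) (inver q))) ?e (\<lambda>h. L
    (dright base c one (inver q) h))"
    by (rule chart_deriv_chain[where F=inver, OF _ 1 cd(1)]) (use L in simp)
  then have 2: "chart_deriv d (\<lambda>x. mul q (inver (chart_inv base x))) ?e (\<lambda>h. L
    (dright base c one (inver q) h))"
    by (simp add: inverse_distrib_swap)
  have 3: "chart_deriv d (\<lambda>x. mul q (inver (chart_inv base x))) ?e (\<lambda>h. dleft base d q one (L0 h))"
    using chart_deriv_dleft[OF L0, of d q] cd inver_one by simp
  have "linear (dleft base d q one)" using bounded_linear_dleft[of base d one q] cd by
    (simp add: bounded_linear.linear)
  with fun_cong[OF chart_deriv_unique[OF 2 3], of v]
  have "L (rfield v (inver q) c) = (- lfield v) q d"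
    using c d by (simp add: rfield_apply lfield_apply L0_eq linear_neg)
  with L show "\<exists>L. chart_deriv d (\<lambda>x. inver (chart_inv c x)) (snd c (inver q)) L \<and> L (rfield v
    (inver q) c) = (- lfield v) q d"
    by blast
qed (simp_all add: lfield_def)

text \<open>Conjugation takes the right translate of \<open>x\<close> by the preimage of
  \<open>q\<close> to the right translate by \<open>q\<close> of the conjugate of \<open>x\<close>;
  differentiate at the unit.\<close>

lemma pushforward_conj_rfield:
  "pushforward A (\<lambda>x. mul (mul g x) (inver g)) (rfield w) = rfield (Ad_base g w)"
proof (rule pushforward_eq[where G="\<lambda>x. mul (mul (inver g) x) g"])
  let ?F = "\<lambda>x. mul (mul g x) (inver g)" and ?G = "\<lambda>x. mul (mul (inver g) x) g"
  show GF: "?G (?F x) = x" for x by (metis assoc left_inverse left_neutral right_neutral)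
  show FG: "?F (?G x) = x" for x by (metis assoc right_inverse left_neutral right_neutral)
  let ?e = "snd base one"
  fix q c d assume c: "c \<in> charts_at A (?G q)" and d: "d \<in> charts_at A q"
  note cd = charts_atD[OF c] charts_atD[OF d]
  obtain k where k: "k \<in> charts_at A (mul g (?G q))" by (rule chart_exists)
  note k' = charts_atD[OF k]
  have "chart_deriv k (\<lambda>x. mul g (chart_inv c x)) (snd c (?G q)) (dleft c k g (?G q))"
    by (rule chart_deriv_dleft_chart) (use cd k' in auto)
  from chart_deriv_dright[OF this, of d "inver g"]
  obtain L where L: "chart_deriv d (\<lambda>x. ?F (chart_inv c x)) (snd c (?G q)) L"
    using cd k' FG[of q] by auto
  have 1: "chart_deriv c (\<lambda>x. mul (chart_inv base x) (?G q)) ?e (dright base c one (?G q))"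
    by (rule chart_deriv_dright_chart) (use cd in auto)
  have "chart_deriv d (\<lambda>x. ?F (mul (chart_inv base x) (?G q))) ?e (\<lambda>h. L (dright base c one
    (?G q) h))"
    by (rule chart_deriv_chain[where F="?F", OF _ 1 cd(1)]) (use L in simp)
  moreover have "?F (mul x (?G q)) = mul (?F x) q" for x
    by (metis assoc right_inverse right_neutral)
  ultimately have 2: "chart_deriv d (\<lambda>x. mul (?F (chart_inv base x)) q) ?e (\<lambda>h. L
    (dright base c one (?G q) h))" by simp
  have 3: "chart_deriv d (\<lambda>x. mul (?F (chart_inv base x)) q) ?e (\<lambda>h. dright base d one q
    (Ad_base g h))"
    using chart_deriv_dright[OF chart_deriv_Ad_base, of d g q] cd by simp
  have "L (rfield w (?G q) c) = rfield (Ad_base g w) q d"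
    using fun_cong[OF chart_deriv_unique[OF 2 3], of w] c d by (simp add: rfield_apply)
  with L show "\<exists>L. chart_deriv d (\<lambda>x. ?F (chart_inv c x)) (snd c (?G q)) L \<and> L (rfield w (?G q)
    c) = rfield (Ad_base g w) q d"
    by blast
qed (simp add: rfield_def)

lemma Ad_rfield: "Ad A mul inver g (rfield w) = rfield (Ad_base g w)"
  using rfield_in_lie_algebra by (simp add: Ad_def pushforward_conj_rfield)

text \<open>The values of \<Gamma> commute, so conjugation by \<open>\<Gamma> s\<close> fixes the
  curve \<Gamma> and with it the velocity \<open>v\<close>.\<close>

lemma Ad_base_one_parameter:
  assumes hom: "\<And>s t. \<Gamma> (s + t) = mul (\<Gamma> s) (\<Gamma> t)" and \<Gamma>: "curve_on UNIV (rfield v) \<Gamma>"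
  shows "Ad_base (\<Gamma> s) v = v"
proof -
  have \<Gamma>0: "\<Gamma> 0 = one" using hom by (rule hom_zero)
  have cd: "chart_deriv base \<Gamma> 0 (\<lambda>h. h *\<^sub>R v)"
    using curve_onD[OF \<Gamma> UNIV_I, of base 0] base_chart \<Gamma>0 by simp
  have "mul (mul (\<Gamma> s) (\<Gamma> t)) (inver (\<Gamma> s)) = \<Gamma> t" for t
    using hom[of s t] hom[of t s] by (metis add.commute assoc right_inverse right_neutral)
  with chart_deriv_conj[OF cd \<Gamma>0, of "\<Gamma> s"]
  have "chart_deriv base \<Gamma> 0 (\<lambda>h. Ad_base (\<Gamma> s) (h *\<^sub>R v))" by simp
  from fun_cong[OF chart_deriv_unique[OF this cd], of 1] show ?thesis by simp
qed

text \<open>By the product rule the first factor contributes \<open>rfield v\<close>. The second has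
  velocity \<open>- rfield v\<close>, which equals \<open>- lfield v\<close> along \<Gamma> because
  \<open>Ad_base\<close> fixes \<open>v\<close> there, and left translation carries it to the
  product.\<close>

lemma curve_on_conj:
  assumes hom: "\<And>s t. \<Gamma> (s + t) = mul (\<Gamma> s) (\<Gamma> t)" and \<Gamma>: "curve_on UNIV (rfield v) \<Gamma>"
    and tangent: "\<And>p. (rfield v - lfield v) p \<in> tangent_space A p"
  shows "curve_on UNIV (rfield v - lfield v) (\<lambda>t. mul (mul (\<Gamma> t) g) (\<Gamma> (- t)))"
proof (rule curve_onI[OF tangent])
  fix t :: real
  let ?p = "mul (\<Gamma> t) g" and ?q = "\<Gamma> (- t)"
  obtain c d k where c: "c \<in> charts_at A ?p" and d: "d \<in> charts_at A ?q" and k: "k \<in> charts_at A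
    (mul ?p ?q)"
    using chart_exists by metis
  note cdk = charts_atD[OF c] charts_atD[OF d] charts_atD[OF k]
  have 1: "chart_deriv c (\<lambda>t. mul (\<Gamma> t) g) t (\<lambda>h. h *\<^sub>R rfield v ?p c)"
    by (rule curve_onD[OF curve_on_mul_right[OF \<Gamma>] UNIV_I c])
  have "((\<lambda>t. - t) has_derivative (\<lambda>h. - h)) (at t)" by (auto intro!: derivative_eq_intros)
  from chart_deriv_compose[OF curve_onD[OF \<Gamma> UNIV_I d] this]
  have 2: "chart_deriv d (\<lambda>t. \<Gamma> (- t)) t (\<lambda>h. (- h) *\<^sub>R rfield v ?q d)" .
  have "linear (dright c k ?p ?q)" "linear (dleft d k ?p ?q)"
    using bounded_linear_dright[of c k ?p ?q] bounded_linear_dleft[of d k ?q ?p] cdk by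
      (simp_all add: bounded_linear.linear)
  moreover have "rfield v ?q = lfield v ?q"
    using rfield_Ad_base[of ?q v] Ad_base_one_parameter[OF hom \<Gamma>] by simp
  ultimately have "dright c k ?p ?q (h *\<^sub>R rfield v ?p c) + dleft d k ?p ?q ((- h)
    *\<^sub>R rfield v ?q d) = h *\<^sub>R (rfield v - lfield v) (mul ?p ?q) k" for h
    using rfield_mul[OF c k, of v] lfield_mul[OF d k, of v] by
      (simp add: linear_cmul linear_neg scaleR_diff_right)
  with chart_deriv_mul[OF 1 2, of k] cdk
  have "chart_deriv k (\<lambda>t. mul (mul (\<Gamma> t) g) (\<Gamma> (- t))) t (\<lambda>h. h *\<^sub>R (rfield v - lfield v)
    (mul ?p ?q) k)" by simp
  with k show "\<exists>c\<in>charts_at A (mul ?p ?q).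
      chart_deriv c (\<lambda>t. mul (mul (\<Gamma> t) g) (\<Gamma> (- t))) t (\<lambda>h. h *\<^sub>R (rfield v - lfield v)
        (mul ?p ?q) c)" by blast
qed

lemma hom_minus:
  assumes "\<And>s t :: real. \<Gamma> (s + t) = mul (\<Gamma> s) (\<Gamma> t)"
  shows "\<Gamma> (- t) = inver (\<Gamma> t)"
  using assms[of t "- t"] hom_zero[OF assms] by (simp add: inverse_unique)

end

context lie_group begin

text \<open>Recurrence brings a quotient of two values \<open>\<Gamma> (n s)\<close> into the
  neighbourhood where the kernel is trivial. The quotient is \<open>\<Gamma> ((j - i) s)\<close>,
  itself in the kernel and at a positive time.\<close>

lemma one_parameter_returns:
  fixes \<Gamma> :: "real \<Rightarrow> 'a"
  assumes comp: "compact (UNIV :: 'a set)" and semi: "lie_semisimple A mul"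
    and hom: "\<And>s t. \<Gamma> (s + t) = mul (\<Gamma> s) (\<Gamma> t)" and s: "s > 0"
    and triv: "\<And>(n::nat) w. rfield w (\<Gamma> (of_nat n * s)) = lfield w (\<Gamma> (of_nat n * s))"
  shows "\<exists>s>0. \<Gamma> s = one"
proof -
  obtain U where U: "open U" "one \<in> U" "\<And>z. \<lbrakk>z \<in> U; \<And>w. rfield w z = lfield w z\<rbrakk> \<Longrightarrow> z = one"
    using semisimple_center_discrete[OF semi] by metis
  obtain i j where ij: "i < j" "mul (inver (\<Gamma> (of_nat i * s))) (\<Gamma> (of_nat j * s)) \<in> U"
    using compact_recurrence[OF comp U(1,2), of "\<lambda>n. \<Gamma> (of_nat n * s)"] by metis
  have "mul (inver (\<Gamma> (of_nat i * s))) (\<Gamma> (of_nat j * s)) = \<Gamma> (- (of_nat i * s) + of_nat j * s)"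
    by (simp only: hom hom_minus[of \<Gamma>, OF hom])
  also have "- (of_nat i * s) + of_nat j * s = of_nat (j - i) * s"
    using ij(1) by (simp add: of_nat_diff algebra_simps)
  finally have "\<Gamma> (of_nat (j - i) * s) = one"
    using ij(2) U(3) triv by simp
  moreover have "of_nat (j - i) * s > 0" using ij(1) s by simp
  ultimately show ?thesis by blast
qed

end

section \<open>Comparison of the four periodicity statements\<close>

theorem proposition4p1:
  fixes mul :: "'a::{t2_space,second_countable_topology} \<Rightarrow> 'a \<Rightarrow> 'a"
    and one :: 'a and inver :: "'a \<Rightarrow> 'a"
    and A :: "('a, 'e::{banach,heine_borel}) chart set"
    and \<X> X :: "('a, 'e) vfield"
    and \<phi> :: "real \<Rightarrow> 'a \<Rightarrow> 'a"
  assumes "lie_group mul one inver A"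
    and "connected (UNIV :: 'a set)"
    and "compact (UNIV :: 'a set)"
    and "lie_semisimple A mul"
    and "linear_vector_field A mul \<X>"
    and "is_flow A \<X> \<phi>"
    and "X \<in> lie_algebra A mul"
    and "\<X> = X + pushforward A inver X"
  defines "inv_flow \<equiv> invariant_flow A mul one X"
    and "D_flow \<equiv> derivation_flow (lie_algebra A mul) (derivation_of A \<X>)"
  shows "((\<forall>g. periodic_curve (\<lambda>t. inv_flow t g)) \<longleftrightarrow> periodic_point inv_flow one) \<and>
         (periodic_point inv_flow one \<longleftrightarrow> (\<forall>g. periodic_point \<phi> g)) \<and>
         ((\<forall>g. periodic_point \<phi> g) \<longleftrightarrow> (\<forall>g. periodic_point D_flow (Ad A mul inver g)))"
proof -
  interpret lie_group mul one inver A by fact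
  define v where "v = X one base"
  have X: "X = rfield v" unfolding v_def by (rule lie_algebra_eq_rfield) fact
  have \<X>: "\<X> = rfield v - lfield v" using assms(8) by (simp add: X pushforward_inver_rfield)
  obtain \<Gamma> where hom: "\<And>s t. \<Gamma> (s + t) = mul (\<Gamma> s) (\<Gamma> t)" and \<Gamma>: "curve_on UNIV (rfield v) \<Gamma>"
    using one_parameter_subgroup[of v] by metis
  have \<Gamma>0: "\<Gamma> 0 = one" using hom by (rule hom_zero)
  have inv_flow: "inv_flow t g = mul (\<Gamma> t) g" for t g
    unfolding inv_flow_def invariant_flow_def X lie_exp_rfield[OF hom \<Gamma>] ..
  have vf: "vector_field A \<X>" using assms(5) by (simp add: linear_vector_field_def)
  \<comment> \<open>Conjugation by \<Gamma> gives an integral curve of the same field, so uniqueness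
    identifies the given flow.\<close>
  have \<phi>: "\<phi> t g = mul (mul (\<Gamma> t) g) (\<Gamma> (- t))" for t g
  proof (rule curve_on_unique[where V=\<X> and I=UNIV and ?t0.0=0 and \<gamma>="\<lambda>t. \<phi> t g"
        and \<delta>="\<lambda>t. mul (mul (\<Gamma> t) g) (\<Gamma> (- t))"])
    show "smooth_on (snd c ` fst c) (\<lambda>x. \<X> (chart_inv c x) c)" if "c \<in> A" for c
      using vf that by (simp add: vector_field_def)
    show "curve_on UNIV \<X> (\<lambda>t. \<phi> t g)" and "\<phi> 0 g = mul (mul (\<Gamma> 0) g) (\<Gamma> (- 0))"
      using assms(6) by (simp_all add: is_flow_def integral_curve_iff \<Gamma>0)
    show "curve_on UNIV \<X> (\<lambda>t. mul (mul (\<Gamma> t) g) (\<Gamma> (- t)))"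
      unfolding \<X> by (rule curve_on_conj[OF hom \<Gamma>]) (use vf in \<open>simp only: vector_field_def \<X>\<close>)
  qed auto
  have D_flow: "D_flow t (Ad A mul inver g) (rfield w) = rfield (Ad_base (\<Gamma> t) (Ad_base g w))"
    for t g w
    using rfield_in_lie_algebra
    by (simp add: D_flow_def derivation_flow_def compose_def Ad_rfield operator_exp_rfield[OF
      hom \<Gamma>] \<X>)
  define P where "P \<longleftrightarrow> (\<exists>s>0. \<Gamma> s = one)"
  have per: "\<exists>s>0. \<forall>t. \<Gamma> (t + s) = \<Gamma> t" if P using that unfolding P_def by (metis hom right_neutral)
  have i: "periodic_curve (\<lambda>t. inv_flow t g) \<longleftrightarrow> P" for g
  proof
    assume "periodic_curve (\<lambda>t. inv_flow t g)"
    then obtain s where "s > 0" "mul (\<Gamma> (0 + s)) g = mul (\<Gamma> 0) g"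
      unfolding periodic_curve_def inv_flow by blast
    then show P unfolding P_def by (metis \<Gamma>0 add_0 assoc right_inverse right_neutral)
  next
    assume P
    then show "periodic_curve (\<lambda>t. inv_flow t g)"
      unfolding periodic_curve_def inv_flow using per by metis
  qed
  have iii: "(\<forall>g. periodic_point \<phi> g) \<longleftrightarrow> P"
  proof
    assume *: "\<forall>g. periodic_point \<phi> g"
    \<comment> \<open>Equality at the times \<open>0\<close> and \<open>s\<close> says that
      \<open>\<Gamma> s\<close> commutes with \<open>g\<close>; here \<open>s\<close> still depends
      on \<open>g\<close>.\<close>
    have "\<exists>s>0. mul (\<Gamma> s) g = mul g (\<Gamma> s)" for g
    proof -
      from * obtain s where s: "s > 0" "\<phi> (0 + s) g = \<phi> 0 g"
        unfolding periodic_point_def periodic_curve_def by blast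
      then have "mul (mul (\<Gamma> s) g) (inver (\<Gamma> s)) = g"
        using hom_minus[OF hom] by (simp add: \<phi> \<Gamma>0)
      then have "mul (\<Gamma> s) g = mul g (\<Gamma> s)" by (metis assoc left_inverse right_neutral)
      with s show ?thesis by blast
    qed
    moreover have "continuous_on UNIV \<Gamma>"
      using \<Gamma> by (simp add: continuous_at_imp_continuous_on curve_on_isCont)
    ultimately obtain q where q: "q > 0" "\<And>g. mul (\<Gamma> q) g = mul g (\<Gamma> q)"
      using pointwise_periodic_imp_central[OF assms(2,3) hom] by blast
    have "mul (\<Gamma> (of_nat n * q)) g = mul g (\<Gamma> (of_nat n * q))" for n :: nat and g
    proof (induction n)
      case (Suc n)
      have "\<Gamma> (of_nat (Suc n) * q) = mul (\<Gamma> q) (\<Gamma> (of_nat n * q))" by (simp add: distrib_right hom)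
      then show ?case by (metis Suc assoc q(2))
    qed (simp add: \<Gamma>0)
    then show P unfolding P_def
      by (intro one_parameter_returns[OF assms(3,4) hom q(1)] rfield_eq_lfield_central)
  next
    assume P
    then obtain s where s: "s > 0" "\<Gamma> s = one" by (auto simp: P_def)
    have "\<Gamma> (t + s) = \<Gamma> t" for t by (simp add: hom s(2))
    moreover from this have "\<Gamma> (- (t + s)) = \<Gamma> (- t)" for t
      by (simp only: hom_minus[of \<Gamma>, OF hom])
    moreover note s(1)
    ultimately show "\<forall>g. periodic_point \<phi> g"
      unfolding periodic_point_def periodic_curve_def \<phi> by metis
  qed
  have iv: "(\<forall>g. periodic_point D_flow (Ad A mul inver g)) \<longleftrightarrow> P"
  proof
    assume "\<forall>g. periodic_point D_flow (Ad A mul inver g)"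
    \<comment> \<open>The instance \<open>g = one\<close>, compared at the times \<open>0\<close>
      and \<open>s\<close>, already yields that \<open>Ad (\<Gamma> s)\<close> is the
      identity.\<close>
    then obtain s where s: "s > 0" "D_flow (0 + s) (Ad A mul inver one) = D_flow 0
      (Ad A mul inver one)"
      unfolding periodic_point_def periodic_curve_def by blast
    have 1: "Ad_base (\<Gamma> s) w = w" for w
    proof -
      have "rfield (Ad_base (\<Gamma> s) w) = rfield w"
        using fun_cong[OF s(2), of "rfield w"] by (simp add: D_flow Ad_base_one \<Gamma>0)
      then show ?thesis by (metis rfield_base)
    qed
    have "Ad_base (\<Gamma> (of_nat n * s)) w = w" for n :: nat and w
      by (induction n) (simp_all add: \<Gamma>0 Ad_base_one distrib_right hom Ad_base_mul 1)
    then show P unfolding P_def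
      using rfield_Ad_base by (intro one_parameter_returns[OF assms(3,4) hom s(1)]) metis
  next
    assume P
    then obtain s where s: "s > 0" "\<And>t. \<Gamma> (t + s) = \<Gamma> t" using per by blast
    have "D_flow (t + s) (Ad A mul inver g) = D_flow t (Ad A mul inver g)" for t g
    proof
      fix Y
      show "D_flow (t + s) (Ad A mul inver g) Y = D_flow t (Ad A mul inver g) Y"
      \<comment> \<open>Outside the Lie algebra \<open>compose\<close> makes both sides
        \<open>undefined\<close>.\<close>
      proof (cases "Y \<in> lie_algebra A mul")
        case True
        then show ?thesis unfolding lie_algebra_rfield by (auto simp: D_flow s(2))
      qed (simp add: D_flow_def derivation_flow_def compose_def)
    qed
    with s(1) show "\<forall>g. periodic_point D_flow (Ad A mul inver g)"
      unfolding periodic_point_def periodic_curve_def by blast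
  qed
  show ?thesis using i iii iv unfolding periodic_point_def by blast
qed

end
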